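(* For $n_1,n_2\in\mathbb Z$ and $(\nu_1,\nu_2)\in\mathbb C^2$ in the region of absolute convergence, let $$\mathcal R_{\nu_1,\nu_2}(n_1,n_2)=\sum_{v_1,v_{12}\ge1}v_1^{-\nu_1}v_{12}^{-\nu_2}\sum e\Bigl(\frac{n_1v_2}{v_1}+\frac{n_2v_{14}}{v_{12}}\Bigr),$$ where the inner sum is over all $v_2,v_3,v_4\in\{0,\dots,v_1-1\}$ and $v_{14}\in\{0,\dots,v_{12}-1\}$ such that $$v_{13}:=\frac{v_4v_{12}-v_2v_{14}}{v_1},\qquad v_{23}:=\frac{v_2v_{13}-v_3v_{12}}{v_1},\qquad v_{34}:=\frac{v_3v_{14}-v_4v_{13}}{v_1}$$ are integers, $\gcd(v_1,v_2,v_3,v_4)=1$ and $\gcd(v_{12},v_{13},v_{14},v_{23},v_{34})=1$. Then $\mathcal R_{\nu_1,\nu_2}(n_1,n_2)$ evaluates as follows. For $n_1,n_2\ne0$: $$\mathcal R_{\nu_1,\nu_2}(n_1,n_2)=\frac{\sigma_{3/2-\nu_1/2-\nu_2,\;1/2-\nu_1/2}(n_1,n_2)}{\zeta(\nu_1)\zeta(\nu_2)\zeta(\nu_1+\nu_2-1)\zeta(\nu_1+2\nu_2-2)}.$$ For $n_1\ne0$, $n_2=0$: $$\mathcal R_{\nu_1,\nu_2}(n_1,0)=\frac{\sigma_{1-\nu_1}(n_1)}{\zeta(\nu_1)}\frac{\zeta(\nu_2-1)}{\zeta(\nu_2)}\frac{\zeta(\nu_1+\nu_2-2)}{\zeta(\nu_1+\nu_2-1)}\frac{\zeta(\nu_1+2\nu_2-3)}{\zeta(\nu_1+2\nu_2-2)}.$$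 For $n_1=0$, $n_2\ne0$: $$\mathcal R_{\nu_1,\nu_2}(0,n_2)=\frac{\sigma_{1-\nu_2}(n_2)}{\zeta(\nu_2)}\frac{\zeta(\nu_1-1)}{\zeta(\nu_1)}\frac{\zeta(\nu_1+\nu_2-2)}{\zeta(\nu_1+\nu_2-1)}\frac{\zeta(\nu_1+2\nu_2-3)}{\zeta(\nu_1+2\nu_2-2)}.$$ For $n_1=n_2=0$: $$\mathcal R_{\nu_1,\nu_2}(0,0)=\frac{\zeta(\nu_1-1)}{\zeta(\nu_1)}\frac{\zeta(\nu_2-1)}{\zeta(\nu_2)}\frac{\zeta(\nu_1+\nu_2-2)}{\zeta(\nu_1+\nu_2-1)}\frac{\zeta(\nu_1+2\nu_2-3)}{\zeta(\nu_1+2\nu_2-2)}.$$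
   Context: $e(x)=e^{2\pi ix}$; $\zeta$ is the Riemann zeta function; $\sigma_\nu(m)=\sum_{d\mid m}d^\nu$ (positive divisors). For nonzero integers $n_1,n_2$, $\sigma_{\mu_1,\mu_2}(n_1,n_2)=\prod_p\sigma_{\mu_1,\mu_2}(p^{\mathrm{ord}_pn_1},p^{\mathrm{ord}_pn_2})$, where $$\sigma_{\mu_1,\mu_2}(p^{e_1},p^{e_2})=p^{(e_1+e_2)\mu_1+e_1\mu_2}\,\mathrm{Sp}_{e_1+e_2,e_1}(p^{\mu_1},p^{\mu_2}),$$ and for integers $\lambda_1\ge\lambda_2\ge0$ the symplectic Schur function is $$\mathrm{Sp}_{\lambda_1,\lambda_2}(x_1,x_2)=\frac{\begin{vmatrix} x_1^{\lambda_1+2}-x_1^{-(\lambda_1+2)} & x_2^{\lambda_1+2}-x_2^{-(\lambda_1+2)} \\ {x_1^{\lambda_2+1}-x_1^{-(\lambda_2+1)}} & x_2^{\lambda_2+1}-x_2^{-(\lambda_2+1)} \end{vmatrix}}{\begin{vmatrix} x_1^2-x_1^{-2} & x_2^2-x_2^{-2} \\ {x_1-x_1^{-1}} & x_2-x_2^{-1} \end{vmatrix}}$$ (a Laurent polynomial in $x_1,x_2$). *)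

theory Defs
  imports "HOL-Analysis.Analysis" "HOL-Computational_Algebra.Computational_Algebra"
begin

text \<open>
  The Riemann zeta function on the whole plane (its value at the pole \<open>s = 1\<close> is
  irrelevant): the Dirichlet series for \<open>Re s > 1\<close>, and elsewhere its analytic
  continuation, which is unique because the punctured plane is connected.
\<close>

definition zeta_series :: "complex \<Rightarrow> complex" where
  "zeta_series s = (\<Sum>n. 1 / of_nat (Suc n) powr s)"

definition riemann_zeta :: "complex \<Rightarrow> complex" where
  "riemann_zeta s =
     (if Re s > 1 then zeta_series s
      else (THE z. \<exists>f. f holomorphic_on (- {1}) \<and>
                       (\<forall>w. Re w > 1 \<longrightarrow> f w = zeta_series w) \<and> f s = z))"

definition e2pi :: "real \<Rightarrow> complex" where
  "e2pi x = exp (2 * of_real pi * \<i> * of_real x)"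

definition sigma1 :: "complex \<Rightarrow> int \<Rightarrow> complex" where
  "sigma1 \<nu> m = (\<Sum>d | d > 0 \<and> d dvd m. of_int d powr \<nu>)"

definition sp_entry :: "nat \<Rightarrow> complex \<Rightarrow> complex" where
  "sp_entry k x = x ^ k - 1 / x ^ k"

definition sp_det :: "nat \<Rightarrow> nat \<Rightarrow> complex \<times> complex \<Rightarrow> complex" where
  "sp_det k l = (\<lambda>(x\<^sub>1, x\<^sub>2). sp_entry k x\<^sub>1 * sp_entry l x\<^sub>2 - sp_entry k x\<^sub>2 * sp_entry l x\<^sub>1)"

text \<open>
  The quotient of determinants is a Laurent polynomial; where the denominator vanishes
  its value is the limit of the quotient.  Meant for \<open>l\<^sub>1 \<ge> l\<^sub>2\<close> and nonzero arguments.
\<close>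

definition Sp :: "nat \<Rightarrow> nat \<Rightarrow> complex \<Rightarrow> complex \<Rightarrow> complex" where
  "Sp l\<^sub>1 l\<^sub>2 x\<^sub>1 x\<^sub>2 =
     (if sp_det 2 1 (x\<^sub>1, x\<^sub>2) \<noteq> 0
      then sp_det (l\<^sub>1 + 2) (l\<^sub>2 + 1) (x\<^sub>1, x\<^sub>2) / sp_det 2 1 (x\<^sub>1, x\<^sub>2)
      else Lim (at (x\<^sub>1, x\<^sub>2) within {y. sp_det 2 1 y \<noteq> 0})
             (\<lambda>y. sp_det (l\<^sub>1 + 2) (l\<^sub>2 + 1) y / sp_det 2 1 y))"

definition sigma2_local :: "complex \<Rightarrow> complex \<Rightarrow> int \<Rightarrow> nat \<Rightarrow> nat \<Rightarrow> complex" where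
  "sigma2_local \<mu>\<^sub>1 \<mu>\<^sub>2 p e\<^sub>1 e\<^sub>2 =
     of_int p powr (of_nat (e\<^sub>1 + e\<^sub>2) * \<mu>\<^sub>1 + of_nat e\<^sub>1 * \<mu>\<^sub>2)
     * Sp (e\<^sub>1 + e\<^sub>2) e\<^sub>1 (of_int p powr \<mu>\<^sub>1) (of_int p powr \<mu>\<^sub>2)"

text \<open>
  The product over all primes is restricted to the primes dividing \<open>n\<^sub>1 n\<^sub>2\<close>; at every
  other prime both exponents are 0 and the local factor is 1.
\<close>

definition sigma2 :: "complex \<Rightarrow> complex \<Rightarrow> int \<Rightarrow> int \<Rightarrow> complex" where
  "sigma2 \<mu>\<^sub>1 \<mu>\<^sub>2 n\<^sub>1 n\<^sub>2 =
     (\<Prod>p | prime p \<and> p dvd n\<^sub>1 * n\<^sub>2.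
        sigma2_local \<mu>\<^sub>1 \<mu>\<^sub>2 p (multiplicity p n\<^sub>1) (multiplicity p n\<^sub>2))"

text \<open>
  Quadruples \<open>(v\<^sub>2, v\<^sub>3, v\<^sub>4, v\<^sub>1\<^sub>4)\<close>.  Each divisibility by \<open>v\<^sub>1\<close> says that the quotient defining
  \<open>v\<^sub>1\<^sub>3\<close>, \<open>v\<^sub>2\<^sub>3\<close> or \<open>v\<^sub>3\<^sub>4\<close> is an integer, so that the corresponding \<open>div\<close> is exact.
\<close>

definition R_index :: "int \<Rightarrow> int \<Rightarrow> (int \<times> int \<times> int \<times> int) set" where
  "R_index v\<^sub>1 v\<^sub>1\<^sub>2 =
     {(v\<^sub>2, v\<^sub>3, v\<^sub>4, v\<^sub>1\<^sub>4).
        v\<^sub>2 \<in> {0..<v\<^sub>1} \<and> v\<^sub>3 \<in> {0..<v\<^sub>1} \<and> v\<^sub>4 \<in> {0..<v\<^sub>1} \<and> v\<^sub>1\<^sub>4 \<in> {0..<v\<^sub>1\<^sub>2} \<and>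
        (let v\<^sub>1\<^sub>3 = (v\<^sub>4 * v\<^sub>1\<^sub>2 - v\<^sub>2 * v\<^sub>1\<^sub>4) div v\<^sub>1;
             v\<^sub>2\<^sub>3 = (v\<^sub>2 * v\<^sub>1\<^sub>3 - v\<^sub>3 * v\<^sub>1\<^sub>2) div v\<^sub>1;
             v\<^sub>3\<^sub>4 = (v\<^sub>3 * v\<^sub>1\<^sub>4 - v\<^sub>4 * v\<^sub>1\<^sub>3) div v\<^sub>1
         in v\<^sub>1 dvd v\<^sub>4 * v\<^sub>1\<^sub>2 - v\<^sub>2 * v\<^sub>1\<^sub>4 \<and>
            v\<^sub>1 dvd v\<^sub>2 * v\<^sub>1\<^sub>3 - v\<^sub>3 * v\<^sub>1\<^sub>2 \<and>
            v\<^sub>1 dvd v\<^sub>3 * v\<^sub>1\<^sub>4 - v\<^sub>4 * v\<^sub>1\<^sub>3 \<and>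
            Gcd {v\<^sub>1, v\<^sub>2, v\<^sub>3, v\<^sub>4} = 1 \<and>
            Gcd {v\<^sub>1\<^sub>2, v\<^sub>1\<^sub>3, v\<^sub>1\<^sub>4, v\<^sub>2\<^sub>3, v\<^sub>3\<^sub>4} = 1)}"

definition R_term :: "complex \<Rightarrow> complex \<Rightarrow> int \<Rightarrow> int \<Rightarrow> int \<times> int \<Rightarrow> complex" where
  "R_term \<nu>\<^sub>1 \<nu>\<^sub>2 n\<^sub>1 n\<^sub>2 = (\<lambda>(v\<^sub>1, v\<^sub>1\<^sub>2).
     of_int v\<^sub>1 powr (- \<nu>\<^sub>1) * of_int v\<^sub>1\<^sub>2 powr (- \<nu>\<^sub>2)
     * (\<Sum>(v\<^sub>2, v\<^sub>3, v\<^sub>4, v\<^sub>1\<^sub>4) \<in> R_index v\<^sub>1 v\<^sub>1\<^sub>2.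
          e2pi (of_int (n\<^sub>1 * v\<^sub>2) / of_int v\<^sub>1 + of_int (n\<^sub>2 * v\<^sub>1\<^sub>4) / of_int v\<^sub>1\<^sub>2)))"

definition Rseries :: "complex \<Rightarrow> complex \<Rightarrow> int \<Rightarrow> int \<Rightarrow> complex" where
  "Rseries \<nu>\<^sub>1 \<nu>\<^sub>2 n\<^sub>1 n\<^sub>2 = (\<Sum>\<^sub>\<infinity>v \<in> {1..} \<times> {1..}. R_term \<nu>\<^sub>1 \<nu>\<^sub>2 n\<^sub>1 n\<^sub>2 v)"

text \<open>
  Absolute convergence of the double series over \<open>(v\<^sub>1, v\<^sub>1\<^sub>2)\<close>, with the finite inner sum taken
  as part of the term.  The region depends on which of \<open>n\<^sub>1\<close>, \<open>n\<^sub>2\<close> vanish, and it contains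
  the region where the series of all individual exponentials converges absolutely.
\<close>

definition R_abs_conv :: "int \<Rightarrow> int \<Rightarrow> (complex \<times> complex) set" where
  "R_abs_conv n\<^sub>1 n\<^sub>2 =
     {(\<nu>\<^sub>1, \<nu>\<^sub>2). (\<lambda>v. norm (R_term \<nu>\<^sub>1 \<nu>\<^sub>2 n\<^sub>1 n\<^sub>2 v)) summable_on {1..} \<times> {1..}}"

end

theory Submission
  imports Defs
begin

text \<open>
  Write \<open>A(v, w)\<close> for the inner sum with \<open>v = v\<^sub>1\<close> and \<open>w = v\<^sub>1\<^sub>2\<close>, and \<open>B(v, w)\<close> for the same sum without
  the two coprimality conditions. The integrality conditions are homogeneous in \<open>(v\<^sub>1, v\<^sub>2, v\<^sub>3, v\<^sub>4)\<close> and in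
  \<open>(v\<^sub>1\<^sub>2, v\<^sub>1\<^sub>3, v\<^sub>1\<^sub>4, v\<^sub>2\<^sub>3, v\<^sub>3\<^sub>4)\<close>, so \<open>B(v, w)\<close> is the sum of \<open>A(v / d, w / c)\<close> over the divisors \<open>d\<close> of \<open>v\<close> and \<open>c\<close> of
  \<open>w\<close> (\<open>loose_sum_eq_flag_sums\<close>), and the Dirichlet series of \<open>B\<close> is \<open>\<zeta>(\<nu>\<^sub>1) \<zeta>(\<nu>\<^sub>2)\<close> times the series in
  question (\<open>loose_series\<close>).

  For fixed \<open>(v\<^sub>1\<^sub>2, v\<^sub>1\<^sub>4)\<close> with gcd \<open>g\<close>, a unimodular change of the variables \<open>(v\<^sub>2, v\<^sub>4)\<close> evaluates the sum over
  \<open>(v\<^sub>2, v\<^sub>3, v\<^sub>4)\<close>, and the result depends on \<open>v\<^sub>1\<^sub>4\<close> only through \<open>g\<close> (\<open>sum_over_line_eq_fibre_sum\<close>). Hence \<open>B(v, w)\<close>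
  is a divisor sum of Ramanujan sums times these fibre sums (\<open>loose_sum_eq\<close>). Both are multiplicative,
  so the Dirichlet series of \<open>B\<close> has an Euler product (\<open>euler_product_tendsto\<close>), and the sums at prime
  powers are weighted counts of integers in explicit ranges (\<open>fibre_sum_prime_power\<close>).

  With \<open>X = p^(-\<nu>\<^sub>1)\<close>, \<open>Y = p^(-\<nu>\<^sub>2)\<close>, \<open>x = p X\<close>, \<open>y = p Y\<close>, the generating function of \<open>B(p^k, p^l)\<close> is summed by
  geometric series. It equals
  \<open>(1 - p X Y) (1 - p\<^sup>2 X Y\<^sup>2) N / ((1 - x) (1 - y) (1 - x y) (1 - x y\<^sup>2))\<close>, where \<open>N\<close> is the numerator of the Weyl
  character formula for \<open>Sp\<^sub>4\<close> at the simple roots \<open>x\<close>, \<open>y\<close> and the highest weight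
  \<open>(ord\<^sub>p n\<^sub>1 + ord\<^sub>p n\<^sub>2, ord\<^sub>p n\<^sub>1)\<close> (\<open>has_sum_loose_local\<close>). The quotient of \<open>N\<close> by the four binomials is the local
  factor of \<open>\<sigma>\<close> (\<open>sigma2_local_eq\<close>), and the two remaining factors give \<open>1 / \<zeta>(\<nu>\<^sub>1 + \<nu>\<^sub>2 - 1)\<close> and
  \<open>1 / \<zeta>(\<nu>\<^sub>1 + 2 \<nu>\<^sub>2 - 2)\<close>. If \<open>n\<^sub>1\<close> or \<open>n\<^sub>2\<close> is zero, then it behaves like an infinite power of \<open>p\<close>: in the limit the
  corresponding powers drop out of \<open>N\<close> (\<open>has_sum_loose_local_general\<close>), and the binomials in the
  denominator supply the additional zeta functions.

  All these series converge, because absolute convergence restricted to the terms \<open>(p, 1)\<close> and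
  \<open>(1, p)\<close> with \<open>p\<close> prime already forces \<open>Re \<nu>\<^sub>i > 1\<close>, and \<open>Re \<nu>\<^sub>i > 2\<close> if \<open>n\<^sub>i = 0\<close> (\<open>R_abs_conv_imp_Re\<close>). In this
  region \<open>x\<close> and \<open>y\<close> have norm less than \<open>1\<close>, so that no denominator vanishes.
\<close>

section \<open>Additive characters and sums over residues\<close>

lemma e2pi_add: "e2pi (x + y) = e2pi x * e2pi y"
  by (simp add: e2pi_def ring_distribs exp_add)

lemma e2pi_of_int [simp]: "e2pi (of_int k) = 1"
  unfolding e2pi_def
  using exp_2pi_1_int[of k] by (simp add: mult_ac)

lemma e2pi_0 [simp]: "e2pi 0 = 1" by (simp add: e2pi_def)

lemma e2pi_eq_1D: assumes "e2pi x = 1" shows "\<exists>k::int. x = of_int k"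
proof -
  from assms obtain n :: int where "Im (2 * of_real pi * \<i> * of_real x) = of_int (2 * n) * pi"
    unfolding e2pi_def exp_eq_1 by blast
  hence "2 * pi * x = 2 * pi * of_int n" by simp
  thus ?thesis by auto
qed

definition char_mod :: "int \<Rightarrow> int \<Rightarrow> complex" where
  "char_mod n r = e2pi (of_int r / of_int n)"

lemma char_mod_add: "char_mod n (r + s) = char_mod n r * char_mod n s"
  by (simp add: char_mod_def add_divide_distrib e2pi_add)

lemma char_mod_0 [simp]: "char_mod n 0 = 1" by (simp add: char_mod_def)

lemma char_mod_multiple: "n dvd r \<Longrightarrow> char_mod n r = 1"
  by (cases "n = 0") (auto simp: char_mod_def elim!: dvdE)

lemma char_mod_cong: assumes "n dvd r - s" shows "char_mod n r = char_mod n s"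
  using char_mod_add[of n "r - s" s] char_mod_multiple[OF assms] by simp

lemma char_mod_mult_cancel: "d \<noteq> 0 \<Longrightarrow> char_mod (d * n) (d * r) = char_mod n r"
  by (simp add: char_mod_def)

lemma char_mod_eq_1D: assumes "char_mod n r = 1" "n \<noteq> 0" shows "n dvd r"
proof -
  obtain k :: int where "of_int r / of_int n = (of_int k :: real)"
    using e2pi_eq_1D assms unfolding char_mod_def by blast
  hence "real_of_int r = of_int (k * n)" using assms(2) by (simp add: field_simps)
  hence "r = k * n" using of_int_eq_iff by blast
  thus ?thesis by simp
qed

text \<open>
  An affine map with unit slope permutes the residues modulo \<open>n\<close>.
\<close>

lemma sum_residues_affine:
  fixes F :: "int \<Rightarrow> complex"
  assumes n: "n > 0" and per: "\<And>x y. n dvd x - y \<Longrightarrow> F x = F y" and u: "coprime u n"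
  shows "(\<Sum>x\<in>{0..<n}. F (u * x + t)) = (\<Sum>x\<in>{0..<n}. F x)"
proof -
  have inj: "inj_on (\<lambda>x. (u * x + t) mod n) {0..<n}"
  proof (rule inj_onI)
    fix x y assume xy: "x \<in> {0..<n}" "y \<in> {0..<n}" "(u * x + t) mod n = (u * y + t) mod n"
    hence "n dvd u * (x - y)" by (metis mod_eq_dvd_iff add_diff_cancel_right right_diff_distrib')
    hence "n dvd x - y" using u by (metis coprime_commute coprime_dvd_mult_right_iff)
    thus "x = y" using xy by (metis atLeastLessThan_iff mod_eq_dvd_iff mod_pos_pos_trivial)
  qed
  have img: "(\<lambda>x. (u * x + t) mod n) ` {0..<n} = {0..<n}"
    by (rule endo_inj_surj[OF _ _ inj]) (use n in auto)
  have "(\<Sum>x\<in>{0..<n}. F x) = (\<Sum>x\<in>{0..<n}. F ((u * x + t) mod n))"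
    using sum.reindex[OF inj, of F] img by simp
  also have "\<dots> = (\<Sum>x\<in>{0..<n}. F (u * x + t))"
    by (intro sum.cong refl per) (metis mod_eq_dvd_iff mod_mod_trivial)
  finally show ?thesis by simp
qed

text \<open>
  By the Chinese remainder theorem \<open>(x, y) \<mapsto> x n + y m\<close> enumerates the residues modulo \<open>m n\<close>.
  This form of the isomorphism splits the character modulo \<open>m n\<close> without the twists by
  units that the usual form produces.
\<close>

lemma sum_residues_crt:
  fixes F :: "int \<Rightarrow> complex"
  assumes m: "m > 0" and n: "n > 0" and co: "coprime m n"
    and per: "\<And>x y. m * n dvd x - y \<Longrightarrow> F x = F y"
  shows "(\<Sum>x\<in>{0..<m * n}. F x) = (\<Sum>x\<in>{0..<m}. \<Sum>y\<in>{0..<n}. F (x * n + y * m))"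
proof -
  let ?g = "\<lambda>(x, y). (x * n + y * m) mod (m * n)"
  have inj: "inj_on ?g ({0..<m} \<times> {0..<n})"
  proof (rule inj_onI, clarify)
    fix x y x' y'
    assume r: "x \<in> {0..<m}" "y \<in> {0..<n}" "x' \<in> {0..<m}" "y' \<in> {0..<n}"
      and e: "(x * n + y * m) mod (m * n) = (x' * n + y' * m) mod (m * n)"
    have d: "m * n dvd (x - x') * n + (y - y') * m"
      using e[unfolded mod_eq_dvd_iff] by (simp add: algebra_simps)
    have "m dvd (x - x') * n + (y - y') * m" using d dvd_mult_left by blast
    hence "m dvd (x - x') * n" by (simp add: dvd_add_left_iff)
    hence 1: "m dvd x - x'" using co by (metis coprime_dvd_mult_left_iff)
    have "n dvd (x - x') * n + (y - y') * m" using d dvd_mult_right by blast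
    hence "n dvd (y - y') * m" by (simp add: dvd_add_right_iff)
    hence 2: "n dvd y - y'" using co by (metis coprime_commute coprime_dvd_mult_left_iff)
    show "x = x' \<and> y = y'" using 1 2 r
      by (metis atLeastLessThan_iff mod_eq_dvd_iff mod_pos_pos_trivial)
  qed
  have img: "?g ` ({0..<m} \<times> {0..<n}) = {0..<m * n}"
  proof (rule card_subset_eq)
    show "?g ` ({0..<m} \<times> {0..<n}) \<subseteq> {0..<m * n}" using m n by auto
    show "card (?g ` ({0..<m} \<times> {0..<n})) = card {0..<m * n}"
      using m n by (subst card_image[OF inj]) (simp add: card_cartesian_product nat_mult_distrib)
  qed auto
  have "(\<Sum>x\<in>{0..<m * n}. F x) = (\<Sum>z\<in>{0..<m} \<times> {0..<n}. F (?g z))"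
    using sum.reindex[OF inj, of F] img by simp
  also have "\<dots> = (\<Sum>z\<in>{0..<m} \<times> {0..<n}. F (fst z * n + snd z * m))"
    by (intro sum.cong refl) (auto intro!: per simp: mod_eq_dvd_iff[symmetric])
  also have "\<dots> = (\<Sum>x\<in>{0..<m}. \<Sum>y\<in>{0..<n}. F (x * n + y * m))"
    by (simp add: sum.cartesian_product split_def)
  finally show ?thesis .
qed

lemma sum_residues_unimodular:
  fixes F :: "int \<Rightarrow> int \<Rightarrow> complex"
  assumes n: "n > 0" and per: "\<And>x y x' y'. n dvd x - x' \<Longrightarrow> n dvd y - y' \<Longrightarrow> F x y = F x' y'"
    and det: "\<alpha> * \<delta> - \<beta> * \<gamma> = 1"
  shows "(\<Sum>x\<in>{0..<n}. \<Sum>y\<in>{0..<n}. F (\<alpha> * x + \<beta> * y) (\<gamma> * x + \<delta> * y))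
       = (\<Sum>x\<in>{0..<n}. \<Sum>y\<in>{0..<n}. F x y)"
proof -
  let ?g = "\<lambda>(x, y). ((\<alpha> * x + \<beta> * y) mod n, (\<gamma> * x + \<delta> * y) mod n)"
  have inj: "inj_on ?g ({0..<n} \<times> {0..<n})"
  proof (rule inj_onI, clarify)
    fix x y x' y'
    assume r: "x \<in> {0..<n}" "y \<in> {0..<n}" "x' \<in> {0..<n}" "y' \<in> {0..<n}"
      and e: "(\<alpha> * x + \<beta> * y) mod n = (\<alpha> * x' + \<beta> * y') mod n"
        "(\<gamma> * x + \<delta> * y) mod n = (\<gamma> * x' + \<delta> * y') mod n"
    have d: "n dvd \<alpha> * (x - x') + \<beta> * (y - y')" "n dvd \<gamma> * (x - x') + \<delta> * (y - y')"
      using e[unfolded mod_eq_dvd_iff] by (simp_all add: algebra_simps)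
    have "n dvd \<delta> * (\<alpha> * (x - x') + \<beta> * (y - y')) - \<beta> * (\<gamma> * (x - x') + \<delta> * (y - y'))"
      using d by (intro dvd_diff dvd_mult)
    also have "\<dots> = (\<alpha> * \<delta> - \<beta> * \<gamma>) * (x - x')" by (simp add: algebra_simps)
    finally have 1: "n dvd x - x'" by (simp add: det)
    have "n dvd \<alpha> * (\<gamma> * (x - x') + \<delta> * (y - y')) - \<gamma> * (\<alpha> * (x - x') + \<beta> * (y - y'))"
      using d by (intro dvd_diff dvd_mult)
    also have "\<dots> = (\<alpha> * \<delta> - \<beta> * \<gamma>) * (y - y')" by (simp add: algebra_simps)
    finally have 2: "n dvd y - y'" by (simp add: det)
    show "x = x' \<and> y = y'" using 1 2 r
      by (metis atLeastLessThan_iff mod_eq_dvd_iff mod_pos_pos_trivial)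
  qed
  have img: "?g ` ({0..<n} \<times> {0..<n}) = {0..<n} \<times> {0..<n}"
    by (rule endo_inj_surj[OF _ _ inj]) (use n in auto)
  have "(\<Sum>x\<in>{0..<n}. \<Sum>y\<in>{0..<n}. F x y) = (\<Sum>z\<in>{0..<n}\<times>{0..<n}. case z of (x, y) \<Rightarrow> F x y)"
    by (simp add: sum.cartesian_product)
  also have "\<dots> = (\<Sum>z\<in>{0..<n}\<times>{0..<n}. case ?g z of (x, y) \<Rightarrow> F x y)"
    using sum.reindex[OF inj, of "\<lambda>z. case z of (x, y) \<Rightarrow> F x y"] img by (simp add: o_def)
  also have "\<dots> = (\<Sum>(x, y)\<in>{0..<n}\<times>{0..<n}. F (\<alpha> * x + \<beta> * y) (\<gamma> * x + \<delta> * y))"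
    by (intro sum.cong refl) (auto intro!: per simp: mod_eq_dvd_iff[symmetric])
  finally show ?thesis by (simp add: sum.cartesian_product)
qed

lemma sum_residues_multiples:
  fixes F :: "int \<Rightarrow> complex"
  assumes d: "d > 0"
  shows "(\<Sum>x\<in>{0..<d * m}. if d dvd x then F x else 0) = (\<Sum>y\<in>{0..<m}. F (d * y))"
proof -
  have "(\<Sum>x\<in>{0..<d * m}. if d dvd x then F x else 0) = (\<Sum>x\<in>{x \<in> {0..<d * m}. d dvd x}. F x)"
    by (rule sum.inter_filter[symmetric]) simp
  also have "{x \<in> {0..<d * m}. d dvd x} = (\<lambda>y. d * y) ` {0..<m}"
    using d by (auto elim!: dvdE simp: zero_le_mult_iff)
  also have "(\<Sum>x\<in>\<dots>. F x) = (\<Sum>y\<in>{0..<m}. F (d * y))"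
    using d by (subst sum.reindex) (auto simp: inj_on_def)
  finally show ?thesis .
qed

lemma sum_char_mod:
  assumes n: "n > 0"
  shows "(\<Sum>x\<in>{0..<n}. char_mod n (k * x)) = (if n dvd k then of_int n else 0)"
proof (cases "n dvd k")
  case True
  thus ?thesis using n by (simp add: char_mod_multiple)
next
  case False
  have "(\<Sum>x\<in>{0..<n}. char_mod n (k * (1 * x + 1))) = (\<Sum>x\<in>{0..<n}. char_mod n (k * x))"
    by (rule sum_residues_affine[OF n]) (auto intro!: char_mod_cong simp: right_diff_distrib'[symmetric])
  hence "(\<Sum>x\<in>{0..<n}. char_mod n (k * x)) = char_mod n k * (\<Sum>x\<in>{0..<n}. char_mod n (k * x))"
    by (simp add: ring_distribs char_mod_add sum_distrib_left mult_ac)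
  moreover have "char_mod n k \<noteq> 1" using char_mod_eq_1D False n by auto
  ultimately show ?thesis using False by simp
qed

section \<open>The sum over a fibre\<close>

lemma gcd_cofactors:
  fixes a b :: int assumes "a > 0"
  obtains a' b' where "a = gcd a b * a'" "b = gcd a b * b'" "coprime a' b'"
  using gcd_coprime_exists[of a b] assms by (auto simp: mult.commute)

text \<open>
  Dividing by \<open>gcd v g\<close> makes the coefficient invertible, so the solutions form one class
  modulo \<open>v div gcd v g\<close>.
\<close>

lemma card_linear_congruence:
  fixes v g y :: int
  assumes v: "v > 0"
  shows "of_nat (card {x \<in> {0..<v}. v dvd y - x * g}) =
     (if gcd v g dvd y then of_int (gcd v g) else (0::complex))"
proof (cases "gcd v g dvd y")
  case False
  have "{x \<in> {0..<v}. v dvd y - x * g} = {}"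
  proof -
    have "gcd v g dvd y" if "v dvd y - x * g" for x
    proof -
      have "gcd v g dvd (y - x * g) + x * g"
        using that by (intro dvd_add) (auto intro: dvd_trans)
      thus ?thesis by simp
    qed
    thus ?thesis using False by blast
  qed
  hence "card {x \<in> {0..<v}. v dvd y - x * g} = 0" by (metis card.empty)
  thus ?thesis using False by (simp del: card_eq_0_iff)
next
  case True
  define h where "h = gcd v g"
  have h: "h > 0" using v by (simp add: h_def)
  obtain v' g' where v': "v = h * v'" and g': "g = h * g'" and co: "coprime v' g'"
    unfolding h_def by (rule gcd_cofactors[OF v])
  obtain y' where y': "y = h * y'" using True unfolding h_def by (meson dvdE)
  obtain r s where rs: "r * v' + s * g' = 1" using co bezout_int[of v' g'] by auto
  define x0 where "x0 = s * y'"
  have x0: "v dvd x0 * g - y"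
  proof -
    have "x0 * g - y = h * y' * (s * g' - 1)" by (simp add: x0_def g' y' algebra_simps)
    also have "s * g' - 1 = - (r * v')" using rs by simp
    also have "h * y' * - (r * v') = v * (- r * y')" by (simp add: v')
    finally show ?thesis by simp
  qed
  have eq: "v dvd y - (1 * x + x0) * g \<longleftrightarrow> v' dvd x" for x
  proof -
    have "v dvd y - (1 * x + x0) * g \<longleftrightarrow> v dvd (y - (1 * x + x0) * g) + (x0 * g - y)"
      by (rule dvd_add_left_iff[OF x0, symmetric])
    also have "(y - (1 * x + x0) * g) + (x0 * g - y) = - (h * (g' * x))" by (simp add: g' algebra_simps)
    also have "v dvd - (h * (g' * x)) \<longleftrightarrow> v' dvd x"
      using h co by (simp add: v' coprime_dvd_mult_right_iff)
    finally show ?thesis .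
  qed
  have v'0: "v' > 0" using v h v' by (simp add: zero_less_mult_iff)
  have "of_nat (card {x \<in> {0..<v}. v dvd y - x * g}) = (\<Sum>x\<in>{0..<v}. if v dvd y - x * g then 1 else (0::complex))"
    by (simp add: sum.inter_filter[symmetric])
  also have "\<dots> = (\<Sum>x\<in>{0..<v}. if v dvd y - (1 * x + x0) * g then 1 else 0)"
  proof (rule sum_residues_affine[OF v _ , symmetric])
    fix x z assume "v dvd x - z"
    hence "v dvd (x - z) * g" by simp
    moreover have "y - z * g = (y - x * g) + (x - z) * g" by (simp add: algebra_simps)
    ultimately have "(v dvd y - x * g) = (v dvd y - z * g)" by (metis dvd_add_left_iff)
    thus "(if v dvd y - x * g then 1 else (0::complex)) = (if v dvd y - z * g then 1 else 0)" by simp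
  qed simp
  also have "\<dots> = (\<Sum>x\<in>{0..<v' * h}. if v' dvd x then 1 else 0)"
    by (simp only: eq) (simp add: v' mult.commute)
  also have "\<dots> = of_int h"
    using h by (subst sum_residues_multiples[OF v'0]) simp
  finally show ?thesis using True by (simp add: h_def)
qed

text \<open>
  The Bezout coefficient \<open>s\<close> is a unit modulo \<open>a\<close> and may be shifted by multiples of \<open>a\<close>; adding
  \<open>a\<close> times the product of the primes of \<open>h\<close> that do not divide it makes it a unit modulo \<open>h\<close>.
\<close>

lemma coprime_bezout_avoiding:
  fixes a b h :: int
  assumes ab: "coprime a b" and h: "h > 0"
  shows "\<exists>r s. r * a + s * b = 1 \<and> coprime s h"
proof -
  obtain r0 s0 where rs: "r0 * a + s0 * b = 1" using bezout_int[of a b] ab by auto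
  define x where "x = \<Prod>{p \<in> prime_factors h. \<not> p dvd s0}"
  define s where "s = s0 + a * x"
  have "coprime s h"
  proof (rule ccontr)
    assume "\<not> coprime s h"
    then obtain p where p: "prime p" "p dvd s" "p dvd h"
      using prime_divisor_exists[of "gcd s h"] h
      by (metis dvd_trans gcd_dvd1 gcd_dvd2 gcd_eq_0_iff is_unit_gcd less_irrefl)
    hence pf: "p \<in> prime_factors h" using h by (simp add: in_prime_factors_iff)
    show False
    proof (cases "p dvd s0")
      case False
      hence "p dvd x" unfolding x_def using pf by (intro dvd_prodI) auto
      hence "p dvd s0" using p(2) by (simp add: s_def dvd_add_left_iff)
      thus False using False by simp
    next
      case True
      hence "p dvd a * x" using p(2) by (simp add: s_def dvd_add_right_iff)
      moreover have "\<not> p dvd a"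
      proof
        assume "p dvd a"
        hence "p dvd r0 * a + s0 * b" using True by simp
        hence "p dvd 1" by (simp only: rs)
        thus False using p(1) not_prime_unit by blast
      qed
      moreover have "\<not> p dvd x"
      proof
        assume "p dvd x"
        then obtain l where l: "l \<in> prime_factors h" "\<not> l dvd s0" "p dvd l"
          unfolding x_def using p(1) by (subst (asm) prime_dvd_prod_iff) auto
        hence "p = l" using p(1) by (metis in_prime_factors_iff primes_dvd_imp_eq)
        thus False using l True by simp
      qed
      ultimately show False using p(1) by (simp add: prime_dvd_mult_iff)
    qed
  qed
  moreover have "(r0 - b * x) * a + s * b = 1" using rs by (simp add: s_def algebra_simps)
  ultimately show ?thesis by blast
qed

text \<open>
  The third coordinate \<open>v3\<close> enters the integrality conditions for \<open>v23\<close> and \<open>v34\<close> linearly. If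
  \<open>b1\<close> and \<open>b2\<close> are the coordinates of \<open>(v2, v4)\<close> in a unimodular basis whose first vector is the
  primitive vector \<open>(a1, a2)\<close>, then the two conditions together are equivalent to a linear congruence
  for \<open>v3\<close> and a condition that does not involve \<open>v3\<close>.
\<close>

lemma card_completions:
  fixes v g a1 a2 r s v2 v4 v13 :: int
  assumes v: "v > 0" and rs: "r * a1 + s * a2 = 1"
  shows "of_nat (card {x \<in> {0..<v}. v dvd v2 * v13 - x * (g * a1) \<and> v dvd x * (g * a2) - v4 * v13}) =
     (if gcd v g dvd v13 * v2 \<and> gcd v g dvd v13 * v4 \<and> v dvd v13 * (a1 * v4 - a2 * v2)
      then of_int (gcd v g) else (0::complex))"
proof -
  define b1 where "b1 = r * v2 + s * v4"
  define b2 where "b2 = a1 * v4 - a2 * v2"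
  have e2: "v2 = b1 * a1 - b2 * s" 
  proof -
    have "b1 * a1 - b2 * s = (r * a1 + s * a2) * v2" by (simp add: b1_def b2_def algebra_simps)
    thus ?thesis by (simp add: rs)
  qed
  have e4: "v4 = b1 * a2 + b2 * r"
  proof -
    have "b1 * a2 + b2 * r = (r * a1 + s * a2) * v4" by (simp add: b1_def b2_def algebra_simps)
    thus ?thesis by (simp add: rs)
  qed
  have iff1: "v dvd v2 * v13 - x * (g * a1) \<and> v dvd x * (g * a2) - v4 * v13 \<longleftrightarrow>
     v dvd v13 * b1 - x * g \<and> v dvd v13 * b2" (is "?A \<and> ?B \<longleftrightarrow> ?C \<and> ?D") for x
  proof
    assume *: "?A \<and> ?B"
    have "v dvd r * (v2 * v13 - x * (g * a1)) - s * (x * (g * a2) - v4 * v13)"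
      using * by (auto intro!: dvd_diff simp only: dvd_mult)
    also have "\<dots> = v13 * b1 - x * g * (r * a1 + s * a2)"
      by (simp add: b1_def algebra_simps)
    finally have C: ?C by (simp add: rs)
    have "v dvd - (a2 * (v2 * v13 - x * (g * a1)) + a1 * (x * (g * a2) - v4 * v13))"
      using * by (auto intro!: dvd_add simp only: dvd_minus_iff dvd_mult)
    also have "\<dots> = v13 * b2" by (simp add: b2_def algebra_simps)
    finally show "?C \<and> ?D" using C by simp
  next
    assume *: "?C \<and> ?D"
    have "v dvd a1 * (v13 * b1 - x * g) - s * (v13 * b2)"
      using * by (auto intro!: dvd_diff simp only: dvd_mult)
    also have "\<dots> = v2 * v13 - x * (g * a1)" by (simp add: e2 algebra_simps)
    finally have A: ?A .
    have "v dvd - (a2 * (v13 * b1 - x * g) + r * (v13 * b2))"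
      using * by (auto intro!: dvd_add simp only: dvd_minus_iff dvd_mult)
    also have "\<dots> = x * (g * a2) - v4 * v13" by (simp add: e4 algebra_simps)
    finally show "?A \<and> ?B" using A by simp
  qed
  have iff2: "gcd v g dvd v13 * v2 \<and> gcd v g dvd v13 * v4 \<and> v dvd v13 * b2 \<longleftrightarrow>
      gcd v g dvd v13 * b1 \<and> v dvd v13 * b2" (is "?A \<and> ?B \<and> ?D \<longleftrightarrow> ?C \<and> ?D")
  proof
    assume *: "?A \<and> ?B \<and> ?D"
    have "gcd v g dvd r * (v13 * v2) + s * (v13 * v4)" using * by (auto intro!: dvd_add simp only: dvd_mult)
    thus "?C \<and> ?D" using * by (simp add: b1_def algebra_simps)
  next
    assume *: "?C \<and> ?D"
    hence D: "gcd v g dvd v13 * b2" by (meson dvd_trans gcd_dvd1)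
    have "gcd v g dvd a1 * (v13 * b1) - s * (v13 * b2)"  using * D by (auto intro!: dvd_diff simp only: dvd_mult)
    hence A: ?A by (simp add: e2 algebra_simps)
    have "gcd v g dvd a2 * (v13 * b1) + r * (v13 * b2)"  using * D by (auto intro!: dvd_add simp only: dvd_mult)
    hence B: ?B by (simp add: e4 algebra_simps)
    show "?A \<and> ?B \<and> ?D" using * A B by simp
  qed
  show ?thesis
  proof (cases "v dvd v13 * b2")
    case True
    thus ?thesis unfolding iff1 using card_linear_congruence[OF v, of "v13 * b1" g] iff2
      unfolding b2_def[symmetric] by simp
  next
    case False
    thus ?thesis unfolding iff1 using iff2 unfolding b2_def[symmetric] by simp
  qed
qed

text \<open>
  The contribution of all \<open>(v2, v3, v4)\<close> over a fixed pair \<open>(v12, v14)\<close> with \<open>gcd v12 v14 = g\<close> and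
  \<open>v12 = a g\<close>. The factor \<open>h\<close> counts the choices of \<open>v3\<close>, the variable \<open>c\<close> is what remains of the
  coordinate of \<open>(v2, v4)\<close> across the line through \<open>(v12, v14)\<close>, and the factor \<open>w\<close> is the value
  of the complete character sum along that line when it does not vanish.
\<close>

definition fibre_sum :: "int \<Rightarrow> int \<Rightarrow> int \<Rightarrow> int \<Rightarrow> complex" where
  "fibre_sum n v a g =
     (let h = gcd v g; q = h div gcd h (g div h)
      in of_int h * (\<Sum>c\<in>{0..<h}. if q dvd c\<^sup>2 then
           (let w = v div (q div gcd c q) in if w dvd n * a then of_int w * char_mod h (n * c) else 0) else 0))"

lemma gcd_cong: "q dvd x - y \<Longrightarrow> gcd x q = gcd y (q :: int)"
  by (metis gcd_red_int gcd.commute mod_eq_dvd_iff)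

lemma dvd_mult_iff_div_gcd:
  fixes h g x :: int assumes "h > 0"
  shows "h dvd g * x \<longleftrightarrow> h div gcd h g dvd x"
proof -
  define d where "d = gcd h g"
  have d: "d > 0" using assms by (simp add: d_def)
  obtain h' g' where h': "h = d * h'" and g': "g = d * g'" and co: "coprime h' g'"
    unfolding d_def by (rule gcd_cofactors[OF assms])
  show ?thesis unfolding d_def[symmetric] using d co by (simp add: h' g' mult.assoc coprime_dvd_mult_right_iff)
qed

text \<open>
  The pair \<open>(v2, v4)\<close> is expressed in a unimodular basis whose first vector is the primitive
  vector \<open>(a1, a2)\<close>, with coordinates \<open>x\<close> and \<open>y\<close>. Then \<open>v4 v12 - v2 v14 = g y\<close>, so integrality of
  \<open>v13\<close> forces \<open>y = v' c\<close>, and the remaining conditions are divisibilities of \<open>c\<^sup>2\<close> and \<open>c x\<close>.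
  The sum over \<open>x\<close> is a complete character sum. The character in \<open>c\<close> carries the Bezout
  coefficient \<open>- s\<close>, which depends on \<open>v14\<close>; being a unit modulo \<open>h\<close> it can be removed by a
  substitution, since the conditions on \<open>c\<close> only depend on \<open>gcd c q\<close>. This is why no Kloosterman
  sums occur and the result depends on \<open>v14\<close> only through \<open>g\<close>.
\<close>

lemma sum_over_line_eq_fibre_sum:
  fixes n v a1 a2 g :: int
  assumes v: "v > 0" and g: "g > 0" and co: "coprime a1 a2"
  shows "(\<Sum>v2\<in>{0..<v}. \<Sum>v4\<in>{0..<v}.
           if v dvd v4 * (g * a1) - v2 * (g * a2) then
             of_nat (card {v3 \<in> {0..<v}.
               v dvd v2 * ((v4 * (g * a1) - v2 * (g * a2)) div v) - v3 * (g * a1) \<and>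
               v dvd v3 * (g * a2) - v4 * ((v4 * (g * a1) - v2 * (g * a2)) div v)}) * char_mod v (n * v2)
           else 0) = fibre_sum n v a1 g"
    (is "?lhs = _")
proof -
  define h where "h = gcd v g"
  have h: "h > 0" using v by (simp add: h_def)
  obtain v' g' where v': "v = h * v'" and g': "g = h * g'" and co': "coprime v' g'"
    unfolding h_def by (rule gcd_cofactors[OF v])
  have v'0: "v' > 0" using v h v' by (simp add: zero_less_mult_iff)
  define q where "q = h div gcd h g'"
  have qh: "q dvd h" 
  proof -
    have "h = q * gcd h g'" by (simp add: q_def)
    thus ?thesis by (rule dvdI)
  qed
  have q0: "q > 0" using qh h dvd_imp_le unfolding q_def by (simp add: pos_imp_zdiv_pos_iff zdvd_imp_le)
  obtain r s where rs: "r * a1 + s * a2 = 1" and sh: "coprime s h"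
    using coprime_bezout_avoiding[OF co h] by blast
  define F where "F = (\<lambda>v2 v4. if v dvd g * (a1 * v4 - a2 * v2) then
      (let z = g * (a1 * v4 - a2 * v2) div v in
       if h dvd z * v2 \<and> h dvd z * v4 \<and> v dvd z * (a1 * v4 - a2 * v2)
       then of_int h * char_mod v (n * v2) else 0) else 0)"
  have "?lhs = (\<Sum>v2\<in>{0..<v}. \<Sum>v4\<in>{0..<v}. F v2 v4)"
  proof (intro sum.cong refl, goal_cases)
    case (1 v2 v4)
    have e: "v4 * (g * a1) - v2 * (g * a2) = g * (a1 * v4 - a2 * v2)" by (simp add: algebra_simps)
    show ?case unfolding F_def e card_completions[OF v rs] h_def[symmetric] Let_def by simp
  qed
  also have "\<dots> = (\<Sum>x\<in>{0..<v}. \<Sum>y\<in>{0..<v}. F (a1 * x + (- s) * y) (a2 * x + r * y))"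
  proof (rule sum_residues_unimodular[OF v, symmetric])
    show "a1 * r - - s * a2 = 1" using rs by (simp add: algebra_simps)
    \<comment> \<open>The number of choices of \<open>v3\<close> is periodic in \<open>(v2, v4)\<close> although the integer
      \<open>v13\<close> is not: a shift changes it by a multiple of \<open>g\<close>, which is harmless in every condition.\<close>
    fix x y x' y' assume "v dvd x - x'" "v dvd y - y'"
    then obtain t u where x: "x = x' + v * t" and y: "y = y' + v * u"
      by (metis add.commute diff_add_cancel dvd_def)
    define \<beta> where "\<beta> = a1 * y' - a2 * x'"
    define k where "k = a1 * u - a2 * t"
    have \<beta>: "a1 * y - a2 * x = \<beta> + v * k" by (simp add: \<beta>_def k_def x y algebra_simps)
    have c: "char_mod v (n * x) = char_mod v (n * x')"
      by (rule char_mod_cong) (simp add: x algebra_simps)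
    have d: "v dvd g * (\<beta> + v * k) \<longleftrightarrow> v dvd g * \<beta>"
      by (simp add: distrib_left dvd_add_left_iff)
    show "F x y = F x' y'"
    proof (cases "v dvd g * \<beta>")
      case False thus ?thesis unfolding F_def \<beta> \<beta>_def[symmetric] by (simp add: d)
    next
      case True
      then obtain z where z: "g * \<beta> = v * z" by (meson dvdE)
      have z1: "g * \<beta> div v = z" using z v by simp
      have z2: "g * (\<beta> + v * k) div v = z + g * k"
        using v by (simp add: distrib_left z mult.left_commute[of g v])
      have hv: "h dvd v" and hg: "h dvd g" by (simp_all add: h_def)
      have i1: "h dvd (z + g * k) * x \<longleftrightarrow> h dvd z * x'"
      proof -
        have "(z + g * k) * x = z * x' + (g * (k * x) + v * (z * t))" by (simp add: x algebra_simps)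
        moreover have "h dvd g * (k * x) + v * (z * t)" using hv hg by (intro dvd_add) auto
        ultimately show ?thesis by (simp add: dvd_add_left_iff)
      qed
      have i2: "h dvd (z + g * k) * y \<longleftrightarrow> h dvd z * y'"
      proof -
        have "(z + g * k) * y = z * y' + (g * (k * y) + v * (z * u))" by (simp add: y algebra_simps)
        moreover have "h dvd g * (k * y) + v * (z * u)" using hv hg by (intro dvd_add) auto
        ultimately show ?thesis by (simp add: dvd_add_left_iff)
      qed
      have i3: "v dvd (z + g * k) * (\<beta> + v * k) \<longleftrightarrow> v dvd z * \<beta>"
      proof -
        have "(z + g * k) * (\<beta> + v * k) = z * \<beta> + (k * (g * \<beta>) + v * (k * (z + g * k)))"
          by (simp add: algebra_simps)
        also have "\<dots> = z * \<beta> + v * (k * z + k * (z + g * k))"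
          by (simp only: z) (simp add: algebra_simps)
        finally show ?thesis by (simp add: dvd_add_left_iff)
      qed
      show ?thesis unfolding F_def \<beta> \<beta>_def[symmetric] z2 z1 Let_def i1 i2 i3 c d ..
    qed
  qed
  also have "\<dots> = (\<Sum>x\<in>{0..<v}. \<Sum>y\<in>{0..<v' * h}. if v' dvd y then
       (if h dvd g' * (y div v') * x \<and> h dvd g' * (y div v')\<^sup>2
        then of_int h * (char_mod v (n * a1 * x) * char_mod h (- s * (n * (y div v')))) else 0) else 0)"
  proof -
    have "v' * h = v" by (simp add: v')
    moreover have "F (a1 * x + (- s) * y) (a2 * x + r * y) = (if v' dvd y then
       (if h dvd g' * (y div v') * x \<and> h dvd g' * (y div v')\<^sup>2
        then of_int h * (char_mod v (n * a1 * x) * char_mod h (- s * (n * (y div v')))) else 0) else 0)" for x y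
    proof -
      have "a1 * (a2 * x + r * y) - a2 * (a1 * x + (- s) * y) = (r * a1 + s * a2) * y"
        by (simp add: algebra_simps)
      hence b: "a1 * (a2 * x + r * y) - a2 * (a1 * x + (- s) * y) = y" by (simp add: rs)
      have d: "v dvd g * y \<longleftrightarrow> v' dvd y"
        using h co' by (simp add: v' g' mult.assoc coprime_dvd_mult_right_iff)
      show ?thesis
      proof (cases "v' dvd y")
        case False thus ?thesis unfolding F_def b d by simp
      next
        case True
        then obtain c where c: "y = v' * c" by (meson dvdE)
        have c1: "y div v' = c" using c v'0 by simp
        have z: "g * y div v = g' * c" using h v'0 by (simp add: c v' g' ac_simps)
        have i: "v dvd g' * c * y \<longleftrightarrow> h dvd g' * c\<^sup>2"
          using v'0 by (simp add: v' c power2_eq_square mult.commute[of h] mult.left_commute[of _ v']) (simp only: mult.assoc)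
        have i2: "h dvd g' * c * (a1 * x + (- s) * y) \<and> h dvd g' * c * (a2 * x + r * y) \<longleftrightarrow>
            h dvd g' * c * x" if "h dvd g' * c\<^sup>2"
        proof -
          have y: "h dvd g' * c * y" using that by (simp add: c power2_eq_square) (metis dvd_mult mult.left_commute mult.assoc)
          show ?thesis
          proof
            assume *: "h dvd g' * c * (a1 * x + (- s) * y) \<and> h dvd g' * c * (a2 * x + r * y)"
            have "h dvd r * (g' * c * (a1 * x + (- s) * y)) + s * (g' * c * (a2 * x + r * y))"
              using * by (auto intro!: dvd_add simp only: dvd_mult)
            also have "\<dots> = g' * c * x * (r * a1 + s * a2)" by (simp add: algebra_simps)
            finally show "h dvd g' * c * x" by (simp add: rs)
          next
            assume *: "h dvd g' * c * x"
            have "h dvd a1 * (g' * c * x) - s * (g' * c * y)" "h dvd a2 * (g' * c * x) + r * (g' * c * y)"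
              using * y by (auto intro!: dvd_diff dvd_add simp only: dvd_mult)
            thus "h dvd g' * c * (a1 * x + (- s) * y) \<and> h dvd g' * c * (a2 * x + r * y)"
              by (simp add: algebra_simps)
          qed
        qed
        have ch: "char_mod v (n * (a1 * x + (- s) * y)) = char_mod v (n * a1 * x) * char_mod h (- s * (n * c))"
        proof -
          have "n * (a1 * x + (- s) * y) = n * a1 * x + v' * (- s * (n * c))"
            by (simp add: c algebra_simps)
          moreover have "char_mod v (v' * (- s * (n * c))) = char_mod h (- s * (n * c))"
            using char_mod_mult_cancel[of v' h "- s * (n * c)"] v'0 by (simp only: v' mult.commute[of h])
          ultimately show ?thesis by (simp only: char_mod_add)
        qed
        have "(h dvd g' * c * (a1 * x + (- s) * y) \<and> h dvd g' * c * (a2 * x + r * y) \<and> h dvd g' * c\<^sup>2) \<longleftrightarrow>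
            (h dvd g' * c * x \<and> h dvd g' * c\<^sup>2)"
          using i2 by blast
        thus ?thesis unfolding F_def b d z i ch c1 Let_def using True by simp
      qed
    qed
    ultimately show ?thesis by simp
  qed
  also have "\<dots> = (\<Sum>x\<in>{0..<v}. \<Sum>c\<in>{0..<h}.
       if h dvd g' * c * x \<and> h dvd g' * c\<^sup>2
        then of_int h * (char_mod v (n * a1 * x) * char_mod h (- s * (n * c))) else 0)"
  proof -
    have "v' * c div v' = c" for c using v'0 by simp
    thus ?thesis by (simp only: sum_residues_multiples[OF v'0])
  qed
  also have "\<dots> = (\<Sum>c\<in>{0..<h}. \<Sum>x\<in>{0..<v}.
       if h dvd g' * c * x \<and> h dvd g' * c\<^sup>2
        then of_int h * (char_mod v (n * a1 * x) * char_mod h (- s * (n * c))) else 0)"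
    by (rule sum.swap)
  also have "\<dots> = (\<Sum>c\<in>{0..<h}. of_int h * (if q dvd c\<^sup>2 then
       (let w = v div (q div gcd c q) in if w dvd n * a1 then of_int w * char_mod h (- s * (n * c)) else 0) else 0))"
  proof (intro sum.cong refl, goal_cases)
    case (1 c)
    have q2: "h dvd g' * c\<^sup>2 \<longleftrightarrow> q dvd c\<^sup>2" unfolding q_def by (rule dvd_mult_iff_div_gcd[OF h])
    define e where "e = q div gcd c q"
    have q1: "h dvd g' * c * x \<longleftrightarrow> e dvd x" for x
      using dvd_mult_iff_div_gcd[OF h, of g' "c * x"] dvd_mult_iff_div_gcd[OF q0, of c x]
      by (simp only: q_def[symmetric] e_def mult.assoc gcd.commute[of q c])
    have "q = e * gcd c q" by (simp add: e_def)
    hence eq: "e dvd q" by (rule dvdI)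
    hence "e dvd v" using qh v' by (meson dvd_trans dvd_triv_left)
    then obtain w where w: "v = e * w" by (meson dvdE)
    have e0: "e > 0" using eq q0 by (simp add: e_def pos_imp_zdiv_pos_iff zdvd_imp_le)
    have w0: "w > 0" using v w e0 by (simp add: zero_less_mult_iff)
    have vw: "v div e = w" using w e0 by simp
    have S: "(\<Sum>x\<in>{0..<v}. if e dvd x then char_mod v (n * a1 * x) else 0)
        = (if w dvd n * a1 then of_int w else 0)"
    proof -
      have "(\<Sum>x\<in>{0..<e * w}. if e dvd x then char_mod v (n * a1 * x) else 0)
         = (\<Sum>y\<in>{0..<w}. char_mod v (n * a1 * (e * y)))" by (rule sum_residues_multiples[OF e0])
      also have "\<dots> = (\<Sum>y\<in>{0..<w}. char_mod w (n * a1 * y))"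
      proof (intro sum.cong refl)
        fix y
        show "char_mod v (n * a1 * (e * y)) = char_mod w (n * a1 * y)"
          using char_mod_mult_cancel[of e w "n * a1 * y"] e0 by (simp add: w mult_ac)
      qed
      finally show ?thesis unfolding sum_char_mod[OF w0] by (simp add: w)
    qed
    have "(\<Sum>x\<in>{0..<v}. if h dvd g' * c * x \<and> h dvd g' * c\<^sup>2
        then of_int h * (char_mod v (n * a1 * x) * char_mod h (- s * (n * c))) else 0)
      = of_int h * (if q dvd c\<^sup>2 then char_mod h (- s * (n * c)) *
           (\<Sum>x\<in>{0..<v}. if e dvd x then char_mod v (n * a1 * x) else 0) else 0)"
      unfolding q1 q2 by (auto simp: sum_distrib_left intro!: sum.cong)
    thus ?case unfolding S e_def[symmetric] vw Let_def by simp
  qed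
  also have "\<dots> = of_int h * (\<Sum>c\<in>{0..<h}. (if q dvd (- s * c + 0)\<^sup>2 then
       (let w = v div (q div gcd (- s * c + 0) q) in
         if w dvd n * a1 then of_int w * char_mod h (n * (- s * c + 0)) else 0) else 0))"
  proof -
    have sq: "coprime q s" using sh qh by (metis coprime_divisors coprime_commute dvd_refl)
    have 1: "q dvd (- s * c + 0)\<^sup>2 \<longleftrightarrow> q dvd c\<^sup>2" for c
    proof -
      have "(- s * c + 0)\<^sup>2 = s\<^sup>2 * c\<^sup>2" by (simp add: power_mult_distrib)
      moreover have "coprime q (s\<^sup>2)" using sq by simp
      ultimately show ?thesis by (simp only: coprime_dvd_mult_right_iff)
    qed
    have 2: "gcd (- s * c + 0) q = gcd c q" for c
      using gcd_mult_left_left_cancel[OF sq, of c] by simp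
    have 3: "n * (- s * c + 0) = - s * (n * c)" for c by simp
    show ?thesis unfolding sum_distrib_left 1 2 3 ..
  qed
  also have "\<dots> = of_int h * (\<Sum>c\<in>{0..<h}. (if q dvd c\<^sup>2 then
       (let w = v div (q div gcd c q) in if w dvd n * a1 then of_int w * char_mod h (n * c) else 0) else 0))"
  proof (subst sum_residues_affine[OF h])
    show "coprime (- s) h" using sh by simp
    fix x y assume "h dvd x - y"
    hence "char_mod h (n * x) = char_mod h (n * y)"
      by (intro char_mod_cong) (simp add: right_diff_distrib[symmetric])
    moreover have xy: "q dvd x - y" using \<open>h dvd x - y\<close> qh dvd_trans by blast
    hence "gcd x q = gcd y q" by (rule gcd_cong)
    moreover have "x\<^sup>2 - y\<^sup>2 = (x - y) * (x + y)" by (simp add: power2_eq_square algebra_simps)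
    hence "q dvd x\<^sup>2 - y\<^sup>2" using xy by simp
    hence "q dvd x\<^sup>2 \<longleftrightarrow> q dvd y\<^sup>2" by (metis diff_add_cancel dvd_add_right_iff)
    ultimately show "(if q dvd x\<^sup>2 then (let w = v div (q div gcd x q) in
        if w dvd n * a1 then of_int w * char_mod h (n * x) else 0) else 0)
      = (if q dvd y\<^sup>2 then (let w = v div (q div gcd y q) in
        if w dvd n * a1 then of_int w * char_mod h (n * y) else 0) else 0)" by (simp only:)
  qed auto
  also have "\<dots> = fibre_sum n v a1 g"
  proof -
    have "g div h = g'" using g' h by simp
    thus ?thesis by (simp only: fibre_sum_def Let_def h_def[symmetric] q_def)
  qed
  finally show ?thesis .
qed

section \<open>Multiplicativity\<close>

lemma gcd_mult_coprime:
  fixes a b c :: int assumes "coprime a b"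
  shows "gcd c (a * b) = gcd c a * gcd c b"
proof -
  have "coprime (gcd c a) (gcd c b)" using assms by (meson coprime_divisors gcd_dvd2)
  hence 1: "gcd c a * gcd c b dvd gcd c (a * b)"
    by (intro gcd_greatest divides_mult mult_dvd_mono) auto
  obtain x y where xy: "gcd c (a * b) = x * y" "x dvd a" "y dvd b"
    using division_decomp[of "gcd c (a * b)" a b] by auto
  have "x dvd c" "y dvd c" using xy(1) by (metis dvd_trans dvd_triv_left dvd_triv_right gcd_dvd1)+
  hence "gcd c (a * b) dvd gcd c a * gcd c b"
    unfolding xy(1) using xy by (intro mult_dvd_mono) auto
  with 1 show ?thesis by (metis gcd_ge_0_int mult_nonneg_nonneg zdvd_antisym_nonneg)
qed

lemma gcd_mult_mult_coprime:
  fixes a b c d :: int assumes "coprime a d" "coprime b c" "coprime c d"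
  shows "gcd (a * b) (c * d) = gcd a c * gcd b d"
  using assms by (simp add: gcd_mult_coprime gcd_mult_left_left_cancel gcd_mult_left_right_cancel coprime_commute)

lemma divisors_int_finite [simp]: "n > 0 \<Longrightarrow> finite {d. d > 0 \<and> d dvd (n::int)}"
  by (rule finite_subset[of _ "{0..n}"]) (auto dest: zdvd_imp_le)

text \<open>
  A divisor \<open>x\<close> of \<open>m n\<close> is the product of \<open>gcd x m\<close> and \<open>gcd x n\<close>.
\<close>

lemma sum_divisors_mult_coprime:
  fixes f :: "int \<Rightarrow> complex"
  assumes "m > 0" "n > 0" "coprime m n"
  shows "(\<Sum>d | d > 0 \<and> d dvd m * n. f d) = (\<Sum>d | d > 0 \<and> d dvd m. \<Sum>e | e > 0 \<and> e dvd n. f (d * e))"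
proof -
  have co: "coprime d e" if "d dvd m" "e dvd n" for d e
    using assms(3) that coprime_divisors by blast
  have g1: "gcd (d * e) m = d" "gcd (d * e) n = e"
    if "0 < d" "d dvd m" "0 < e" "e dvd n" for d e
  proof -
    have "coprime m e" "coprime n d" using that assms(3) coprime_divisors[of m m e n] coprime_divisors[of d m n n]
      by (auto simp: coprime_commute)
    thus "gcd (d * e) m = d" "gcd (d * e) n = e"
      using that by (simp_all add: gcd_mult_left_right_cancel gcd_mult_left_left_cancel)
  qed
  have "(\<Sum>d | d > 0 \<and> d dvd m * n. f d)
      = (\<Sum>(d, e)\<in>{d. d > 0 \<and> d dvd m} \<times> {e. e > 0 \<and> e dvd n}. f (d * e))"
  proof (rule sum.reindex_bij_witness[of _ "\<lambda>(d, e). d * e" "\<lambda>x. (gcd x m, gcd x n)"], goal_cases)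
    case (1 x)
    thus ?case using gcd_mult_coprime[OF assms(3), of x] by (auto simp: gcd_proj1_iff)
  next
    case (2 x)
    thus ?case using assms by auto
  next
    case (3 b)
    thus ?case using g1 by (cases b) auto
  next
    case (4 b)
    thus ?case by (cases b) (auto intro: mult_dvd_mono)
  next
    case (5 x)
    thus ?case using gcd_mult_coprime[OF assms(3), of x] by (auto simp: gcd_proj1_iff)
  qed
  thus ?thesis by (simp add: sum.cartesian_product)
qed

definition ramanujan_sum :: "int \<Rightarrow> int \<Rightarrow> complex" where
  "ramanujan_sum m n = (\<Sum>u\<in>{0..<m}. if coprime u m then char_mod m (n * u) else 0)"

lemma char_mod_crt:
  assumes "m \<noteq> 0" "n \<noteq> 0"
  shows "char_mod (m * n) (k * (x * n + y * m)) = char_mod m (k * x) * char_mod n (k * y)"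
proof -
  have "char_mod (m * n) (k * (x * n + y * m)) = char_mod (n * m) (n * (k * x)) * char_mod (m * n) (m * (k * y))"
    by (simp add: char_mod_add[symmetric] algebra_simps)
  thus ?thesis using assms by (simp add: char_mod_mult_cancel)
qed

lemma coprime_crt:
  fixes m n x y :: int assumes "coprime m n"
  shows "coprime (x * n + y * m) m \<longleftrightarrow> coprime x m"
proof -
  have "gcd (x * n + y * m) m = gcd (x * n) m" by (rule gcd_cong) simp
  also have "\<dots> = gcd x m" using assms by (rule gcd_mult_left_right_cancel)
  finally show ?thesis by (simp add: coprime_iff_gcd_eq_1)
qed

lemma ramanujan_sum_mult:
  assumes "m > 0" "n > 0" "coprime m n"
  shows "ramanujan_sum (m * n) k = ramanujan_sum m k * ramanujan_sum n k"
proof -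
  have "ramanujan_sum (m * n) k = (\<Sum>x\<in>{0..<m}. \<Sum>y\<in>{0..<n}.
     if coprime (x * n + y * m) (m * n) then char_mod (m * n) (k * (x * n + y * m)) else 0)"
    unfolding ramanujan_sum_def
  proof (rule sum_residues_crt[OF assms])
    fix x y assume d: "m * n dvd x - y"
    hence "gcd x (m * n) = gcd y (m * n)" by (rule gcd_cong)
    hence "coprime x (m * n) \<longleftrightarrow> coprime y (m * n)" by (simp only: coprime_iff_gcd_eq_1)
    moreover have "char_mod (m * n) (k * x) = char_mod (m * n) (k * y)"
      using d by (intro char_mod_cong) (simp add: right_diff_distrib[symmetric])
    ultimately show "(if coprime x (m * n) then char_mod (m * n) (k * x) else 0)
        = (if coprime y (m * n) then char_mod (m * n) (k * y) else 0)" by simp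
  qed
  also have "\<dots> = (\<Sum>x\<in>{0..<m}. \<Sum>y\<in>{0..<n}.
     (if coprime x m then char_mod m (k * x) else 0) * (if coprime y n then char_mod n (k * y) else 0))"
  proof (intro sum.cong refl, goal_cases)
    case (1 x y)
    have "coprime (x * n + y * m) (m * n) \<longleftrightarrow> coprime x m \<and> coprime y n"
      using coprime_crt[OF assms(3), of x y] coprime_crt[of n m y x] assms(3)
      by (simp add: coprime_mult_right_iff add.commute coprime_commute)
    thus ?case using char_mod_crt[of m n] assms by auto
  qed
  also have "\<dots> = ramanujan_sum m k * ramanujan_sum n k"
    by (simp add: ramanujan_sum_def sum_product)
  finally show ?thesis .
qed

text \<open>
  All quantities in \<open>fibre_sum\<close> are built from gcds and exact quotients and hence multiply; the sum
  over \<open>c\<close> splits by the Chinese remainder theorem, because \<open>x h' + y h\<close> has the same gcd with \<open>q\<close>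
  as \<open>x\<close>, and the same gcd with \<open>q'\<close> as \<open>y\<close>.
\<close>

lemma fibre_sum_mult:
  fixes v a g v' a' g' :: int
  assumes pos: "v > 0" "a > 0" "g > 0" "v' > 0" "a' > 0" "g' > 0"
    and co: "coprime (v * a * g) (v' * a' * g')"
  shows "fibre_sum n (v * v') (a * a') (g * g') = fibre_sum n v a g * fibre_sum n v' a' g'"
proof -
  have cos: "coprime x y" if "x dvd v * a * g" "y dvd v' * a' * g'" for x y
    using co coprime_divisors that by blast
  define h where "h = gcd v g"
  define h' where "h' = gcd v' g'"
  have h: "h > 0" "h' > 0" using pos by (simp_all add: h_def h'_def)
  have hd: "h dvd v" "h dvd g" "h' dvd v'" "h' dvd g'" by (simp_all add: h_def h'_def)
  have hh: "gcd (v * v') (g * g') = h * h'"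
    unfolding h_def h'_def by (rule gcd_mult_mult_coprime) (auto intro!: cos simp: coprime_commute[of v' g])
  have gdiv: "g * g' div (h * h') = (g div h) * (g' div h')" using hd by (simp add: div_mult_div_if_dvd)
  define r where "r = gcd h (g div h)"
  define r' where "r' = gcd h' (g' div h')"
  have gd: "g div h dvd g" "g' div h' dvd g'" using hd by (metis dvd_div_mult_self dvd_triv_left)+
  have h1: "h dvd v * a * g" "h' dvd v' * a' * g'" using hd by (auto intro: dvd_mult2)
  have gd1: "g div h dvd v * a * g" "g' div h' dvd v' * a' * g'" using gd by auto
  have rr: "gcd (h * h') ((g div h) * (g' div h')) = r * r'"
    unfolding r_def r'_def
    by (intro gcd_mult_mult_coprime cos[OF h1(1) gd1(2)] cos[OF gd1(1) gd1(2)]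
        coprime_commute[THEN iffD1, OF cos[OF gd1(1) h1(2)]])
  have rd: "r dvd h" "r' dvd h'" by (simp_all add: r_def r'_def)
  define q where "q = h div r"
  define q' where "q' = h' div r'"
  have qq: "h * h' div (r * r') = q * q'" unfolding q_def q'_def using rd by (simp add: div_mult_div_if_dvd)
  have qd: "q dvd h" "q' dvd h'" unfolding q_def q'_def using rd by (metis dvd_div_mult_self dvd_triv_left)+
  have q1: "q dvd v * a * g" "q' dvd v' * a' * g'" using h1 qd dvd_trans by blast+
  have coh: "coprime h h'" "coprime q q'" "coprime q h'" "coprime h q'" using cos h1 q1 by blast+
  define w where "w = (\<lambda>c. v div (q div gcd c q))"
  define w' where "w' = (\<lambda>c. v' div (q' div gcd c q'))"
  define f where "f = (\<lambda>c. if q dvd c\<^sup>2 then (if w c dvd n * a then of_int (w c) * char_mod h (n * c) else 0) else 0)"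
  define f' where "f' = (\<lambda>c. if q' dvd c\<^sup>2 then (if w' c dvd n * a' then of_int (w' c) * char_mod h' (n * c) else 0) else 0)"
  define F where "F = (\<lambda>c. if q * q' dvd c\<^sup>2 then
     (let w = v * v' div (q * q' div gcd c (q * q')) in if w dvd n * (a * a') then of_int w * char_mod (h * h') (n * c) else 0) else 0)"
  have "fibre_sum n (v * v') (a * a') (g * g') = of_int (h * h') * (\<Sum>c\<in>{0..<h * h'}. F c)"
    unfolding fibre_sum_def Let_def hh gdiv rr qq F_def ..
  also have "(\<Sum>c\<in>{0..<h * h'}. F c) = (\<Sum>x\<in>{0..<h}. \<Sum>y\<in>{0..<h'}. F (x * h' + y * h))"
  proof (rule sum_residues_crt[OF h coh(1)])
    fix x y assume d: "h * h' dvd x - y"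
    hence d': "q * q' dvd x - y" using qd by (meson dvd_trans mult_dvd_mono)
    hence 1: "gcd x (q * q') = gcd y (q * q')" by (rule gcd_cong)
    have "x\<^sup>2 - y\<^sup>2 = (x - y) * (x + y)" by (simp add: power2_eq_square algebra_simps)
    hence "q * q' dvd x\<^sup>2 - y\<^sup>2" using d' by simp
    hence 2: "q * q' dvd x\<^sup>2 \<longleftrightarrow> q * q' dvd y\<^sup>2" by (metis diff_add_cancel dvd_add_right_iff)
    have 3: "char_mod (h * h') (n * x) = char_mod (h * h') (n * y)"
      using d by (intro char_mod_cong) (simp add: right_diff_distrib[symmetric])
    show "F x = F y" unfolding F_def 1 2 3 ..
  qed
  also have "\<dots> = (\<Sum>x\<in>{0..<h}. \<Sum>y\<in>{0..<h'}. f x * f' y)"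
  proof (intro sum.cong refl, goal_cases)
    case (1 x y)
    let ?c = "x * h' + y * h"
    have gx: "gcd ?c q = gcd x q"
    proof -
      have "gcd ?c q = gcd (x * h') q" using qd by (intro gcd_cong) simp
      thus ?thesis using coh(3) by (simp add: gcd_mult_left_right_cancel)
    qed
    have gy: "gcd ?c q' = gcd y q'"
    proof -
      have "gcd ?c q' = gcd (y * h) q'" using qd by (intro gcd_cong) simp
      thus ?thesis using coh(4) by (simp add: gcd_mult_left_right_cancel coprime_commute)
    qed
    have gc: "gcd ?c (q * q') = gcd x q * gcd y q'" using gcd_mult_coprime[OF coh(2), of ?c] gx gy by simp
    have sq: "q * q' dvd ?c\<^sup>2 \<longleftrightarrow> q dvd x\<^sup>2 \<and> q' dvd y\<^sup>2"
    proof -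
      have "q * q' dvd ?c\<^sup>2 \<longleftrightarrow> q dvd ?c\<^sup>2 \<and> q' dvd ?c\<^sup>2"
        using coh(2) by (auto intro: divides_mult dest: dvd_mult_left dvd_mult_right)
      also have "q dvd ?c\<^sup>2 \<longleftrightarrow> q dvd x\<^sup>2"
      proof -
        have "?c\<^sup>2 = x\<^sup>2 * h'\<^sup>2 + h * (y * (2 * x * h' + y * h))" by (simp add: power2_eq_square algebra_simps)
        hence "q dvd ?c\<^sup>2 \<longleftrightarrow> q dvd x\<^sup>2 * h'\<^sup>2" using qd by (simp add: dvd_add_left_iff dvd_mult2)
        moreover have "coprime q (h'\<^sup>2)" using coh(3) by simp
        ultimately show ?thesis by (simp only: coprime_dvd_mult_left_iff)
      qed
      also have "q' dvd ?c\<^sup>2 \<longleftrightarrow> q' dvd y\<^sup>2"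
      proof -
        have "?c\<^sup>2 = y\<^sup>2 * h\<^sup>2 + h' * (x * (2 * y * h + x * h'))" by (simp add: power2_eq_square algebra_simps)
        hence "q' dvd ?c\<^sup>2 \<longleftrightarrow> q' dvd y\<^sup>2 * h\<^sup>2" using qd by (simp add: dvd_add_left_iff dvd_mult2)
        moreover have "coprime q' (h\<^sup>2)" using coh(4) by (simp add: coprime_commute)
        ultimately show ?thesis by (simp only: coprime_dvd_mult_left_iff)
      qed
      finally show ?thesis .
    qed
    have ed: "q div gcd x q dvd q" "q' div gcd y q' dvd q'" by (metis dvd_div_mult_self dvd_triv_left gcd_dvd2)+
    have ev: "q div gcd x q dvd v" "q' div gcd y q' dvd v'" using ed qd hd dvd_trans by blast+
    have ww: "v * v' div (q * q' div (gcd x q * gcd y q')) = w x * w' y"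
      unfolding w_def w'_def using ev by (simp add: div_mult_div_if_dvd)
    have wv: "w x dvd v" "w' y dvd v'" unfolding w_def w'_def using ev by (metis dvd_div_mult_self dvd_triv_left)+
    have w1: "w x dvd v * a * g" "w' y dvd v' * a' * g'" using wv by (auto intro: dvd_mult2)
    have cow: "coprime (w x) (w' y)" "coprime (w x) a'" "coprime (w' y) a"
      using cos[OF w1(1) w1(2)] cos[OF w1(1), of a'] cos[OF _ w1(2), of a]
      by (auto simp: coprime_commute)
    have wd: "w x * w' y dvd n * (a * a') \<longleftrightarrow> w x dvd n * a \<and> w' y dvd n * a'"
    proof -
      have "w x * w' y dvd n * (a * a') \<longleftrightarrow> w x dvd n * (a * a') \<and> w' y dvd n * (a * a')"
        using cow(1) by (auto intro: divides_mult dest: dvd_mult_left dvd_mult_right)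
      also have "n * (a * a') = n * a * a'" by simp
      also have "w x dvd \<dots> \<longleftrightarrow> w x dvd n * a" using cow(2) by (simp only: coprime_dvd_mult_left_iff)
      also have "n * a * a' = n * a' * a" by simp
      also have "w' y dvd \<dots> \<longleftrightarrow> w' y dvd n * a'" using cow(3) by (simp only: coprime_dvd_mult_left_iff)
      finally show ?thesis by (simp only: mult_ac)
    qed
    have ch: "char_mod (h * h') (n * ?c) = char_mod h (n * x) * char_mod h' (n * y)"
      using h by (intro char_mod_crt) auto
    show ?case unfolding F_def f_def f'_def sq gc ww Let_def wd ch by simp
  qed
  also have "\<dots> = (\<Sum>c\<in>{0..<h}. f c) * (\<Sum>c\<in>{0..<h'}. f' c)" by (simp add: sum_product)
  also have "of_int (h * h') * \<dots> = fibre_sum n v a g * fibre_sum n v' a' g'"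
    unfolding fibre_sum_def Let_def h_def[symmetric] h'_def[symmetric] r_def[symmetric] r'_def[symmetric]
      q_def[symmetric] q'_def[symmetric] f_def f'_def w_def w'_def by simp
  finally show ?thesis .
qed

section \<open>Dropping the coprimality conditions\<close>

text \<open>
  The index set of the inner sum without the two coprimality conditions.
\<close>

definition loose_index :: "int \<Rightarrow> int \<Rightarrow> (int \<times> int \<times> int \<times> int) set" where
  "loose_index v w =
     {(v2, v3, v4, v14). v2 \<in> {0..<v} \<and> v3 \<in> {0..<v} \<and> v4 \<in> {0..<v} \<and> v14 \<in> {0..<w} \<and>
        v dvd v4 * w - v2 * v14 \<and>
        v dvd v2 * ((v4 * w - v2 * v14) div v) - v3 * w \<and>
        v dvd v3 * v14 - v4 * ((v4 * w - v2 * v14) div v)}"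

definition loose_sum :: "int \<Rightarrow> int \<Rightarrow> int \<Rightarrow> int \<Rightarrow> complex" where
  "loose_sum n1 n2 v w =
     (\<Sum>(v2, v3, v4, v14)\<in>loose_index v w. char_mod v (n1 * v2) * char_mod w (n2 * v14))"

definition flag_sum :: "int \<Rightarrow> int \<Rightarrow> int \<Rightarrow> int \<Rightarrow> complex" where
  "flag_sum n1 n2 v w =
     (\<Sum>(v2, v3, v4, v14)\<in>R_index v w. char_mod v (n1 * v2) * char_mod w (n2 * v14))"

lemma R_term_eq:
  "R_term s t n1 n2 (v, w) = of_int v powr (- s) * of_int w powr (- t) * flag_sum n1 n2 v w"
  by (simp add: R_term_def flag_sum_def char_mod_def e2pi_add)

lemma sum_group_gcd:
  fixes \<Psi> :: "int \<Rightarrow> complex"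
  assumes w: "w > 0"
  shows "(\<Sum>x\<in>{0..<w}. char_mod w (n * x) * \<Psi> (gcd w x))
      = (\<Sum>g | g > 0 \<and> g dvd w. ramanujan_sum (w div g) n * \<Psi> g)"
proof -
  have "(\<Sum>x\<in>{0..<w}. char_mod w (n * x) * \<Psi> (gcd w x))
      = (\<Sum>g | g > 0 \<and> g dvd w. \<Sum>x | x \<in> {0..<w} \<and> gcd w x = g. char_mod w (n * x) * \<Psi> (gcd w x))"
    using w by (intro sum.group[symmetric]) auto
  also have "\<dots> = (\<Sum>g | g > 0 \<and> g dvd w. ramanujan_sum (w div g) n * \<Psi> g)"
  proof (intro sum.cong refl, clarify)
    fix g assume g: "g > 0" "g dvd w"
    then obtain m where m: "w = g * m" by (meson dvdE)
    have "(\<Sum>x | x \<in> {0..<w} \<and> gcd w x = g. char_mod w (n * x) * \<Psi> (gcd w x))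
       = (\<Sum>x\<in>{0..<w}. if gcd w x = g then char_mod w (n * x) * \<Psi> g else 0)"
      by (subst sum.inter_filter[symmetric]) (auto intro: sum.cong)
    also have "\<dots> = (\<Sum>x\<in>{0..<g * m}. if g dvd x then (if gcd w x = g then char_mod w (n * x) * \<Psi> g else 0) else 0)"
      unfolding m[symmetric] by (intro sum.cong refl) auto
    also have "\<dots> = (\<Sum>y\<in>{0..<m}. if gcd w (g * y) = g then char_mod w (n * (g * y)) * \<Psi> g else 0)"
      by (rule sum_residues_multiples[OF g(1)])
    also have "\<dots> = (\<Sum>y\<in>{0..<m}. (if coprime y m then char_mod m (n * y) else 0) * \<Psi> g)"
    proof (intro sum.cong refl)
      fix y
      have "gcd w (g * y) = g * gcd y m" using g by (simp add: m gcd_mult_left gcd.commute)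
      hence 1: "gcd w (g * y) = g \<longleftrightarrow> coprime y m" using g by (simp add: coprime_iff_gcd_eq_1)
      have 2: "char_mod w (n * (g * y)) = char_mod m (n * y)"
        using char_mod_mult_cancel[of g m "n * y"] g by (simp add: m mult_ac)
      show "(if gcd w (g * y) = g then char_mod w (n * (g * y)) * \<Psi> g else 0)
          = (if coprime y m then char_mod m (n * y) else 0) * \<Psi> g" unfolding 1 2 by simp
    qed
    finally show "(\<Sum>x | x \<in> {0..<w} \<and> gcd w x = g. char_mod w (n * x) * \<Psi> (gcd w x))
        = ramanujan_sum (w div g) n * \<Psi> g"
      using g by (simp add: ramanujan_sum_def m sum_distrib_right)
  qed
  finally show ?thesis .
qed

text \<open>
  Since the sum over \<open>(v2, v3, v4)\<close> depends on \<open>v14\<close> only through \<open>gcd w v14\<close>, the sum over \<open>v14\<close>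
  becomes a divisor sum of Ramanujan sums.
\<close>

lemma loose_sum_eq:
  assumes v: "v > 0" and w: "w > 0"
  shows "loose_sum n1 n2 v w
     = (\<Sum>g | g > 0 \<and> g dvd w. ramanujan_sum (w div g) n2 * fibre_sum n1 v (w div g) g)"
proof -
  define C where "C = (\<lambda>v2 v3 v4 v14. v dvd v4 * w - v2 * v14 \<and>
        v dvd v2 * ((v4 * w - v2 * v14) div v) - v3 * w \<and>
        v dvd v3 * v14 - v4 * ((v4 * w - v2 * v14) div v))"
  have "loose_sum n1 n2 v w = (\<Sum>(v2, v3, v4, v14)\<in>{0..<v} \<times> {0..<v} \<times> {0..<v} \<times> {0..<w}.
      if C v2 v3 v4 v14 then char_mod v (n1 * v2) * char_mod w (n2 * v14) else 0)"
    unfolding loose_sum_def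
    by (rule sum.mono_neutral_cong_left) (auto simp: loose_index_def C_def split: if_splits)
  also have "\<dots> = (\<Sum>(v14, v2, v4, v3)\<in>{0..<w} \<times> {0..<v} \<times> {0..<v} \<times> {0..<v}.
      if C v2 v3 v4 v14 then char_mod v (n1 * v2) * char_mod w (n2 * v14) else 0)"
    by (rule sum.reindex_bij_witness[of _ "\<lambda>(v14, v2, v4, v3). (v2, v3, v4, v14)" "\<lambda>(v2, v3, v4, v14). (v14, v2, v4, v3)"]) auto
  also have "\<dots> = (\<Sum>v14\<in>{0..<w}. \<Sum>v2\<in>{0..<v}. \<Sum>v4\<in>{0..<v}. \<Sum>v3\<in>{0..<v}.
      if C v2 v3 v4 v14 then char_mod v (n1 * v2) * char_mod w (n2 * v14) else 0)"
    by (simp add: sum.cartesian_product)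
  also have "\<dots> = (\<Sum>v14\<in>{0..<w}. char_mod w (n2 * v14) * fibre_sum n1 v (w div gcd w v14) (gcd w v14))"
  proof (intro sum.cong refl)
    fix v14 :: int
    define g where "g = gcd w v14"
    have g: "g > 0" using w by (simp add: g_def)
    obtain a1 a2 where a1: "w = g * a1" and a2: "v14 = g * a2" and co: "coprime a1 a2"
      unfolding g_def by (rule gcd_cofactors[OF w])
    have "(\<Sum>v3\<in>{0..<v}. if C v2 v3 v4 v14 then char_mod v (n1 * v2) * char_mod w (n2 * v14) else 0)
       = char_mod w (n2 * v14) * (if v dvd v4 * (g * a1) - v2 * (g * a2) then
             of_nat (card {v3 \<in> {0..<v}.
               v dvd v2 * ((v4 * (g * a1) - v2 * (g * a2)) div v) - v3 * (g * a1) \<and>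
               v dvd v3 * (g * a2) - v4 * ((v4 * (g * a1) - v2 * (g * a2)) div v)}) * char_mod v (n1 * v2)
           else 0)" for v2 v4
      unfolding a1[symmetric] a2[symmetric] C_def
      by (cases "v dvd v4 * w - v2 * v14") (simp_all add: sum.inter_filter[symmetric] mult_ac)
    hence "(\<Sum>v2\<in>{0..<v}. \<Sum>v4\<in>{0..<v}. \<Sum>v3\<in>{0..<v}.
        if C v2 v3 v4 v14 then char_mod v (n1 * v2) * char_mod w (n2 * v14) else 0)
      = char_mod w (n2 * v14) * fibre_sum n1 v a1 g"
      by (simp only: sum_distrib_left[symmetric] sum_over_line_eq_fibre_sum[OF v g co])
    also have "a1 = w div g" using a1 g by simp
    finally show "(\<Sum>v2\<in>{0..<v}. \<Sum>v4\<in>{0..<v}. \<Sum>v3\<in>{0..<v}.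
        if C v2 v3 v4 v14 then char_mod v (n1 * v2) * char_mod w (n2 * v14) else 0)
      = char_mod w (n2 * v14) * fibre_sum n1 v (w div gcd w v14) (gcd w v14)"
      unfolding g_def .
  qed
  also have "\<dots> = (\<Sum>g | g > 0 \<and> g dvd w. ramanujan_sum (w div g) n2 * fibre_sum n1 v (w div g) g)"
    by (rule sum_group_gcd[OF w])
  finally show ?thesis .
qed

lemma loose_sum_mult:
  assumes pos: "v > 0" "w > 0" "v' > 0" "w' > 0" and co: "coprime (v * w) (v' * w')"
  shows "loose_sum n1 n2 (v * v') (w * w') = loose_sum n1 n2 v w * loose_sum n1 n2 v' w'"
proof -
  have co': "coprime w w'" using co by simp
  have "loose_sum n1 n2 (v * v') (w * w') = (\<Sum>g | g > 0 \<and> g dvd w. \<Sum>g' | g' > 0 \<and> g' dvd w'.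
     ramanujan_sum (w * w' div (g * g')) n2 * fibre_sum n1 (v * v') (w * w' div (g * g')) (g * g'))"
    using pos co' by (simp add: loose_sum_eq sum_divisors_mult_coprime)
  also have "\<dots> = (\<Sum>g | g > 0 \<and> g dvd w. \<Sum>g' | g' > 0 \<and> g' dvd w'.
     (ramanujan_sum (w div g) n2 * fibre_sum n1 v (w div g) g) *
     (ramanujan_sum (w' div g') n2 * fibre_sum n1 v' (w' div g') g'))"
  proof (intro sum.cong refl, clarify)
    fix g g' assume g: "g > 0" "g dvd w" "g' > 0" "g' dvd w'"
    obtain a where a: "w = g * a" using g by (meson dvdE)
    obtain a' where a': "w' = g' * a'" using g by (meson dvdE)
    have ap: "a > 0" "a' > 0" using pos g a a' by (simp_all add: zero_less_mult_iff)
    have d: "w * w' div (g * g') = a * a'" "w div g = a" "w' div g' = a'"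
      using g by (simp_all add: a a' mult.assoc mult.left_commute[of a])
    have 1: "coprime a a'" using co' by (simp add: a a')
    have 2: "coprime (v * a * g) (v' * a' * g')" using co by (simp add: a a')
    show "ramanujan_sum (w * w' div (g * g')) n2 * fibre_sum n1 (v * v') (w * w' div (g * g')) (g * g')
        = (ramanujan_sum (w div g) n2 * fibre_sum n1 v (w div g) g) *
     (ramanujan_sum (w' div g') n2 * fibre_sum n1 v' (w' div g') g')"
      unfolding d by (simp add: ramanujan_sum_mult[OF ap 1] fibre_sum_mult[OF pos(1) ap(1) g(1) pos(3) ap(2) g(3) 2])
  qed
  also have "\<dots> = loose_sum n1 n2 v w * loose_sum n1 n2 v' w'"
    using pos by (simp add: loose_sum_eq sum_product)
  finally show ?thesis .
qed

text \<open>
  The integrality conditions with the three quotients \<open>v13\<close>, \<open>v23\<close>, \<open>v34\<close> as explicit witnesses. The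
  equations are homogeneous in \<open>(v, v2, v3, v4)\<close> and in \<open>(w, v13, v14, v23, v34)\<close> separately.
\<close>

definition plucker :: "int \<Rightarrow> int \<Rightarrow> int \<times> int \<times> int \<times> int \<Rightarrow> int \<times> int \<times> int \<Rightarrow> bool" where
  "plucker v w = (\<lambda>(v2, v3, v4, v14) (v13, v23, v34).
     v2 \<in> {0..<v} \<and> v3 \<in> {0..<v} \<and> v4 \<in> {0..<v} \<and> v14 \<in> {0..<w} \<and>
     v4 * w - v2 * v14 = v * v13 \<and> v2 * v13 - v3 * w = v * v23 \<and> v3 * v14 - v4 * v13 = v * v34)"

lemma loose_index_iff:
  assumes "v > 0" shows "t \<in> loose_index v w \<longleftrightarrow> (\<exists>z. plucker v w t z)"
proof -
  obtain v2 v3 v4 v14 where t: "t = (v2, v3, v4, v14)" by (cases t)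
  show ?thesis unfolding t loose_index_def plucker_def using assms
    by (auto elim!: dvdE)
qed

lemma R_index_iff:
  assumes "v > 0"
  shows "(v2, v3, v4, v14) \<in> R_index v w \<longleftrightarrow>
     (\<exists>v13 v23 v34. plucker v w (v2, v3, v4, v14) (v13, v23, v34) \<and>
        Gcd {v, v2, v3, v4} = 1 \<and> Gcd {w, v13, v14, v23, v34} = 1)"
proof
  assume "(v2, v3, v4, v14) \<in> R_index v w"
  thus "\<exists>v13 v23 v34. plucker v w (v2, v3, v4, v14) (v13, v23, v34) \<and>
        Gcd {v, v2, v3, v4} = 1 \<and> Gcd {w, v13, v14, v23, v34} = 1"
    unfolding R_index_def plucker_def Let_def
    by (intro exI[of _ "(v4 * w - v2 * v14) div v"]
        exI[of _ "(v2 * ((v4 * w - v2 * v14) div v) - v3 * w) div v"]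
        exI[of _ "(v3 * v14 - v4 * ((v4 * w - v2 * v14) div v)) div v"]) (auto simp del: Gcd_insert)
next
  assume "\<exists>v13 v23 v34. plucker v w (v2, v3, v4, v14) (v13, v23, v34) \<and>
        Gcd {v, v2, v3, v4} = 1 \<and> Gcd {w, v13, v14, v23, v34} = 1"
  then obtain v13 v23 v34 where *: "plucker v w (v2, v3, v4, v14) (v13, v23, v34)"
    "Gcd {v, v2, v3, v4} = 1" "Gcd {w, v13, v14, v23, v34} = 1" by blast
  have e: "v4 * w - v2 * v14 = v * v13" "v2 * v13 - v3 * w = v * v23" "v3 * v14 - v4 * v13 = v * v34"
    using *(1) by (auto simp: plucker_def)
  have d: "v * x div v = x" for x using assms by simp
  show "(v2, v3, v4, v14) \<in> R_index v w"
    unfolding R_index_def Let_def using *(1) *(2,3)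
    by (simp add: plucker_def e d del: Gcd_insert)
qed

lemma plucker_unique: "plucker v w t z \<Longrightarrow> plucker v w t z' \<Longrightarrow> v > 0 \<Longrightarrow> z = z'"
  by (cases t; cases z; cases z') (auto simp: plucker_def)

lemma plucker_scale_iff:
  assumes "d > 0" "c > 0"
  shows "plucker (d * v) (c * w) (d * v2, d * v3, d * v4, c * v14) (c * v13, c * v23, c * v34)
      \<longleftrightarrow> plucker v w (v2, v3, v4, v14) (v13, v23, v34)"
proof -
  have r: "k * x \<in> {0..<k * y} \<longleftrightarrow> x \<in> {0..<y}" if "k > 0" for k x y :: int
    using that by (auto simp: zero_le_mult_iff)
  have cancel: "k * x = k * y \<longleftrightarrow> x = y" if "k > 0" for k x y :: int using that by simp
  have e: "d * v4 * (c * w) - d * v2 * (c * v14) = (d * c) * (v4 * w - v2 * v14)" 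
     "d * v * (c * v13) = (d * c) * (v * v13)"
     "d * v2 * (c * v13) - d * v3 * (c * w) = (d * c) * (v2 * v13 - v3 * w)"
     "d * v * (c * v23) = (d * c) * (v * v23)"
     "d * v3 * (c * v14) - d * v4 * (c * v13) = (d * c) * (v3 * v14 - v4 * v13)"
     "d * v * (c * v34) = (d * c) * (v * v34)"
    by (simp_all add: algebra_simps)
  have dc: "d * c > 0" using assms by simp
  show ?thesis unfolding plucker_def prod.case e r[OF assms(1)] r[OF assms(2)] cancel[OF dc] ..
qed

text \<open>
  Every solution of the integrality conditions is obtained from a unique one that satisfies the
  two coprimality conditions: the two gcds \<open>d\<close> and \<open>c\<close> are divided out of the two groups of
  coordinates. The fractions inside the characters are not affected.
\<close>

lemma loose_sum_eq_flag_sums: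
  assumes v: "v > 0" and w: "w > 0"
  shows "loose_sum n1 n2 v w =
     (\<Sum>(d, c) \<in> {d. d > 0 \<and> d dvd v} \<times> {c. c > 0 \<and> c dvd w}. flag_sum n1 n2 (v div d) (w div c))"
proof -
  define I where "I = {d. d > 0 \<and> d dvd v} \<times> {c. c > 0 \<and> c dvd w}"
  define S where "S = (SIGMA (d, c) : I. R_index (v div d) (w div c))"
  define i :: "(int \<times> int) \<times> (int \<times> int \<times> int \<times> int) \<Rightarrow> int \<times> int \<times> int \<times> int"
    where "i = (\<lambda>((d, c), (x2, x3, x4, x14)). (d * x2, d * x3, d * x4, c * x14))"
  define D where "D = (\<lambda>(v2, v3, v4, v14 :: int). Gcd {v, v2, v3, v4})"
  define E where "E = (\<lambda>t. case t of (v2 :: int, v3 :: int, v4 :: int, v14) \<Rightarrow> case (THE z. plucker v w t z) of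
      (v13, v23, v34) \<Rightarrow> Gcd {w, v13, v14, v23, v34})"
  have Gs: "Gcd ((*) k ` A) = k * Gcd A" if "k > 0" for k :: int and A
    using that by (simp add: Gcd_mult abs_mult)
  \<comment> \<open>The maps \<open>D\<close> and \<open>E\<close> recover the two scaling factors, which gives injectivity of \<open>i\<close>.\<close>
  have key: "i ((d, c), (x2, x3, x4, x14)) \<in> loose_index v w \<and>
      D (i ((d, c), (x2, x3, x4, x14))) = d \<and> E (i ((d, c), (x2, x3, x4, x14))) = c"
    if "((d, c), (x2, x3, x4, x14)) \<in> S" for d c x2 x3 x4 x14
  proof -
    from that have dc: "d > 0" "c > 0" "d dvd v" "c dvd w" and R: "(x2, x3, x4, x14) \<in> R_index (v div d) (w div c)"
      by (auto simp: S_def I_def)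
    obtain v' where v': "v = d * v'" using dc by (meson dvdE)
    obtain w' where w': "w = c * w'" using dc by (meson dvdE)
    have vd: "v div d = v'" "w div c = w'" using dc by (simp_all add: v' w')
    have v'0: "v' > 0" using v v' dc by (simp add: zero_less_mult_iff)
    obtain x13 x23 x34 where x: "plucker v' w' (x2, x3, x4, x14) (x13, x23, x34)"
      "Gcd {v', x2, x3, x4} = 1" "Gcd {w', x13, x14, x23, x34} = 1"
      using R unfolding vd R_index_iff[OF v'0] by blast
    have p: "plucker v w (d * x2, d * x3, d * x4, c * x14) (c * x13, c * x23, c * x34)"
      unfolding v' w' plucker_scale_iff[OF dc(1,2)] by (rule x)
    have the: "(THE z. plucker v w (d * x2, d * x3, d * x4, c * x14) z) = (c * x13, c * x23, c * x34)"
      using p plucker_unique[OF _ p v] by blast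
    have "D (d * x2, d * x3, d * x4, c * x14) = Gcd ((*) d ` {v', x2, x3, x4})"
      by (simp add: D_def v' del: Gcd_insert)
    hence "D (d * x2, d * x3, d * x4, c * x14) = d" unfolding Gs[OF dc(1)] x(2) by simp
    moreover have "E (d * x2, d * x3, d * x4, c * x14) = Gcd ((*) c ` {w', x13, x14, x23, x34})"
      unfolding E_def prod.case the by (simp add: w' del: Gcd_insert)
    hence "E (d * x2, d * x3, d * x4, c * x14) = c" unfolding Gs[OF dc(2)] x(3) by simp
    ultimately show ?thesis using p loose_index_iff[OF v] unfolding i_def prod.case by blast
  qed
  have bij: "bij_betw i S (loose_index v w)"
  proof (rule bij_betw_imageI)
    show "inj_on i S"
    proof (rule inj_onI)
      fix a b assume ab: "a \<in> S" "b \<in> S" "i a = i b"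
      obtain d c x2 x3 x4 x14 where a: "a = ((d, c), (x2, x3, x4, x14))" by (metis prod.exhaust)
      obtain d' c' y2 y3 y4 y14 where b: "b = ((d', c'), (y2, y3, y4, y14))" by (metis prod.exhaust)
      have "d = d'" "c = c'" using key ab unfolding a b by metis+
      moreover have "d > 0" "c > 0" using ab by (auto simp: S_def I_def a)
      ultimately show "a = b" using ab(3) by (simp add: a b i_def)
    qed
    show "i ` S = loose_index v w"
    proof
      show "i ` S \<subseteq> loose_index v w" using key by fastforce
      show "loose_index v w \<subseteq> i ` S"
      proof
        fix t assume "t \<in> loose_index v w"
        then obtain z where z: "plucker v w t z" using loose_index_iff[OF v] by blast
        obtain v2 v3 v4 v14 where t: "t = (v2, v3, v4, v14)" by (cases t)
        obtain v13 v23 v34 where zz: "z = (v13, v23, v34)" by (cases z)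
        define d where "d = Gcd {v, v2, v3, v4}"
        define c where "c = Gcd {w, v13, v14, v23, v34}"
        have d_eq: "Gcd {v, v2, v3, v4} = d" and c_eq: "Gcd {w, v13, v14, v23, v34} = c"
          by (simp_all only: d_def c_def)
        have dd: "d dvd v" "d dvd v2" "d dvd v3" "d dvd v4" unfolding d_def by (rule Gcd_dvd; simp)+
        have cc: "c dvd w" "c dvd v13" "c dvd v14" "c dvd v23" "c dvd v34" unfolding c_def by (rule Gcd_dvd; simp)+
        have d0: "d > 0" and c0: "c > 0"
          using dd(1) cc(1) v w by (auto simp: d_def c_def simp del: Gcd_insert intro!: order.not_eq_order_implies_strict)
        obtain v' x2 x3 x4 where d: "v = d * v'" "v2 = d * x2" "v3 = d * x3" "v4 = d * x4"
          using dd by (meson dvdE)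
        obtain w' x13 x14 x23 x34 where c: "w = c * w'" "v13 = c * x13" "v14 = c * x14" "v23 = c * x23" "v34 = c * x34"
          using cc by (meson dvdE)
        have vd: "v div d = v'" "w div c = w'" using d0 c0 by (simp_all add: d c)
        have v'0: "v' > 0" using v d d0 by (simp add: zero_less_mult_iff)
        have p: "plucker v' w' (x2, x3, x4, x14) (x13, x23, x34)"
          using z unfolding t zz d c plucker_scale_iff[OF d0 c0] .
        have "(*) d ` {v', x2, x3, x4} = {v, v2, v3, v4}"
          unfolding d image_insert image_empty ..
        hence "Gcd ((*) d ` {v', x2, x3, x4}) = d" by (metis d_eq)
        hence g1: "Gcd {v', x2, x3, x4} = 1" using d0 unfolding Gs[OF d0] by (simp del: Gcd_insert)
        have "(*) c ` {w', x13, x14, x23, x34} = {w, v13, v14, v23, v34}"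
          unfolding c image_insert image_empty ..
        hence "Gcd ((*) c ` {w', x13, x14, x23, x34}) = c" by (metis c_eq)
        hence g2: "Gcd {w', x13, x14, x23, x34} = 1" using c0 unfolding Gs[OF c0] by (simp del: Gcd_insert)
        have "(x2, x3, x4, x14) \<in> R_index (v div d) (w div c)"
          unfolding vd R_index_iff[OF v'0] using p g1 g2 by blast
        hence "((d, c), (x2, x3, x4, x14)) \<in> S" using d0 c0 dd(1) cc(1) by (simp add: S_def I_def)
        moreover have "t = i ((d, c), (x2, x3, x4, x14))" by (simp add: t i_def d(2-4) c(3))
        ultimately show "t \<in> i ` S" by blast
      qed
    qed
  qed
  have finI: "finite I" using v w by (simp add: I_def)
  have finR: "finite (R_index a b)" for a b
  proof (rule finite_subset)
    have "t \<in> R_index a b \<Longrightarrow> t \<in> {0..<a} \<times> {0..<a} \<times> {0..<a} \<times> {0..<b}" for t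
      unfolding R_index_def by (cases t) (unfold mem_Collect_eq prod.case, blast)
    thus "R_index a b \<subseteq> {0..<a} \<times> {0..<a} \<times> {0..<a} \<times> {0..<b}" by blast
  qed simp
  define f where "f = (\<lambda>(v2, v3 :: int, v4 :: int, v14). char_mod v (n1 * v2) * char_mod w (n2 * v14))"
  have "loose_sum n1 n2 v w = (\<Sum>t\<in>loose_index v w. f t)" by (simp add: loose_sum_def f_def)
  also have "\<dots> = (\<Sum>x\<in>S. f (i x))" by (rule sum.reindex_bij_betw[OF bij, symmetric])
  also have "\<dots> = (\<Sum>p\<in>I. \<Sum>x\<in>(case p of (d, c) \<Rightarrow> R_index (v div d) (w div c)). f (i (p, x)))"
    unfolding S_def using finI finR by (subst sum.Sigma) auto
  also have "\<dots> = (\<Sum>(d, c)\<in>I. flag_sum n1 n2 (v div d) (w div c))"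
  proof (intro sum.cong refl, clarify, unfold prod.case flag_sum_def, intro sum.cong refl, clarify)
    fix d c x2 x3 x4 x14 assume "(d, c) \<in> I"
    hence dc: "d > 0" "c > 0" "d dvd v" "c dvd w" by (auto simp: I_def)
    obtain v' where v': "v = d * v'" using dc by (meson dvdE)
    obtain w' where w': "w = c * w'" using dc by (meson dvdE)
    have vd: "v div d = v'" "w div c = w'" using dc by (simp_all add: v' w')
    show "f (i ((d, c), x2, x3, x4, x14)) = char_mod (v div d) (n1 * x2) * char_mod (w div c) (n2 * x14)"
      unfolding vd using char_mod_mult_cancel[of d v' "n1 * x2"] char_mod_mult_cancel[of c w' "n2 * x14"] dc
      by (simp add: f_def i_def v' w' mult_ac)
  qed
  finally show ?thesis by (simp add: I_def)
qed

section \<open>Prime powers\<close>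

lemma prime_power_dvd_iff_le:
  fixes p :: int assumes "prime p" "n \<noteq> 0"
  shows "p ^ i dvd n \<longleftrightarrow> i \<le> multiplicity p n"
  using assms by (intro power_dvd_iff_le_multiplicity) (auto simp: not_prime_unit)

lemma gcd_prime_powers:
  fixes p :: int assumes "p > 0"
  shows "gcd (p ^ k) (p ^ m) = p ^ min k m"
proof (cases "k \<le> m")
  case True
  hence "p ^ k dvd p ^ m" by (rule le_imp_power_dvd)
  thus ?thesis using True assms by (simp add: min_def gcd_proj1_if_dvd)
next
  case False
  hence "p ^ m dvd p ^ k" by (intro le_imp_power_dvd) simp
  thus ?thesis using False assms by (simp add: min_def gcd_proj2_if_dvd)
qed

lemma sum_char_mod_multiples:
  fixes p :: int assumes p: "p > 0" and t: "t \<le> e"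
  shows "(\<Sum>c\<in>{0..<p ^ e}. if p ^ t dvd c then char_mod (p ^ e) (n * c) else 0)
       = (if p ^ (e - t) dvd n then of_int p ^ (e - t) else 0)"
proof -
  have pe: "p ^ e = p ^ t * p ^ (e - t)" using t by (simp add: power_add[symmetric])
  have "(\<Sum>c\<in>{0..<p ^ t * p ^ (e - t)}. if p ^ t dvd c then char_mod (p ^ e) (n * c) else 0)
     = (\<Sum>y\<in>{0..<p ^ (e - t)}. char_mod (p ^ e) (n * (p ^ t * y)))"
    using p by (intro sum_residues_multiples) simp
  also have "\<dots> = (\<Sum>y\<in>{0..<p ^ (e - t)}. char_mod (p ^ (e - t)) (n * y))"
  proof (intro sum.cong refl)
    fix y
    show "char_mod (p ^ e) (n * (p ^ t * y)) = char_mod (p ^ (e - t)) (n * y)"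
      using char_mod_mult_cancel[of "p ^ t" "p ^ (e - t)" "n * y"] p by (simp add: pe mult_ac)
  qed
  finally show ?thesis using p by (simp add: pe[symmetric] sum_char_mod)
qed

lemma ramanujan_sum_1 [simp]: "ramanujan_sum 1 n = 1"
proof -
  have "{0..<1::int} = {0}" by auto
  thus ?thesis by (simp add: ramanujan_sum_def)
qed

lemma ramanujan_sum_prime_power:
  fixes p :: int assumes p: "prime p"
  shows "ramanujan_sum (p ^ Suc j) n =
     (if p ^ Suc j dvd n then of_int p ^ Suc j else 0) - (if p ^ j dvd n then of_int p ^ j else 0)"
proof -
  have p0: "p > 0" using p by (simp add: prime_gt_0_int)
  have "coprime u (p ^ Suc j) \<longleftrightarrow> \<not> p dvd u" for u
  proof -
    have "coprime u (p ^ Suc j) \<longleftrightarrow> coprime p u" by (auto simp: coprime_commute)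
    also have "\<dots> \<longleftrightarrow> \<not> p dvd u"
      using p prime_imp_coprime[of p u] coprime_absorb_left[of p u] not_prime_unit[of p] by blast
    finally show ?thesis .
  qed
  hence "ramanujan_sum (p ^ Suc j) n = (\<Sum>u\<in>{0..<p ^ Suc j}.
      (if p ^ 0 dvd u then char_mod (p ^ Suc j) (n * u) else 0) -
      (if p ^ 1 dvd u then char_mod (p ^ Suc j) (n * u) else 0))"
    unfolding ramanujan_sum_def by (intro sum.cong refl) simp
  also have "\<dots> = (if p ^ (Suc j - 0) dvd n then of_int p ^ (Suc j - 0) else 0) - (if p ^ (Suc j - 1) dvd n then of_int p ^ (Suc j - 1) else 0)"
    unfolding sum_subtractf by (intro arg_cong2[of _ _ _ _ "(-)"] sum_char_mod_multiples p0) auto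
  finally show ?thesis by simp
qed

lemma prime_power_dvd_square_iff:
  fixes p c :: int assumes p: "prime p" and u: "gcd c (p ^ \<tau>) = p ^ u" "u \<le> \<tau>"
  shows "p ^ \<tau> dvd c\<^sup>2 \<longleftrightarrow> (\<tau> + 1) div 2 \<le> u"
proof -
  have p0: "p > 0" using p by (simp add: prime_gt_0_int)
  have "p ^ u dvd c" using u(1) by (metis gcd_dvd1)
  then obtain d where d: "c = p ^ u * d" by (meson dvdE)
  have c2: "c\<^sup>2 = p ^ (2 * u) * d\<^sup>2" by (simp add: d power_mult_distrib power_mult[symmetric] mult.commute)
  show ?thesis
  proof (cases "\<tau> \<le> 2 * u")
    case True
    hence "p ^ \<tau> dvd p ^ (2 * u)" by (rule le_imp_power_dvd)
    thus ?thesis using True by (simp add: c2)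
  next
    case False
    have nd: "\<not> p dvd d"
    proof
      assume "p dvd d"
      hence "p ^ Suc u dvd c" by (simp add: d mult.commute mult_dvd_mono)
      moreover have "p ^ Suc u dvd p ^ \<tau>" using False by (intro le_imp_power_dvd) simp
      ultimately have "p ^ Suc u dvd p ^ u" using u(1) by (metis gcd_greatest)
      hence "p dvd 1" using p0 by simp
      thus False using p not_prime_unit by blast
    qed
    have "\<not> p ^ \<tau> dvd c\<^sup>2"
    proof
      assume "p ^ \<tau> dvd c\<^sup>2"
      moreover have "p ^ Suc (2 * u) dvd p ^ \<tau>" using False by (intro le_imp_power_dvd) simp
      ultimately have "p ^ Suc (2 * u) dvd p ^ (2 * u) * d\<^sup>2" by (metis c2 dvd_trans)
      hence "p ^ (2 * u) * p dvd p ^ (2 * u) * d\<^sup>2" by (simp only: power_Suc2)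
      hence "p dvd d\<^sup>2" using p0 by (simp add: dvd_mult_cancel_left)
      thus False using nd p prime_dvd_power by blast
    qed
    thus ?thesis using False by simp
  qed
qed

text \<open>
  Modulo a prime power the gcds form a chain, so a function of \<open>gcd c (p ^ \<tau>)\<close> is a telescoping
  combination of the indicators of \<open>p ^ t dvd c\<close>; the condition on \<open>c\<^sup>2\<close> says that the chain starts at
  \<open>\<lceil>\<tau>/2\<rceil>\<close>. Each indicator leaves a complete character sum.
\<close>

lemma sum_by_gcd_prime_power:
  fixes p :: int and G :: "int \<Rightarrow> complex"
  assumes p: "prime p" and le: "\<tau> \<le> e"
  defines "t0 \<equiv> (\<tau> + 1) div 2"
  shows "(\<Sum>c\<in>{0..<p ^ e}. if p ^ \<tau> dvd c\<^sup>2 then G (gcd c (p ^ \<tau>)) * char_mod (p ^ e) (n * c) else 0)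
     = (\<Sum>t\<in>{t0..\<tau>}. G (p ^ t) * (if p ^ (e - t) dvd n then of_int p ^ (e - t) else 0))
     - (\<Sum>t\<in>{t0<..\<tau>}. G (p ^ (t - 1)) * (if p ^ (e - t) dvd n then of_int p ^ (e - t) else 0))"
proof -
  have p0: "p > 0" using p by (simp add: prime_gt_0_int)
  have tele: "(\<Sum>t\<in>{t0..u}. g t) - (\<Sum>t\<in>{t0<..u}. g (t - 1)) = (if t0 \<le> u then g u else 0)"
    for g :: "nat \<Rightarrow> complex" and u
  proof (cases "t0 \<le> u")
    case True
    thus ?thesis
    proof (induction u rule: dec_induct)
      case (step u)
      have "{t0..Suc u} = insert (Suc u) {t0..u}" "{t0<..Suc u} = insert (Suc u) {t0<..u}"
        using step.hyps by auto
      thus ?case using step by (simp add: algebra_simps)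
    qed simp
  qed auto
  have pt: "(if p ^ \<tau> dvd c\<^sup>2 then G (gcd c (p ^ \<tau>)) else 0)
     = (\<Sum>t\<in>{t0..\<tau>}. if p ^ t dvd c then G (p ^ t) else 0) - (\<Sum>t\<in>{t0<..\<tau>}. if p ^ t dvd c then G (p ^ (t - 1)) else 0)" for c
  proof -
    have "gcd c (p ^ \<tau>) dvd p ^ \<tau>" by simp
    then obtain u where u: "u \<le> \<tau>" "normalize (gcd c (p ^ \<tau>)) = normalize (p ^ u)"
      using divides_primepow_weak[of p "gcd c (p ^ \<tau>)" \<tau>] p by auto
    have g: "gcd c (p ^ \<tau>) = p ^ u" using u(2) p0 by simp
    have iff: "p ^ t dvd c \<longleftrightarrow> t \<le> u" if "t \<le> \<tau>" for t
    proof -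
      have "p ^ t dvd c \<longleftrightarrow> p ^ t dvd gcd c (p ^ \<tau>)" using that by (auto intro: le_imp_power_dvd dvd_trans)
      also have "\<dots> \<longleftrightarrow> t \<le> u" unfolding g using p p0 not_prime_unit[of p] by (subst dvd_power_iff) auto
      finally show ?thesis .
    qed
    have "(\<Sum>t\<in>{t0..\<tau>}. if p ^ t dvd c then G (p ^ t) else 0) = (\<Sum>t\<in>{t0..u}. G (p ^ t))"
      using u iff by (intro sum.mono_neutral_cong_right) auto
    moreover have "(\<Sum>t\<in>{t0<..\<tau>}. if p ^ t dvd c then G (p ^ (t - 1)) else 0) = (\<Sum>t\<in>{t0<..u}. G (p ^ (t - 1)))"
      using u iff by (intro sum.mono_neutral_cong_right) auto
    ultimately show ?thesis using tele[of "\<lambda>t. G (p ^ t)" u] prime_power_dvd_square_iff[OF p g u(1)] g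
      by (simp add: t0_def)
  qed
  have "(\<Sum>c\<in>{0..<p ^ e}. if p ^ \<tau> dvd c\<^sup>2 then G (gcd c (p ^ \<tau>)) * char_mod (p ^ e) (n * c) else 0)
     = (\<Sum>c\<in>{0..<p ^ e}. (if p ^ \<tau> dvd c\<^sup>2 then G (gcd c (p ^ \<tau>)) else 0) * char_mod (p ^ e) (n * c))"
    by (intro sum.cong refl) simp
  also have "\<dots> = (\<Sum>c\<in>{0..<p ^ e}. (\<Sum>t\<in>{t0..\<tau>}. G (p ^ t) * (if p ^ t dvd c then char_mod (p ^ e) (n * c) else 0)))
       - (\<Sum>c\<in>{0..<p ^ e}. (\<Sum>t\<in>{t0<..\<tau>}. G (p ^ (t - 1)) * (if p ^ t dvd c then char_mod (p ^ e) (n * c) else 0)))"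
    unfolding pt sum_subtractf[symmetric] left_diff_distrib sum_distrib_right
    by (intro sum.cong refl arg_cong2[of _ _ _ _ "(-)"]) auto
  also have "\<dots> = (\<Sum>t\<in>{t0..\<tau>}. G (p ^ t) * (\<Sum>c\<in>{0..<p ^ e}. if p ^ t dvd c then char_mod (p ^ e) (n * c) else 0))
       - (\<Sum>t\<in>{t0<..\<tau>}. G (p ^ (t - 1)) * (\<Sum>c\<in>{0..<p ^ e}. if p ^ t dvd c then char_mod (p ^ e) (n * c) else 0))"
    unfolding sum_distrib_left by (intro arg_cong2[of _ _ _ _ "(-)"] sum.swap)
  also have "\<dots> = (\<Sum>t\<in>{t0..\<tau>}. G (p ^ t) * (if p ^ (e - t) dvd n then of_int p ^ (e - t) else 0))
     - (\<Sum>t\<in>{t0<..\<tau>}. G (p ^ (t - 1)) * (if p ^ (e - t) dvd n then of_int p ^ (e - t) else 0))"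
    using le by (intro arg_cong2[of _ _ _ _ "(-)"] sum.cong refl) (simp_all add: sum_char_mod_multiples[OF p0])
  finally show ?thesis .
qed

text \<open>
  The value of \<open>fibre_sum n (p ^ k) (p ^ j) (p ^ m)\<close>, where \<open>P\<close> stands for \<open>p\<close> and \<open>a\<close> for the
  multiplicity of \<open>p\<close> in \<open>n\<close>. For fixed \<open>i\<close> each of the two counts is over a region of pairs \<open>(k, m)\<close>
  cut out by linear inequalities, which makes the generating function in \<open>k\<close> and \<open>m\<close> elementary.
\<close>

definition local_fibre :: "complex \<Rightarrow> nat \<Rightarrow> nat \<Rightarrow> nat \<Rightarrow> nat \<Rightarrow> complex" where
  "local_fibre P a k j m =
     (if 2 * k < m \<and> k \<le> a then P ^ (3 * k) else 0)
     + P ^ (k + m) * (\<Sum>i\<le>a. of_bool (m \<le> k + i \<and> 2 * i \<le> m \<and> k \<le> a + j + i \<and> m \<le> a + j + i))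
     - P ^ (k + m) / P * (\<Sum>i\<le>a. of_bool (m \<le> k + i \<and> 2 * i + 2 \<le> m \<and> k \<le> a + j + i + 1 \<and> m \<le> a + j + i + 1))"

text \<open>
  The summation variable is \<open>i = e - t\<close>, where \<open>p ^ t\<close> is the level in the telescoping sum over gcds:
  then \<open>p ^ i\<close> must divide \<open>n\<close>, and \<open>p ^ (K - i)\<close> must divide \<open>n p ^ j\<close>.
\<close>

lemma fibre_sum_prime_power_raw:
  fixes p n :: int and k m j :: nat assumes p: "prime p" and n: "n \<noteq> 0"
  defines "a \<equiv> multiplicity p n"
  defines "e \<equiv> min k m" 
  defines "\<tau> \<equiv> e - min e (m - e)"
  defines "t0 \<equiv> (\<tau> + 1) div 2"
  defines "K \<equiv> k + e - \<tau>"
  shows "fibre_sum n (p ^ k) (p ^ j) (p ^ m) =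
     of_int p ^ (e + K) * (\<Sum>i\<in>{e - \<tau>..e - t0}. of_bool (i \<le> a \<and> K \<le> a + j + i))
   - of_int p ^ (e + K) / of_int p * (\<Sum>i\<in>{e - \<tau>..<e - t0}. of_bool (i \<le> a \<and> K \<le> a + j + i + 1))"
proof -
  have p0: "p > 0" using p by (simp add: prime_gt_0_int)
  have np: "p ^ i dvd n * p ^ j \<longleftrightarrow> i \<le> a + j" for i
  proof -
    have "multiplicity p (n * p ^ j) = a + j"
    proof -
      have "multiplicity p (n * p ^ j) = multiplicity p n + multiplicity p (p ^ j)"
        using p n p0 by (intro prime_elem_multiplicity_mult_distrib) auto
      moreover have "multiplicity p (p ^ j) = j"
        using p p0 not_prime_unit[of p] by (intro multiplicity_same_power) auto
      ultimately show ?thesis by (simp add: a_def)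
    qed
    thus ?thesis using prime_power_dvd_iff_le[of p "n * p ^ j" i] p n p0 by simp
  qed
  have ek: "e \<le> k" and em: "e \<le> m" by (simp_all add: e_def)
  have \<tau>e: "\<tau> \<le> e" by (simp only: \<tau>_def diff_le_self)
  have \<tau>k: "\<tau> \<le> k" using \<tau>e ek by (rule le_trans)
  define G where "G = (\<lambda>x::int. let w = p ^ k div (p ^ \<tau> div x) in if w dvd n * p ^ j then of_int w else (0::complex))"
  have G: "G (p ^ t) = (if k - \<tau> + t \<le> a + j then of_int p ^ (k - \<tau> + t) else 0)" if "t \<le> \<tau>" for t
  proof -
    have "p ^ \<tau> div p ^ t = p ^ (\<tau> - t)" using that p0 by (intro power_diff[symmetric]) auto
    moreover have "p ^ k div p ^ (\<tau> - t) = p ^ (k - (\<tau> - t))" using that p0 \<tau>k by (intro power_diff[symmetric]) auto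
    moreover have "k - (\<tau> - t) = k - \<tau> + t" using that \<tau>k by simp
    ultimately show ?thesis by (simp only: G_def Let_def np of_int_power)
  qed
  have "fibre_sum n (p ^ k) (p ^ j) (p ^ m) = of_int (p ^ e) *
     (\<Sum>c\<in>{0..<p ^ e}. if p ^ \<tau> dvd c\<^sup>2 then G (gcd c (p ^ \<tau>)) * char_mod (p ^ e) (n * c) else 0)"
  proof -
    have 1: "gcd (p ^ k) (p ^ m) = p ^ e" by (simp add: gcd_prime_powers p0 e_def)
    have 2: "p ^ m div p ^ e = p ^ (m - e)" using p0 em by (intro power_diff[symmetric]) auto
    have 3: "p ^ e div gcd (p ^ e) (p ^ (m - e)) = p ^ \<tau>"
      unfolding gcd_prime_powers[OF p0] \<tau>_def using p0 by (intro power_diff[symmetric]) auto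
    have 4: "(if x dvd n * p ^ j then of_int x * y else 0) = (if x dvd n * p ^ j then of_int x else 0) * y"
      for x and y :: complex by simp
    show ?thesis unfolding fibre_sum_def Let_def 1 2 3 4 G_def ..
  qed
  also have "\<dots> = of_int p ^ e * (
      (\<Sum>t\<in>{t0..\<tau>}. G (p ^ t) * (if p ^ (e - t) dvd n then of_int p ^ (e - t) else 0))
     - (\<Sum>t\<in>{t0<..\<tau>}. G (p ^ (t - 1)) * (if p ^ (e - t) dvd n then of_int p ^ (e - t) else 0)))"
    unfolding t0_def by (subst sum_by_gcd_prime_power[OF p \<tau>e]) simp
  also have "(\<Sum>t\<in>{t0..\<tau>}. G (p ^ t) * (if p ^ (e - t) dvd n then of_int p ^ (e - t) else 0))
      = of_int p ^ K * (\<Sum>i\<in>{e - \<tau>..e - t0}. of_bool (i \<le> a \<and> K \<le> a + j + i))"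
    unfolding sum_distrib_left
  proof (rule sum.reindex_bij_witness[of _ "\<lambda>i. e - i" "\<lambda>t. e - t"], goal_cases)
    case (5 t)
    hence t: "t \<le> \<tau>" by simp
    have K: "K = (k - \<tau> + t) + (e - t)" using t \<tau>k \<tau>e by (simp add: K_def)
    have "K \<le> a + j + (e - t) \<longleftrightarrow> k - \<tau> + t \<le> a + j" unfolding K by simp
    moreover have "(of_int p :: complex) ^ K = of_int p ^ (k - \<tau> + t) * of_int p ^ (e - t)" unfolding K by (rule power_add)
    ultimately show ?case using G[OF t] prime_power_dvd_iff_le[OF p n, of "e - t"] by (simp add: a_def)
  qed (use \<tau>e in \<open>auto simp: t0_def\<close>)
  also have "(\<Sum>t\<in>{t0<..\<tau>}. G (p ^ (t - 1)) * (if p ^ (e - t) dvd n then of_int p ^ (e - t) else 0))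
      = of_int p ^ K / of_int p * (\<Sum>i\<in>{e - \<tau>..<e - t0}. of_bool (i \<le> a \<and> K \<le> a + j + i + 1))"
    unfolding sum_distrib_left
  proof (rule sum.reindex_bij_witness[of _ "\<lambda>i. e - i" "\<lambda>t. e - t"], goal_cases)
    case (5 t)
    hence t: "t \<le> \<tau>" "t \<ge> 1" by auto
    have K: "K = Suc ((k - \<tau> + (t - 1)) + (e - t))" using t \<tau>k \<tau>e by (simp add: K_def)
    have "K \<le> a + j + (e - t) + 1 \<longleftrightarrow> k - \<tau> + (t - 1) \<le> a + j" unfolding K by simp
    moreover have "(of_int p :: complex) ^ K / of_int p = of_int p ^ (k - \<tau> + (t - 1)) * of_int p ^ (e - t)"
      unfolding K using p0 by (simp add: power_add)
    ultimately show ?case using G[of "t - 1"] t prime_power_dvd_iff_le[OF p n, of "e - t"] by (simp add: a_def)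
  qed (use \<tau>e in \<open>auto simp: t0_def\<close>)
  finally show ?thesis by (simp add: power_add right_diff_distrib mult.assoc)
qed

lemma fibre_sum_prime_power:
  fixes p n :: int assumes p: "prime p" and n: "n \<noteq> 0"
  shows "fibre_sum n (p ^ k) (p ^ j) (p ^ m) = local_fibre (of_int p) (multiplicity p n) k j m"
proof -
  define a where "a = multiplicity p n"
  define P where "P = (of_int p :: complex)"
  have count: "(\<Sum>i\<in>A. of_bool (i \<le> a \<and> Q i)) = (\<Sum>i\<le>a. of_bool (i \<in> A \<and> Q i) :: complex)" if "finite A" for A Q
    using that by (intro sum.mono_neutral_cong) auto
  show ?thesis
  proof (cases "m \<le> 2 * k")
    case True
    define e where "e = min k m"
    define \<tau> where "\<tau> = e - min e (m - e)"
    have eqs: "e - \<tau> = m - k" "e - (\<tau> + 1) div 2 = m div 2" "k + e - \<tau> = max k m" "e + max k m = k + m"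
      using True by (auto simp: e_def \<tau>_def min_def max_def)
    have "fibre_sum n (p ^ k) (p ^ j) (p ^ m) =
       P ^ (k + m) * (\<Sum>i\<in>{m - k..m div 2}. of_bool (i \<le> a \<and> max k m \<le> a + j + i))
     - P ^ (k + m) / P * (\<Sum>i\<in>{m - k..<m div 2}. of_bool (i \<le> a \<and> max k m \<le> a + j + i + 1))"
      using fibre_sum_prime_power_raw[OF p n, of k j m, folded e_def, folded \<tau>_def, unfolded eqs]
      by (simp only: a_def P_def)
    also have "(\<Sum>i\<in>{m - k..m div 2}. of_bool (i \<le> a \<and> max k m \<le> a + j + i) :: complex)
      = (\<Sum>i\<le>a. of_bool (m \<le> k + i \<and> 2 * i \<le> m \<and> k \<le> a + j + i \<and> m \<le> a + j + i))"
      unfolding count[OF finite_atLeastAtMost] by (intro sum.cong refl arg_cong[of _ _ of_bool]) auto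
    also have "(\<Sum>i\<in>{m - k..<m div 2}. of_bool (i \<le> a \<and> max k m \<le> a + j + i + 1) :: complex)
      = (\<Sum>i\<le>a. of_bool (m \<le> k + i \<and> 2 * i + 2 \<le> m \<and> k \<le> a + j + i + 1 \<and> m \<le> a + j + i + 1))"
      unfolding count[OF finite_atLeastLessThan] by (intro sum.cong refl arg_cong[of _ _ of_bool]) auto
    finally show ?thesis using True by (simp add: local_fibre_def a_def P_def)
  next
    case 3: False
    have e: "min k m = k" "k - min k (m - k) = 0" "k + k - 0 = 2 * k" "k - (0 + 1) div 2 = k" "k - 0 = k" "k + 2 * k = 3 * k"
      using 3 by auto
    have "fibre_sum n (p ^ k) (p ^ j) (p ^ m) =
       P ^ (3 * k) * (\<Sum>i\<in>{k..k}. of_bool (i \<le> a \<and> 2 * k \<le> a + j + i))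
     - P ^ (3 * k) / P * (\<Sum>i\<in>{k..<k}. of_bool (i \<le> a \<and> 2 * k \<le> a + j + i + 1))"
      using fibre_sum_prime_power_raw[OF p n, of k j m] unfolding e a_def P_def .
    also have "\<dots> = (if k \<le> a then P ^ (3 * k) else 0)" by auto
    moreover have "(\<Sum>i\<le>a. of_bool (m \<le> k + i \<and> 2 * i \<le> m \<and> k \<le> a + j + i \<and> m \<le> a + j + i) :: complex) = 0"
      using 3 by (intro sum.neutral) auto
    moreover have "(\<Sum>i\<le>a. of_bool (m \<le> k + i \<and> 2 * i + 2 \<le> m \<and> k \<le> a + j + i + 1 \<and> m \<le> a + j + i + 1) :: complex) = 0"
      using 3 by (intro sum.neutral) auto
    ultimately show ?thesis using 3 by (simp add: local_fibre_def a_def P_def)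
  qed
qed

section \<open>The local generating function\<close>

lemma has_sum_diff:
  fixes f g :: "'a \<Rightarrow> complex"
  assumes "(f has_sum a) A" "(g has_sum b) A" shows "((\<lambda>x. f x - g x) has_sum (a - b)) A"
  using has_sum_add[OF assms(1) has_sum_uminusI[OF assms(2)]] by simp

lemma has_sum_finite_sum:
  fixes f :: "'i \<Rightarrow> 'a \<Rightarrow> complex"
  assumes "finite I" "\<And>i. i \<in> I \<Longrightarrow> (f i has_sum s i) A"
  shows "((\<lambda>x. \<Sum>i\<in>I. f i x) has_sum (\<Sum>i\<in>I. s i)) A"
  using assms by (induction I rule: finite_induct) (auto intro: has_sum_add)

lemma has_sum_geometric_from:
  fixes z :: complex assumes "norm z < 1"
  shows "((\<lambda>m. z ^ (n + m)) has_sum (z ^ n / (1 - z))) UNIV"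
proof -
  have "((\<lambda>m. z ^ m) has_sum (1 / (1 - z))) UNIV"
    using assms by (intro norm_summable_imp_has_sum geometric_sums) (simp_all add: norm_power summable_geometric)
  from has_sum_cmult_right[OF this, of "z ^ n"] show ?thesis by (simp add: power_add)
qed

lemma geometric_sum_atMost:
  fixes z :: complex assumes "z \<noteq> 1"
  shows "(\<Sum>i\<le>n. z ^ i) = (1 - z ^ Suc n) / (1 - z)"
  using assms sum_gp0[of z n] by (simp add: lessThan_Suc_atMost[symmetric])

text \<open>
  The generating function of \<open>local_fibre\<close> in closed form. Its dependence on \<open>j\<close> is a combination of
  \<open>1\<close>, \<open>(x y) ^ j\<close> and \<open>x ^ j\<close>, so that the sum over \<open>j\<close> consists of geometric sums.
\<close>

definition fibre_gen :: "complex \<Rightarrow> complex \<Rightarrow> complex \<Rightarrow> nat \<Rightarrow> nat \<Rightarrow> complex" where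
  "fibre_gen x y Y a j =
    (1 - (x * y\<^sup>2) ^ Suc a) * (1 - x * Y) * (1 - x * y * Y) / ((1 - Y) * (1 - x) * (1 - x * y) * (1 - x * y\<^sup>2))
    + (1 - x * Y) * (x * y\<^sup>2) ^ Suc a * (1 - x ^ Suc a) / ((1 - x) * (1 - y) * (1 - x * y)) * (x * y) ^ j
    - x ^ Suc a * (1 - x * y * Y) * (1 - (x * y\<^sup>2) ^ Suc a) / ((1 - x) * (1 - y) * (1 - x * y\<^sup>2)) * x ^ j"

context
  fixes x y :: complex
  assumes x: "norm x < 1" and y: "norm y < 1"
begin

lemma small_products: "norm (x * y) < 1" "norm (x * y\<^sup>2) < 1"
proof -
  show 1: "norm (x * y) < 1"
    using mult_strict_mono'[OF x y] by (simp add: norm_mult)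
  show "norm (x * y\<^sup>2) < 1"
    using mult_strict_mono'[OF 1 y] by (simp add: norm_mult power2_eq_square mult.assoc)
qed

lemma not_one: "x \<noteq> 1" "y \<noteq> 1" "x * y \<noteq> 1" "x * y\<^sup>2 \<noteq> 1"
  using x y small_products by auto

text \<open>
  For fixed \<open>i\<close> the first region counted in \<open>local_fibre\<close> is \<open>2 i \<le> m \<le> s + i\<close>,
  \<open>m - i \<le> k \<le> s + i\<close>, so its generating function is a double geometric sum.
\<close>

lemma rectangle_sum:
  assumes "i \<le> s"
  shows "(\<Sum>m\<in>{2*i..s+i}. \<Sum>k\<in>{m-i..s+i}. x ^ k * y ^ m) =
    1 / (1 - x) * (((x * y\<^sup>2) ^ i - (x * y) ^ Suc s * y ^ i) / (1 - x * y)
        - (x ^ Suc s * (x * y\<^sup>2) ^ i - (x * y) ^ Suc s * (x * y) ^ i) / (1 - y))"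
proof -
  obtain z where s: "s = i + z" using assms le_Suc_ex by blast
  have inner: "(\<Sum>k\<in>{i+r..2*i+z}. x ^ k) = (x ^ (i + r) - x ^ Suc (2*i+z)) / (1 - x)" if "r \<le> z" for r
    using that not_one by (simp add: sum_gp)
  have "(\<Sum>m\<in>{2*i..s+i}. \<Sum>k\<in>{m-i..s+i}. x ^ k * y ^ m)
      = (\<Sum>r\<le>z. \<Sum>k\<in>{i+r..2*i+z}. x ^ k * y ^ (2*i+r))"
    by (rule sum.reindex_bij_witness[of _ "\<lambda>r. 2*i+r" "\<lambda>m. m - 2*i"]) (auto simp: s intro!: sum.cong)
  also have "\<dots> = (\<Sum>r\<le>z. y ^ (2*i+r) * ((x ^ (i + r) - x ^ Suc (2*i+z)) / (1 - x)))"
  proof (intro sum.cong refl)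
    fix r assume r: "r \<in> {..z}"
    have "(\<Sum>k\<in>{i+r..2*i+z}. x ^ k * y ^ (2*i+r)) = (\<Sum>k\<in>{i+r..2*i+z}. x ^ k) * y ^ (2*i+r)"
      by (simp only: sum_distrib_right)
    thus "(\<Sum>k\<in>{i+r..2*i+z}. x ^ k * y ^ (2*i+r)) = y ^ (2*i+r) * ((x ^ (i + r) - x ^ Suc (2*i+z)) / (1 - x))"
      using r by (simp only: inner atMost_iff mult.commute[of _ "y ^ (2*i+r)"])
  qed
  also have "\<dots> = y ^ (2*i) * x ^ i / (1 - x) * (\<Sum>r\<le>z. (x * y) ^ r)
       - y ^ (2*i) * x ^ Suc (2*i+z) / (1 - x) * (\<Sum>r\<le>z. y ^ r)"
    unfolding sum_distrib_left sum_subtractf[symmetric]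
    by (intro sum.cong refl) (simp add: power_add power_mult_distrib right_diff_distrib diff_divide_distrib mult_ac)
  also have "\<dots> = 1 / (1 - x) * ((y ^ (2*i) * x ^ i - y ^ (2*i) * x ^ i * (x * y) ^ Suc z) / (1 - x * y)
       - (y ^ (2*i) * x ^ Suc (2*i+z) - y ^ (2*i) * x ^ Suc (2*i+z) * y ^ Suc z) / (1 - y))"
    unfolding geometric_sum_atMost[OF not_one(3)] geometric_sum_atMost[OF not_one(2)]
    by (simp only: right_diff_distrib diff_divide_distrib mult_1_right times_divide_eq_left times_divide_eq_right mult_1_left)
  also have "y ^ (2*i) * x ^ i = (x * y\<^sup>2) ^ i" by (simp add: power_mult_distrib power_mult[symmetric])
  also have "(x * y\<^sup>2) ^ i * (x * y) ^ Suc z = (x * y) ^ Suc s * y ^ i"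
    by (simp add: s power_mult_distrib power_add power_mult[symmetric] power2_eq_square mult_ac)
  also have "y ^ (2*i) * x ^ Suc (2*i+z) = x ^ Suc s * (x * y\<^sup>2) ^ i"
    by (simp add: s power_mult_distrib power_add power_mult[symmetric] mult_2 mult_2_right mult_ac)
  also have "x ^ Suc s * (x * y\<^sup>2) ^ i * y ^ Suc z = (x * y) ^ Suc s * (x * y) ^ i"
    by (simp add: s power_mult_distrib power_add power2_eq_square mult_ac)
  finally show ?thesis .
qed

text \<open>
  The second region counted in \<open>local_fibre\<close> is the first one without its row \<open>m = 2 i\<close>, translated
  by \<open>(1, 1)\<close>.
\<close>

lemma shifted_rectangle_sum:
  assumes "i \<le> s"
  shows "(\<Sum>m\<in>{2*i+2..s+i+1}. \<Sum>k\<in>{m-i..s+i+1}. x ^ k * y ^ m) =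
    x * y * ((\<Sum>m\<in>{2*i..s+i}. \<Sum>k\<in>{m-i..s+i}. x ^ k * y ^ m) - (x * y\<^sup>2) ^ i * (1 - x ^ Suc s) / (1 - x))"
proof -
  have "(\<Sum>m\<in>{2*i+2..s+i+1}. \<Sum>k\<in>{m-i..s+i+1}. x ^ k * y ^ m)
      = (\<Sum>m\<in>{2*i+1..s+i}. x * y * (\<Sum>k\<in>{m-i..s+i}. x ^ k * y ^ m))"
  proof (rule sum.reindex_bij_witness[of _ Suc "\<lambda>m. m - 1"], goal_cases)
    case (5 m)
    then obtain m' where m': "m = Suc m'" "m' \<ge> i" by (cases m) auto
    have "(\<Sum>k\<in>{m-i..s+i+1}. x ^ k * y ^ m) = (\<Sum>k\<in>{Suc (m'-i)..Suc (s+i)}. x ^ k * y ^ m)"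
      using m' by (simp add: Suc_diff_le)
    also have "\<dots> = (\<Sum>k\<in>{m'-i..s+i}. x ^ Suc k * y ^ m)" by (rule sum.shift_bounds_cl_Suc_ivl)
    finally show ?case using m' by (simp add: sum_distrib_left mult_ac)
  qed auto
  also have "\<dots> = x * y * ((\<Sum>m\<in>{2*i..s+i}. \<Sum>k\<in>{m-i..s+i}. x ^ k * y ^ m) - (\<Sum>k\<in>{2*i-i..s+i}. x ^ k * y ^ (2*i)))"
  proof -
    have "{2*i..s+i} = insert (2*i) {2*i+1..s+i}" using assms by auto
    thus ?thesis by (simp add: sum_distrib_left)
  qed
  also have "(\<Sum>k\<in>{2*i-i..s+i}. x ^ k * y ^ (2*i)) = (x * y\<^sup>2) ^ i * (1 - x ^ Suc s) / (1 - x)"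
  proof -
    have "(\<Sum>k\<in>{i..s+i}. x ^ k) = (x ^ i - x ^ Suc (s+i)) / (1 - x)" using not_one by (simp add: sum_gp)
    moreover have "x ^ i - x ^ Suc (s+i) = x ^ i * (1 - x ^ Suc s)" by (simp add: power_add algebra_simps)
    moreover have "y ^ (2*i) = (y\<^sup>2) ^ i" by (simp only: power_mult)
    moreover have "2 * i - i = i" by simp
    ultimately show ?thesis by (simp only: sum_distrib_right[symmetric] power_mult_distrib) (simp add: mult_ac)
  qed
  finally show ?thesis .
qed

text \<open>
  The two regions combine to \<open>(1 - U)\<close> times the first one plus \<open>U\<close> times a single row, with \<open>U = x Y\<close>. Summing
  over \<open>i \<le> a\<close> and collecting the coefficients of \<open>1\<close>, \<open>(x y) ^ j\<close> and \<open>x ^ j\<close> yields three rational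
  functions, each of which factors.
\<close>

lemma has_sum_local_fibre:
  fixes P X Y :: complex
  assumes P: "P \<noteq> 0" "x = P * X" "y = P * Y" and Y: "norm Y < 1"
  shows "((\<lambda>(k, m). local_fibre P a k j m * X ^ k * Y ^ m) has_sum fibre_gen x y Y a j) UNIV"
proof -
  define s where "s = a + j"
  define R1 where "R1 = (\<lambda>i. {(k, m). m \<in> {2*i..s+i} \<and> k \<in> {m-i..s+i}})"
  define R2 where "R2 = (\<lambda>i. {(k, m). m \<in> {2*i+2..s+i+1} \<and> k \<in> {m-i..s+i+1}})"
  have monomial: "P ^ (k + m) * X ^ k * Y ^ m = x ^ k * y ^ m" for k m
    by (simp add: P power_add power_mult_distrib mult_ac)
  have decomp: "local_fibre P a k j m * X ^ k * Y ^ m =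
      (\<Sum>i\<le>a. of_bool (k = i \<and> 2 * i < m) * ((P ^ 3 * X) ^ i * Y ^ m))
    + (\<Sum>i\<le>a. of_bool ((k, m) \<in> R1 i) * (x ^ k * y ^ m))
    - (\<Sum>i\<le>a. of_bool ((k, m) \<in> R2 i) * (x ^ k * y ^ m)) / P" for k m
  proof -
    have 1: "(\<Sum>i\<le>a. of_bool (k = i \<and> 2 * i < m) * ((P ^ 3 * X) ^ i * Y ^ m))
        = (if 2 * k < m \<and> k \<le> a then P ^ (3 * k) else 0) * X ^ k * Y ^ m"
    proof -
      have "(\<Sum>i\<le>a. of_bool (k = i \<and> 2 * i < m) * ((P ^ 3 * X) ^ i * Y ^ m))
         = (\<Sum>i\<le>a. if i = k then of_bool (2 * k < m) * ((P ^ 3 * X) ^ k * Y ^ m) else 0)"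
        by (intro sum.cong refl) auto
      thus ?thesis by (simp add: power_mult_distrib power_mult)
    qed
    have 2: "(k, m) \<in> R1 i \<longleftrightarrow> (m \<le> k + i \<and> 2 * i \<le> m \<and> k \<le> a + j + i \<and> m \<le> a + j + i)" for i
      by (auto simp: R1_def s_def)
    have 3: "(k, m) \<in> R2 i \<longleftrightarrow> (m \<le> k + i \<and> 2 * i + 2 \<le> m \<and> k \<le> a + j + i + 1 \<and> m \<le> a + j + i + 1)" for i
      by (auto simp: R2_def s_def)
    show ?thesis unfolding 1 local_fibre_def 2[symmetric] 3[symmetric] sum_distrib_right[symmetric] monomial[symmetric]
      by (simp add: algebra_simps)
  qed
  have h1: "((\<lambda>(k, m). of_bool (k = i \<and> 2 * i < m) * ((P ^ 3 * X) ^ i * Y ^ m)) has_sum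
      (Y / (1 - Y) * (x * y\<^sup>2) ^ i)) UNIV" for i
  proof -
    have "((\<lambda>m. (P ^ 3 * X) ^ i * Y ^ (Suc (2 * i) + m)) has_sum (P ^ 3 * X) ^ i * (Y ^ Suc (2 * i) / (1 - Y))) UNIV"
      by (intro has_sum_cmult_right has_sum_geometric_from Y)
    also have "(P ^ 3 * X) ^ i * (Y ^ Suc (2 * i) / (1 - Y)) = Y / (1 - Y) * (x * y\<^sup>2) ^ i"
      by (simp add: P power_mult_distrib power_mult power2_eq_square power3_eq_cube mult_ac)
    finally have *: "((\<lambda>m. (P ^ 3 * X) ^ i * Y ^ (Suc (2 * i) + m)) has_sum (Y / (1 - Y) * (x * y\<^sup>2) ^ i)) UNIV" .
    have "bij_betw (\<lambda>m. (i, Suc (2 * i) + m)) UNIV ({i} \<times> {2 * i<..})"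
      by (rule bij_betwI[where g = "\<lambda>(k, m). m - Suc (2 * i)"]) auto
    from has_sum_reindex_bij_betw[OF this, of "\<lambda>(k, m). (P ^ 3 * X) ^ i * Y ^ m"] *
    have "((\<lambda>(k, m). (P ^ 3 * X) ^ i * Y ^ m) has_sum (Y / (1 - Y) * (x * y\<^sup>2) ^ i)) ({i} \<times> {2 * i<..})"
      by simp
    also have "?this \<longleftrightarrow> ?thesis" by (rule has_sum_cong_neutral) auto
    finally show ?thesis .
  qed
  have h2: "((\<lambda>(k, m). of_bool ((k, m) \<in> R1 i) * (x ^ k * y ^ m)) has_sum
      (\<Sum>m\<in>{2*i..s+i}. \<Sum>k\<in>{m-i..s+i}. x ^ k * y ^ m)) UNIV" for i
  proof -
    have "((\<lambda>(k, m). of_bool ((k, m) \<in> R1 i) * (x ^ k * y ^ m)) has_sum (\<Sum>(k, m)\<in>R1 i. x ^ k * y ^ m)) UNIV"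
    proof (rule has_sum_finite_neutralI)
      show "finite (R1 i)" by (rule finite_subset[of _ "{..s+i} \<times> {..s+i}"]) (auto simp: R1_def)
    qed (auto intro!: sum.cong)
    also have "(\<Sum>(k, m)\<in>R1 i. x ^ k * y ^ m) = (\<Sum>(m, k)\<in>(SIGMA m:{2*i..s+i}. {m-i..s+i}). x ^ k * y ^ m)"
      by (rule sum.reindex_bij_witness[of _ prod.swap prod.swap]) (auto simp: R1_def)
    finally show ?thesis by (subst sum.Sigma) auto
  qed
  have h3: "((\<lambda>(k, m). of_bool ((k, m) \<in> R2 i) * (x ^ k * y ^ m)) has_sum
      (\<Sum>m\<in>{2*i+2..s+i+1}. \<Sum>k\<in>{m-i..s+i+1}. x ^ k * y ^ m)) UNIV" for i
  proof -
    have "((\<lambda>(k, m). of_bool ((k, m) \<in> R2 i) * (x ^ k * y ^ m)) has_sum (\<Sum>(k, m)\<in>R2 i. x ^ k * y ^ m)) UNIV"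
    proof (rule has_sum_finite_neutralI)
      show "finite (R2 i)" by (rule finite_subset[of _ "{..s+i+1} \<times> {..s+i+1}"]) (auto simp: R2_def)
    qed (auto intro!: sum.cong)
    also have "(\<Sum>(k, m)\<in>R2 i. x ^ k * y ^ m) = (\<Sum>(m, k)\<in>(SIGMA m:{2*i+2..s+i+1}. {m-i..s+i+1}). x ^ k * y ^ m)"
      by (rule sum.reindex_bij_witness[of _ prod.swap prod.swap]) (auto simp: R2_def)
    finally show ?thesis by (subst sum.Sigma) auto
  qed
  define V where "V = (\<lambda>i. \<Sum>m\<in>{2*i..s+i}. \<Sum>k\<in>{m-i..s+i}. x ^ k * y ^ m)"
  define V' where "V' = (\<lambda>i. \<Sum>m\<in>{2*i+2..s+i+1}. \<Sum>k\<in>{m-i..s+i+1}. x ^ k * y ^ m)"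
  have "((\<lambda>(k, m). local_fibre P a k j m * X ^ k * Y ^ m) has_sum
     ((\<Sum>i\<le>a. Y / (1 - Y) * (x * y\<^sup>2) ^ i) + (\<Sum>i\<le>a. V i) - (\<Sum>i\<le>a. V' i) / P)) UNIV"
    unfolding decomp split_def
    unfolding V_def V'_def
    using h1 h2 h3 unfolding split_def
    by (intro has_sum_add has_sum_diff has_sum_divide_const has_sum_finite_sum) (auto simp: split_def)
  also have "(\<Sum>i\<le>a. Y / (1 - Y) * (x * y\<^sup>2) ^ i) + (\<Sum>i\<le>a. V i) - (\<Sum>i\<le>a. V' i) / P = fibre_gen x y Y a j"
  proof -
    define S where "S = (\<lambda>z. (1 - z ^ Suc a) / (1 - z) :: complex)"
    define U where "U = x * Y"
    have U: "x * y / P = U" using P by (simp add: U_def)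
    have diff_eq: "V i - V' i / P = (1 - U) / (1 - x) * (((x * y\<^sup>2) ^ i - (x * y) ^ Suc s * y ^ i) / (1 - x * y)
        - (x ^ Suc s * (x * y\<^sup>2) ^ i - (x * y) ^ Suc s * (x * y) ^ i) / (1 - y))
        + U * (1 - x ^ Suc s) / (1 - x) * (x * y\<^sup>2) ^ i" if "i \<le> a" for i
    proof -
      have ile: "i \<le> s" using that by (simp add: s_def)
      have "V' i / P = U * (V i - (x * y\<^sup>2) ^ i * (1 - x ^ Suc s) / (1 - x))"
        unfolding V'_def shifted_rectangle_sum[OF ile] V_def U[symmetric] by simp
      hence "V i - V' i / P = (1 - U) * V i + U * (1 - x ^ Suc s) / (1 - x) * (x * y\<^sup>2) ^ i"
        by (simp add: algebra_simps)
      also have "(1 - U) * V i = (1 - U) / (1 - x) * (((x * y\<^sup>2) ^ i - (x * y) ^ Suc s * y ^ i) / (1 - x * y)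
        - (x ^ Suc s * (x * y\<^sup>2) ^ i - (x * y) ^ Suc s * (x * y) ^ i) / (1 - y))"
        unfolding V_def rectangle_sum[OF ile] by simp
      finally show ?thesis .
    qed
    have sums: "(\<Sum>i\<le>a. (x * y\<^sup>2) ^ i) = S (x * y\<^sup>2)" "(\<Sum>i\<le>a. y ^ i) = S y" "(\<Sum>i\<le>a. (x * y) ^ i) = S (x * y)"
      unfolding S_def by (rule geometric_sum_atMost, rule not_one)+
    have "(\<Sum>i\<le>a. Y / (1 - Y) * (x * y\<^sup>2) ^ i) + (\<Sum>i\<le>a. V i) - (\<Sum>i\<le>a. V' i) / P
       = Y / (1 - Y) * (\<Sum>i\<le>a. (x * y\<^sup>2) ^ i) + (\<Sum>i\<le>a. V i - V' i / P)"
      by (simp add: sum_distrib_left sum_subtractf sum_divide_distrib)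
    also have "(\<Sum>i\<le>a. V i - V' i / P) = (\<Sum>i\<le>a. (1 - U) / (1 - x) * (((x * y\<^sup>2) ^ i - (x * y) ^ Suc s * y ^ i) / (1 - x * y)
        - (x ^ Suc s * (x * y\<^sup>2) ^ i - (x * y) ^ Suc s * (x * y) ^ i) / (1 - y))
        + U * (1 - x ^ Suc s) / (1 - x) * (x * y\<^sup>2) ^ i)"
      by (intro sum.cong refl diff_eq) simp
    also have "\<dots> = (1 - U) / (1 - x) * ((S (x * y\<^sup>2) - (x * y) ^ Suc s * S y) / (1 - x * y)
        - (x ^ Suc s * S (x * y\<^sup>2) - (x * y) ^ Suc s * S (x * y)) / (1 - y))
        + U * (1 - x ^ Suc s) / (1 - x) * S (x * y\<^sup>2)"
      unfolding sums[symmetric]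
      by (simp only: sum.distrib sum_subtractf sum_distrib_left[symmetric] sum_divide_distrib[symmetric])
    also have "Y / (1 - Y) * (\<Sum>i\<le>a. (x * y\<^sup>2) ^ i) + \<dots> = fibre_gen x y Y a j"
    proof -
      define r where "r = x * y\<^sup>2"
      define u w E where "u = x ^ Suc a" and "w = y ^ Suc a" and "E = S r"
      have nz: "1 - x \<noteq> 0" "1 - y \<noteq> 0" "1 - x * y \<noteq> 0" "1 - r \<noteq> 0" "1 - Y \<noteq> 0"
        using not_one Y by (auto simp: r_def)
      have pw: "x ^ Suc s = u * x ^ j" "(x * y) ^ Suc s = u * w * (x * y) ^ j" "r ^ Suc a = u * w\<^sup>2"
        by (simp_all add: u_def w_def s_def r_def power_add power_mult_distrib power2_eq_square mult_ac)
      have beta: "- (u * w * S y) / (1 - x * y) + u * w * S (x * y) / (1 - y)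
          = u * w\<^sup>2 * (1 - u) / ((1 - y) * (1 - x * y))"
      proof -
        have 1: "S y = (1 - w) / (1 - y)" and 2: "S (x * y) = (1 - u * w) / (1 - x * y)"
          by (simp_all add: S_def w_def u_def power_mult_distrib)
        show ?thesis unfolding 1 2 using nz by (simp add: divide_simps) (simp add: algebra_simps power2_eq_square)
      qed
      have alpha: "Y / (1 - Y) + (1 - U) / ((1 - x) * (1 - x * y)) + U / (1 - x)
           = (1 - x * Y) * (1 - x * y * Y) / ((1 - Y) * (1 - x) * (1 - x * y))"
        using nz unfolding U_def by (simp add: divide_simps) (simp add: algebra_simps power2_eq_square)
      have gamma: "(1 - U) / ((1 - x) * (1 - y)) + U / (1 - x) = (1 - x * y * Y) / ((1 - x) * (1 - y))"
        using nz unfolding U_def by (simp add: divide_simps) (simp add: algebra_simps power2_eq_square)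
      have "Y / (1 - Y) * E + ((1 - U) / (1 - x) * ((E - u * w * (x * y) ^ j * S y) / (1 - x * y)
          - (u * x ^ j * E - u * w * (x * y) ^ j * S (x * y)) / (1 - y))
          + U * (1 - u * x ^ j) / (1 - x) * E)
        = E * (Y / (1 - Y) + (1 - U) / ((1 - x) * (1 - x * y)) + U / (1 - x))
          + (1 - U) / (1 - x) * (- (u * w * S y) / (1 - x * y) + u * w * S (x * y) / (1 - y)) * (x * y) ^ j
          - u * E * ((1 - U) / ((1 - x) * (1 - y)) + U / (1 - x)) * x ^ j"
        by (simp add: algebra_simps add_divide_distrib diff_divide_distrib)
      also have "\<dots> = fibre_gen x y Y a j"
        unfolding alpha beta gamma
        unfolding fibre_gen_def r_def[symmetric] pw u_def[symmetric] E_def S_def U_def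
        by (simp add: mult_ac)
      finally show ?thesis unfolding sums unfolding r_def[symmetric] pw E_def .
    qed
    finally show ?thesis .
  qed
  finally show ?thesis .
qed

end

lemma sum_divisors_prime_power:
  fixes p :: int and f :: "int \<Rightarrow> complex"
  assumes p: "prime p"
  shows "(\<Sum>d | d > 0 \<and> d dvd p ^ l. f d) = (\<Sum>m\<le>l. f (p ^ m))"
proof -
  have p1: "p > 1" using p by (rule prime_gt_1_int)
  have "{d. d > 0 \<and> d dvd p ^ l} = (\<lambda>m. p ^ m) ` {..l}"
  proof (intro equalityI subsetI)
    fix d assume "d \<in> {d. d > 0 \<and> d dvd p ^ l}"
    hence d: "d > 0" "d dvd p ^ l" by auto
    then obtain u where "u \<le> l" "normalize d = normalize (p ^ u)"
      using divides_primepow_weak[of p d l] p by auto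
    thus "d \<in> (\<lambda>m. p ^ m) ` {..l}" using d p1 by auto
  qed (use p1 in \<open>auto intro: le_imp_power_dvd\<close>)
  thus ?thesis using p1 by (simp add: sum.reindex inj_on_def)
qed

definition local_ramanujan :: "complex \<Rightarrow> nat \<Rightarrow> nat \<Rightarrow> complex" where
  "local_ramanujan P b j =
     (if j \<le> b then P ^ j else 0) - (if 0 < j \<and> j \<le> Suc b then P ^ (j - 1) else 0)"

lemma ramanujan_sum_prime_power_eq:
  fixes p n :: int assumes "prime p" "n \<noteq> 0"
  shows "ramanujan_sum (p ^ j) n = local_ramanujan (of_int p) (multiplicity p n) j"
proof (cases j)
  case 0 thus ?thesis using ramanujan_sum_1 by (simp add: local_ramanujan_def)
next
  case (Suc i)
  show ?thesis unfolding Suc ramanujan_sum_prime_power[OF assms(1)] prime_power_dvd_iff_le[OF assms]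
    by (simp add: local_ramanujan_def)
qed

lemma loose_sum_prime_powers:
  fixes p n1 n2 :: int assumes p: "prime p" and n: "n1 \<noteq> 0" "n2 \<noteq> 0"
  shows "loose_sum n1 n2 (p ^ k) (p ^ l) = (\<Sum>j\<le>l. local_ramanujan (of_int p) (multiplicity p n2) j
      * local_fibre (of_int p) (multiplicity p n1) k j (l - j))"
proof -
  have p0: "p > 0" using p by (rule prime_gt_0_int)
  have "loose_sum n1 n2 (p ^ k) (p ^ l) = (\<Sum>m\<le>l. ramanujan_sum (p ^ l div p ^ m) n2 * fibre_sum n1 (p ^ k) (p ^ l div p ^ m) (p ^ m))"
    using p0 by (simp add: loose_sum_eq sum_divisors_prime_power[OF p])
  also have "\<dots> = (\<Sum>m\<le>l. local_ramanujan (of_int p) (multiplicity p n2) (l - m)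
      * local_fibre (of_int p) (multiplicity p n1) k (l - m) m)"
  proof (intro sum.cong refl)
    fix m assume "m \<in> {..l}"
    hence "p ^ l div p ^ m = p ^ (l - m)" using p0 by (intro power_diff[symmetric]) auto
    thus "ramanujan_sum (p ^ l div p ^ m) n2 * fibre_sum n1 (p ^ k) (p ^ l div p ^ m) (p ^ m)
       = local_ramanujan (of_int p) (multiplicity p n2) (l - m) * local_fibre (of_int p) (multiplicity p n1) k (l - m) m"
      by (simp only: ramanujan_sum_prime_power_eq[OF p n(2)] fibre_sum_prime_power[OF p n(1)])
  qed
  also have "\<dots> = (\<Sum>j\<le>l. local_ramanujan (of_int p) (multiplicity p n2) j
      * local_fibre (of_int p) (multiplicity p n1) k j (l - j))"
    by (rule sum.reindex_bij_witness[of _ "\<lambda>j. l - j" "\<lambda>j. l - j"]) auto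
  finally show ?thesis .
qed

text \<open>
  The product of \<open>1 - e^\<alpha>\<close> over the positive roots \<open>\<alpha>\<close> of \<open>Sp\<^sub>4\<close>, where \<open>x\<close> and \<open>y\<close> are the exponentials
  of the long and the short simple root.
\<close>

definition weyl_denominator :: "complex \<Rightarrow> complex \<Rightarrow> complex" where
  "weyl_denominator x y = (1 - x) * (1 - y) * (1 - x * y) * (1 - x * y\<^sup>2)"

text \<open>
  With \<open>A z = z ^ (a + 1)\<close> and \<open>B z = z ^ (b + 1)\<close> this is the character of highest weight \<open>(a + b, a)\<close>,
  normalised so that its lowest weight contributes \<open>1\<close>; the eight terms of the numerator are the
  alternating sum over the Weyl group. The powers are passed as functions so that an infinite
  exponent can be represented by the zero function.
\<close>

definition schur_factor :: "complex \<Rightarrow> complex \<Rightarrow> (complex \<Rightarrow> complex) \<Rightarrow> (complex \<Rightarrow> complex) \<Rightarrow> complex" where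
  "schur_factor x y A B =
     ((1 - A (x * y\<^sup>2) * B (x * y\<^sup>2)) * (1 - A x) - B y * (1 - A x * B x) * (1 - A (x * y\<^sup>2)))
     / weyl_denominator x y"

definition euler_factor :: "complex \<Rightarrow> complex \<Rightarrow> complex \<Rightarrow> (complex \<Rightarrow> complex) \<Rightarrow> (complex \<Rightarrow> complex) \<Rightarrow> complex" where
  "euler_factor x y Y A B = (1 - x * Y) * (1 - x * y * Y) * schur_factor x y A B"

text \<open>
  The Ramanujan sum at \<open>p ^ j\<close> is a difference of two indicators, so summation by parts turns the sum
  into that of \<open>y ^ j (G j - Y G (j + 1))\<close> over \<open>j \<le> b\<close>. Here the factors \<open>1 - Y\<close>, \<open>1 - x y Y\<close> and
  \<open>1 - x Y\<close> produced by the three terms of \<open>G\<close> complete the common factor \<open>c\<close>.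
\<close>

lemma sum_local_ramanujan_fibre_gen:
  fixes x y P Y :: complex
  assumes x: "norm x < 1" and y: "norm y < 1" and P: "P \<noteq> 0" "y = P * Y" and Y: "norm Y < 1"
  shows "(\<Sum>j\<le>Suc b. local_ramanujan P b j * Y ^ j * fibre_gen x y Y a j)
      = euler_factor x y Y (\<lambda>z. z ^ Suc a) (\<lambda>z. z ^ Suc b)"
proof -
  note nz = not_one[OF x y]
  define r where "r = x * y\<^sup>2"
  have nz': "1 - x \<noteq> 0" "1 - y \<noteq> 0" "1 - x * y \<noteq> 0" "1 - r \<noteq> 0" "1 - Y \<noteq> 0"
    using nz Y by (auto simp: r_def)
  define R where "R = r ^ Suc a"
  define u where "u = x ^ Suc a"
  define c where "c = (1 - x * Y) * (1 - x * y * Y) / ((1 - x) * (1 - y) * (1 - x * y) * (1 - r))"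
  define G where "G = (\<lambda>j. fibre_gen x y Y a j)"
  have diff: "G j - Y * G (Suc j) = c * ((1 - R) * (1 - y)) + c * (R * (1 - u) * (1 - r)) * (x * y) ^ j
      - c * (u * (1 - R) * (1 - x * y)) * x ^ j" for j
  proof -
    define \<alpha> \<beta> \<gamma> where
      "\<alpha> = (1 - R) * (1 - x * Y) * (1 - x * y * Y) / ((1 - Y) * (1 - x) * (1 - x * y) * (1 - r))" and
      "\<beta> = (1 - x * Y) * R * (1 - u) / ((1 - x) * (1 - y) * (1 - x * y))" and
      "\<gamma> = u * (1 - x * y * Y) * (1 - R) / ((1 - x) * (1 - y) * (1 - r))"
    have G: "G j = \<alpha> + \<beta> * (x * y) ^ j - \<gamma> * x ^ j" for j
      unfolding G_def fibre_gen_def \<alpha>_def \<beta>_def \<gamma>_def R_def u_def r_def ..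
    have 1: "\<alpha> * (1 - Y) = c * ((1 - R) * (1 - y))"
      unfolding \<alpha>_def c_def using nz' by (simp add: divide_simps)
    have 2: "\<beta> * (1 - x * y * Y) = c * (R * (1 - u) * (1 - r))"
      unfolding \<beta>_def c_def using nz' by (simp add: divide_simps)
    have 3: "\<gamma> * (1 - x * Y) = c * (u * (1 - R) * (1 - x * y))"
      unfolding \<gamma>_def c_def using nz' by (simp add: divide_simps)
    have "G j - Y * G (Suc j) = \<alpha> * (1 - Y) + (\<beta> * (1 - x * y * Y)) * (x * y) ^ j - (\<gamma> * (1 - x * Y)) * x ^ j"
      unfolding G by (simp add: algebra_simps)
    thus ?thesis unfolding 1 2 3 .
  qed
  have "(\<Sum>j\<le>Suc b. local_ramanujan P b j * Y ^ j * G j)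
      = (\<Sum>j\<le>Suc b. if j \<le> b then y ^ j * G j else 0) - (\<Sum>j\<le>Suc b. if 0 < j then P ^ (j - 1) * Y ^ j * G j else 0)"
    unfolding sum_subtractf[symmetric] local_ramanujan_def
    by (intro sum.cong refl) (auto simp: P(2) power_mult_distrib algebra_simps)
  also have "(\<Sum>j\<le>Suc b. if j \<le> b then y ^ j * G j else 0) = (\<Sum>j\<le>b. y ^ j * G j)" by simp
  also have "(\<Sum>j\<le>Suc b. if 0 < j then P ^ (j - 1) * Y ^ j * G j else 0) = (\<Sum>j\<le>b. y ^ j * (Y * G (Suc j)))"
    unfolding sum.atMost_Suc_shift by (simp add: P(2) power_mult_distrib mult_ac)
  also have "(\<Sum>j\<le>b. y ^ j * G j) - (\<Sum>j\<le>b. y ^ j * (Y * G (Suc j))) = (\<Sum>j\<le>b. y ^ j * (G j - Y * G (Suc j)))"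
    by (simp add: sum_subtractf right_diff_distrib)
  also have "\<dots> = c * ((1 - R) * (1 - y)) * (\<Sum>j\<le>b. y ^ j) + c * (R * (1 - u) * (1 - r)) * (\<Sum>j\<le>b. r ^ j)
      - c * (u * (1 - R) * (1 - x * y)) * (\<Sum>j\<le>b. (x * y) ^ j)"
    unfolding diff sum_distrib_left sum_subtractf[symmetric] sum.distrib[symmetric]
    by (intro sum.cong refl)
      (simp add: r_def power_mult_distrib power2_eq_square distrib_left right_diff_distrib mult_ac)
  also have "\<dots> = c * ((1 - R) * (1 - y ^ Suc b) + R * (1 - u) * (1 - r ^ Suc b) - u * (1 - R) * (1 - (x * y) ^ Suc b))"
  proof -
    have g: "(1 - z) * (\<Sum>j\<le>b. z ^ j) = 1 - z ^ Suc b" if "z \<noteq> 1" for z :: complex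
      using geometric_sum_atMost[OF that, of b] that by simp
    have 1: "c * ((1 - R) * (1 - y)) * (\<Sum>j\<le>b. y ^ j) = c * (1 - R) * (1 - y ^ Suc b)"
      using g[OF nz(2)] by (simp only: mult.assoc)
    have 2: "c * (R * (1 - u) * (1 - r)) * (\<Sum>j\<le>b. r ^ j) = c * (R * (1 - u)) * (1 - r ^ Suc b)"
      using g[OF nz(4)] unfolding r_def[symmetric] by (simp only: mult.assoc)
    have 3: "c * (u * (1 - R) * (1 - x * y)) * (\<Sum>j\<le>b. (x * y) ^ j) = c * (u * (1 - R)) * (1 - (x * y) ^ Suc b)"
      using g[OF nz(3)] by (simp only: mult.assoc)
    show ?thesis unfolding 1 2 3 by (simp add: algebra_simps del: power_Suc)
  qed
  also have "\<dots> = c * ((1 - R * r ^ Suc b) * (1 - u) - y ^ Suc b * (1 - u * x ^ Suc b) * (1 - R))"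
    unfolding power_mult_distrib by (rule arg_cong[of _ _ "(*) c"]) (simp add: algebra_simps)
  also have "\<dots> = euler_factor x y Y (\<lambda>z. z ^ Suc a) (\<lambda>z. z ^ Suc b)"
    unfolding euler_factor_def schur_factor_def weyl_denominator_def c_def R_def u_def r_def by simp
  finally show ?thesis unfolding G_def .
qed

text \<open>
  A Casselman-Shalika formula: for nonzero \<open>n1\<close> and \<open>n2\<close> the local generating function is a
  normalised symplectic character times two factors of the inverse zeta functions.
\<close>

lemma has_sum_loose_local:
  fixes p n1 n2 :: int and X Y :: complex
  assumes p: "prime p" and n: "n1 \<noteq> 0" "n2 \<noteq> 0"
    and x: "norm (of_int p * X) < 1" and y: "norm (of_int p * Y) < 1"
  shows "((\<lambda>(k, l). loose_sum n1 n2 (p ^ k) (p ^ l) * X ^ k * Y ^ l) has_sum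
     euler_factor (of_int p * X) (of_int p * Y) Y
       (\<lambda>z. z ^ Suc (multiplicity p n1)) (\<lambda>z. z ^ Suc (multiplicity p n2))) UNIV"
proof -
  define P where "P = (of_int p :: complex)"
  define a where "a = multiplicity p n1"
  define b where "b = multiplicity p n2"
  have p1: "p > 1" using p by (rule prime_gt_1_int)
  hence P0: "P \<noteq> 0" by (simp add: P_def)
  have "norm Y \<le> norm (of_int p * Y)" using p1 by (simp add: norm_mult mult_le_cancel_right1)
  hence Y: "norm Y < 1" using y by simp
  define t where "t = (\<lambda>j (k, l). of_bool (j \<le> l) * (local_ramanujan P b j * Y ^ j * (local_fibre P a k j (l - j) * X ^ k * Y ^ (l - j))))"
  have t: "(t j has_sum (local_ramanujan P b j * Y ^ j * fibre_gen (P * X) (P * Y) Y a j)) UNIV" for j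
  proof -
    have "((\<lambda>(k, m). local_fibre P a k j m * X ^ k * Y ^ m) has_sum fibre_gen (P * X) (P * Y) Y a j) UNIV"
      using x y by (intro has_sum_local_fibre P0 Y refl) (simp_all add: P_def)
    from has_sum_cmult_right[OF this, of "local_ramanujan P b j * Y ^ j"]
    have *: "((\<lambda>(k, m). local_ramanujan P b j * Y ^ j * (local_fibre P a k j m * X ^ k * Y ^ m)) has_sum
        (local_ramanujan P b j * Y ^ j * fibre_gen (P * X) (P * Y) Y a j)) UNIV" by (simp add: split_def)
    have "bij_betw (\<lambda>(k, m). (k, m + j)) UNIV {(k :: nat, l). j \<le> l}"
      by (rule bij_betwI[where g = "\<lambda>(k, l). (k, l - j)"]) auto
    from has_sum_reindex_bij_betw[OF this, of "t j"] *
    have "(t j has_sum (local_ramanujan P b j * Y ^ j * fibre_gen (P * X) (P * Y) Y a j)) {(k, l). j \<le> l}"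
      by (simp add: t_def split_def)
    also have "?this \<longleftrightarrow> ?thesis" by (rule has_sum_cong_neutral) (auto simp: t_def)
    finally show ?thesis .
  qed
  have "loose_sum n1 n2 (p ^ k) (p ^ l) * X ^ k * Y ^ l = (\<Sum>j\<le>Suc b. t j (k, l))" for k l
  proof -
    have "loose_sum n1 n2 (p ^ k) (p ^ l) * X ^ k * Y ^ l
       = (\<Sum>j\<le>l. local_ramanujan P b j * local_fibre P a k j (l - j) * X ^ k * Y ^ l)"
      unfolding loose_sum_prime_powers[OF p n] P_def a_def b_def by (simp add: sum_distrib_right)
    also have "\<dots> = (\<Sum>j\<in>{..Suc b} \<inter> {..l}. local_ramanujan P b j * local_fibre P a k j (l - j) * X ^ k * Y ^ l)"
      by (rule sum.mono_neutral_right) (auto simp: local_ramanujan_def)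
    also have "\<dots> = (\<Sum>j\<le>Suc b. t j (k, l))"
    proof (rule sum.mono_neutral_cong_left)
      fix j assume "j \<in> {..Suc b} \<inter> {..l}"
      hence j: "j \<le> l" by simp
      hence "Y ^ l = Y ^ j * Y ^ (l - j)" by (simp add: power_add[symmetric])
      thus "local_ramanujan P b j * local_fibre P a k j (l - j) * X ^ k * Y ^ l = t j (k, l)"
        using j by (simp add: t_def mult_ac)
    qed (auto simp: t_def)
    finally show ?thesis .
  qed
  hence "(\<lambda>(k, l). loose_sum n1 n2 (p ^ k) (p ^ l) * X ^ k * Y ^ l) = (\<lambda>z. \<Sum>j\<le>Suc b. t j z)"
    by (auto simp: fun_eq_iff)
  moreover have "((\<lambda>z. \<Sum>j\<le>Suc b. t j z) has_sum
     (\<Sum>j\<le>Suc b. local_ramanujan P b j * Y ^ j * fibre_gen (P * X) (P * Y) Y a j)) UNIV"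
    by (intro has_sum_finite_sum t) simp
  ultimately show ?thesis
    using sum_local_ramanujan_fibre_gen[of "P * X" "P * Y" P Y b a] x y P0 Y
    by (simp add: P_def a_def b_def)
qed

section \<open>Euler products\<close>

lemma summable_tail_small:
  fixes g :: "'a \<Rightarrow> real"
  assumes "g summable_on A" "e > 0"
  obtains F where "finite F" "F \<subseteq> A" "infsum g (A - F) < e"
proof -
  obtain F where F: "finite F" "F \<subseteq> A" "dist (sum g F) (infsum g A) \<le> e / 2"
    using infsum_finite_approximation[OF assms(1), of "e / 2"] assms(2) by auto
  have "infsum g (A - F) = infsum g A - sum g F"
    using infsum_Diff[OF assms(1) summable_on_finite[OF F(1)] F(2)] F(1) by simp
  hence "infsum g (A - F) < e" using F(3) assms(2) by (simp add: dist_real_def abs_if split: if_splits)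
  thus ?thesis using that F by blast
qed

text \<open>
  Stated with an auxiliary set \<open>F\<close> so that one small tail bounds the error for all larger \<open>B\<close>.
\<close>

lemma norm_infsum_diff_subset_le:
  fixes f :: "'a \<Rightarrow> complex"
  assumes f: "(\<lambda>x. norm (f x)) summable_on A" and FB: "F \<subseteq> B" "B \<subseteq> A"
  shows "norm (infsum f A - infsum f B) \<le> infsum (\<lambda>x. norm (f x)) (A - F)"
proof -
  have s: "f summable_on A" using f by (rule abs_summable_summable)
  have "infsum f A - infsum f B = infsum f (A - B)"
    using infsum_Diff[OF s summable_on_subset_banach[OF s FB(2)] FB(2)] by simp
  also have "norm \<dots> \<le> infsum (\<lambda>x. norm (f x)) (A - B)"
    by (rule norm_infsum_bound) (rule summable_on_subset_banach[OF f], simp)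
  also have "\<dots> \<le> infsum (\<lambda>x. norm (f x)) (A - F)"
    using FB by (intro infsum_mono_neutral summable_on_subset_banach[OF f]) auto
  finally show ?thesis .
qed

text \<open>
  Dominated convergence for a sequence whose terms are eventually constant at each point.
\<close>

lemma has_sum_dominated_eventually:
  fixes f :: "nat \<Rightarrow> 'a \<Rightarrow> complex" and g :: "'a \<Rightarrow> real"
  assumes g: "g summable_on A" and le: "\<And>N x. x \<in> A \<Longrightarrow> norm (f N x) \<le> g x"
    and ev: "\<And>x. x \<in> A \<Longrightarrow> eventually (\<lambda>N. f N x = h x) sequentially"
    and lim: "(\<lambda>N. infsum (f N) A) \<longlonglongrightarrow> L"
  shows "(h has_sum L) A"
proof -
  have leh: "norm (h x) \<le> g x" if "x \<in> A" for x
  proof -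
    from ev[OF that] obtain N where "f N x = h x" by (auto simp: eventually_sequentially)
    thus ?thesis using le[OF that, of N] by simp
  qed
  have fs: "(\<lambda>x. norm (f N x)) summable_on A" for N
    by (rule summable_on_comparison_test[OF g]) (auto intro: le)
  have hs: "(\<lambda>x. norm (h x)) summable_on A"
    by (rule summable_on_comparison_test[OF g]) (auto intro: leh)
  have "(\<lambda>N. infsum (f N) A) \<longlonglongrightarrow> infsum h A"
  proof (rule tendstoI)
    fix e :: real assume e: "e > 0"
    obtain F where F: "finite F" "F \<subseteq> A" "infsum g (A - F) < e / 2"
      using summable_tail_small[OF g, of "e / 2"] e by auto
    have "eventually (\<lambda>N. \<forall>x\<in>F. f N x = h x) sequentially"
      using F by (intro eventually_ball_finite) (auto intro: ev)
    thus "eventually (\<lambda>N. dist (infsum (f N) A) (infsum h A) < e) sequentially"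
    proof eventually_elim
      case (elim N)
      have d1: "norm (infsum (f N) A - infsum (f N) F) \<le> infsum (\<lambda>x. norm (f N x)) (A - F)"
        by (rule norm_infsum_diff_subset_le[OF fs order_refl F(2)])
      have d2: "norm (infsum h A - infsum h F) \<le> infsum (\<lambda>x. norm (h x)) (A - F)"
        by (rule norm_infsum_diff_subset_le[OF hs order_refl F(2)])
      have e1: "infsum (\<lambda>x. norm (f N x)) (A - F) \<le> infsum g (A - F)"
        by (intro infsum_mono summable_on_subset_banach[OF fs] summable_on_subset_banach[OF g]) (auto intro: le)
      have e2: "infsum (\<lambda>x. norm (h x)) (A - F) \<le> infsum g (A - F)"
        by (intro infsum_mono summable_on_subset_banach[OF hs] summable_on_subset_banach[OF g]) (auto intro: leh)
      have "infsum (f N) F = infsum h F" using elim by (intro infsum_cong) auto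
      hence "infsum (f N) A - infsum h A = (infsum (f N) A - infsum (f N) F) - (infsum h A - infsum h F)" by simp
      hence "norm (infsum (f N) A - infsum h A) \<le> norm (infsum (f N) A - infsum (f N) F) + norm (infsum h A - infsum h F)"
        by (metis norm_triangle_ineq4)
      thus ?case using d1 d2 e1 e2 F(3) by (simp add: dist_norm)
    qed
  qed
  hence "infsum h A = L" using lim LIMSEQ_unique by blast
  thus ?thesis using hs abs_summable_summable has_sum_infsum by metis
qed

definition smooth :: "int set \<Rightarrow> int set" where
  "smooth S = {n. n > 0 \<and> prime_factors n \<subseteq> S}"

lemma smooth_empty [simp]: "smooth {} = {1}"
proof -
  have "n = 1" if "n > 0" "prime_factors n = {}" for n :: int
    using that by (simp add: prime_factorization_empty_iff)
  thus ?thesis by (auto simp: smooth_def)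
qed

lemma coprime_prime_power_smooth:
  assumes "prime p" "p \<notin> S" "m \<in> smooth S"
  shows "coprime (p ^ k) m"
proof -
  have "\<not> p dvd m" using assms by (auto simp: smooth_def prime_factors_dvd)
  thus ?thesis using assms(1) by (simp add: prime_imp_coprime)
qed

lemma bij_betw_smooth_insert:
  fixes p :: int
  assumes p: "prime p" "p \<notin> S"
  shows "bij_betw (\<lambda>(k, m). p ^ k * m) (UNIV \<times> smooth S) (smooth (insert p S))"
proof (rule bij_betwI[where g = "\<lambda>n. (multiplicity p n, n div p ^ multiplicity p n)"])
  have p0: "p > 0" using p by (simp add: prime_gt_0_int)
  show "(\<lambda>(k, m). p ^ k * m) \<in> UNIV \<times> smooth S \<rightarrow> smooth (insert p S)"
  proof (clarify)
    fix k m assume m: "m \<in> smooth S"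
    hence m0: "m \<noteq> 0" by (auto simp: smooth_def)
    have "prime_factors (p ^ k * m) = prime_factors (p ^ k) \<union> prime_factors m"
      using m0 p0 by (intro prime_factors_product) auto
    also have "\<dots> \<subseteq> insert p S" using m p(1)
      by (auto simp: smooth_def prime_factorization_prime_power split: if_splits)
    finally show "p ^ k * m \<in> smooth (insert p S)" using m p0 by (simp add: smooth_def)
  qed
  show "(\<lambda>n. (multiplicity p n, n div p ^ multiplicity p n)) \<in> smooth (insert p S) \<rightarrow> UNIV \<times> smooth S"
  proof
    fix n assume n: "n \<in> smooth (insert p S)"
    hence n0: "n > 0" by (simp add: smooth_def)
    obtain d where d: "n = p ^ multiplicity p n * d" by (meson multiplicity_dvd dvdE)
    have nd: "\<not> p dvd d"
      using multiplicity_decompose[of n p] n0 p not_prime_unit[of p] d p0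
      by (metis less_irrefl mult_cancel_left multiplicity_dvd dvd_mult_div_cancel power_not_zero)
    have d0: "d > 0" using d n0 p0 by (metis zero_less_mult_iff zero_less_power less_asym)
    have "prime_factors d \<subseteq> S"
    proof
      fix q assume q: "q \<in> prime_factors d"
      hence "q dvd n" using d by (metis dvd_mult in_prime_factors_imp_dvd)
      hence "q \<in> prime_factors n" using q n0 by (auto simp: in_prime_factors_iff)
      moreover have "q \<noteq> p" using q nd by (auto simp: in_prime_factors_iff)
      ultimately show "q \<in> S" using n by (auto simp: smooth_def)
    qed
    moreover have "n div p ^ multiplicity p n = d" using d p0
      by (metis nonzero_mult_div_cancel_left power_not_zero less_irrefl)
    ultimately show "(multiplicity p n, n div p ^ multiplicity p n) \<in> UNIV \<times> smooth S"
      using d0 by (simp add: smooth_def)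
  qed
  show "(\<lambda>n. (multiplicity p n, n div p ^ multiplicity p n)) ((\<lambda>(k, m). p ^ k * m) z) = z"
    if "z \<in> UNIV \<times> smooth S" for z
  proof -
    obtain k m where z: "z = (k, m)" by (cases z)
    have m: "m > 0" "\<not> p dvd m" using that z p by (auto simp: smooth_def prime_factors_dvd)
    have "multiplicity p (p ^ k * m) = multiplicity p (p ^ k) + multiplicity p m"
      using p p0 m by (intro prime_elem_multiplicity_mult_distrib) auto
    also have "multiplicity p (p ^ k) = k"
      using p p0 not_prime_unit[of p] by (intro multiplicity_same_power) auto
    also have "multiplicity p m = 0" using m by (simp add: not_dvd_imp_multiplicity_0)
    finally show ?thesis using p0 by (simp add: z)
  qed
  show "(\<lambda>(k, m). p ^ k * m) (multiplicity p n, n div p ^ multiplicity p n) = n" for n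
    by (simp add: multiplicity_dvd)
qed

lemma infsum_Times_product:
  fixes f g :: "_ \<Rightarrow> complex"
  assumes "(\<lambda>(x, y). f x * g y) summable_on (A \<times> B)"
  shows "infsum (\<lambda>(x, y). f x * g y) (A \<times> B) = infsum f A * infsum g B"
  using infsum_Sigma_banach[OF assms]
  by (simp add: infsum_cmult_right' infsum_cmult_left')

text \<open>
  Adjoining a prime \<open>p\<close> multiplies the smooth pairs by \<open>(p ^ k, p ^ l)\<close>; by multiplicativity the sum
  over the enlarged set is a product.
\<close>

lemma euler_product_finite:
  fixes f :: "int \<times> int \<Rightarrow> complex"
  assumes sm: "(\<lambda>z. norm (f z)) summable_on {1..} \<times> {1..}"
    and one: "f (1, 1) = 1"
    and mult: "\<And>v w v' w'. v > 0 \<Longrightarrow> w > 0 \<Longrightarrow> v' > 0 \<Longrightarrow> w' > 0 \<Longrightarrow> coprime (v * w) (v' * w') \<Longrightarrow>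
       f (v * v', w * w') = f (v, w) * f (v', w')"
    and S: "finite S" "\<And>p. p \<in> S \<Longrightarrow> prime p"
  shows "infsum f (smooth S \<times> smooth S) = (\<Prod>p\<in>S. infsum (\<lambda>(k, l). f (p ^ k, p ^ l)) UNIV)"
  using S
proof (induction S rule: finite_induct)
  case empty
  show ?case using one by simp
next
  case (insert p S)
  have p: "prime p" "p \<notin> S" using insert by auto
  have p0: "p > 0" using p by (simp add: prime_gt_0_int)
  define G where "G = (\<lambda>((k, l), (m, n)). (p ^ k * m, p ^ l * n))"
  have b: "bij_betw G (UNIV \<times> (smooth S \<times> smooth S)) (smooth (insert p S) \<times> smooth (insert p S))"
  proof -
    have 1: "bij_betw (\<lambda>((k, l), (m, n)). ((k, m), (l, n))) (UNIV \<times> (smooth S \<times> smooth S)) ((UNIV \<times> smooth S) \<times> (UNIV \<times> smooth S))"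
      by (rule bij_betwI[where g = "\<lambda>((k, m), (l, n)). ((k, l), (m, n))"]) auto
    from bij_betw_trans[OF 1 bij_betw_map_prod[OF bij_betw_smooth_insert[OF p] bij_betw_smooth_insert[OF p]]]
    have "bij_betw (map_prod (\<lambda>(k, m). p ^ k * m) (\<lambda>(k, m). p ^ k * m) \<circ> (\<lambda>((k, l), (m, n)). ((k, m), (l, n))))
       (UNIV \<times> (smooth S \<times> smooth S)) (smooth (insert p S) \<times> smooth (insert p S))" .
    also have "map_prod (\<lambda>(k, m). p ^ k * m) (\<lambda>(k, m). p ^ k * m) \<circ> (\<lambda>((k, l), (m, n)). ((k, m), (l, n))) = G"
      by (auto simp: G_def fun_eq_iff)
    finally show ?thesis .
  qed
  have sub: "smooth S' \<subseteq> {1..}" for S' by (auto simp: smooth_def)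
  have "(\<lambda>z. norm (f z)) summable_on (smooth (insert p S) \<times> smooth (insert p S))"
    by (rule summable_on_subset_banach[OF sm]) (use sub in auto)
  hence "f summable_on (smooth (insert p S) \<times> smooth (insert p S))" by (rule abs_summable_summable)
  hence "(\<lambda>z. f (G z)) summable_on (UNIV \<times> (smooth S \<times> smooth S))"
    using summable_on_reindex_bij_betw[OF b, of f] by simp
  moreover have G: "f (G z) = (case z of (x, y) \<Rightarrow> (case x of (k, l) \<Rightarrow> f (p ^ k, p ^ l)) * f y)"
    if "z \<in> UNIV \<times> (smooth S \<times> smooth S)" for z
  proof -
    obtain k l m n where z: "z = ((k, l), (m, n))" by (metis prod.exhaust)
    have mn: "m \<in> smooth S" "n \<in> smooth S" using that z by auto
    have "coprime (p ^ k * p ^ l) (m * n)"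
      using coprime_prime_power_smooth[OF p mn(1)] coprime_prime_power_smooth[OF p mn(2)]
      by (simp only: power_add[symmetric] coprime_mult_right_iff)
    thus ?thesis using mult[of "p ^ k" "p ^ l" m n] mn p0 by (simp add: z G_def smooth_def)
  qed
  ultimately have sm': "(\<lambda>(x, y). (case x of (k, l) \<Rightarrow> f (p ^ k, p ^ l)) * f y) summable_on (UNIV \<times> (smooth S \<times> smooth S))"
    by (subst (asm) summable_on_cong[OF G]) auto
  have "infsum f (smooth (insert p S) \<times> smooth (insert p S)) = infsum (\<lambda>z. f (G z)) (UNIV \<times> (smooth S \<times> smooth S))"
    by (rule infsum_reindex_bij_betw[OF b, symmetric])
  also have "\<dots> = infsum (\<lambda>(x, y). (case x of (k, l) \<Rightarrow> f (p ^ k, p ^ l)) * f y) (UNIV \<times> (smooth S \<times> smooth S))"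
    by (rule infsum_cong) (rule G)
  also have "\<dots> = infsum (\<lambda>(k, l). f (p ^ k, p ^ l)) UNIV * infsum f (smooth S \<times> smooth S)"
    by (rule infsum_Times_product[OF sm'])
  finally show ?case using insert by simp
qed

text \<open>
  Multiplicativity refers to the product \<open>v w\<close> of both arguments: a prime may divide \<open>v\<close> and \<open>w\<close>
  simultaneously, and its factor is the double series over \<open>(p ^ k, p ^ l)\<close>. The finite products
  are the sums over smooth pairs, and these exhaust all pairs.
\<close>

theorem euler_product_tendsto:
  fixes f :: "int \<times> int \<Rightarrow> complex"
  assumes sm: "(\<lambda>z. norm (f z)) summable_on {1..} \<times> {1..}"
    and one: "f (1, 1) = 1"
    and mult: "\<And>v w v' w'. v > 0 \<Longrightarrow> w > 0 \<Longrightarrow> v' > 0 \<Longrightarrow> w' > 0 \<Longrightarrow> coprime (v * w) (v' * w') \<Longrightarrow>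
       f (v * v', w * w') = f (v, w) * f (v', w')"
    and loc: "\<And>p. prime p \<Longrightarrow> ((\<lambda>(k, l). f (p ^ k, p ^ l)) has_sum L p) UNIV"
  shows "((\<lambda>S. \<Prod>p\<in>S. L p) \<longlongrightarrow> infsum f ({1..} \<times> {1..})) (finite_subsets_at_top {p. prime p})"
proof (rule tendstoI)
  fix e :: real assume e: "e > 0"
  obtain F where F: "finite F" "F \<subseteq> {1..} \<times> {1..}" "infsum (\<lambda>z. norm (f z)) ({1..} \<times> {1..} - F) < e"
    using summable_tail_small[OF sm e] by blast
  define S0 where "S0 = (\<Union>(m, n)\<in>F. prime_factors m \<union> prime_factors n)"
  have S0: "finite S0" "S0 \<subseteq> {p. prime p}"
    unfolding S0_def using F(1) by (auto simp: in_prime_factors_iff)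
  show "eventually (\<lambda>S. dist (\<Prod>p\<in>S. L p) (infsum f ({1..} \<times> {1..})) < e) (finite_subsets_at_top {p. prime p})"
    unfolding eventually_finite_subsets_at_top
  proof (intro exI[of _ S0] conjI S0 allI impI, elim conjE)
    fix S :: "int set" assume S: "finite S" "S0 \<subseteq> S" "S \<subseteq> {p. prime p}"
    have "(\<Prod>p\<in>S. L p) = (\<Prod>p\<in>S. infsum (\<lambda>(k, l). f (p ^ k, p ^ l)) UNIV)"
      using loc S by (intro prod.cong refl infsumI[symmetric] loc) auto
    also have "\<dots> = infsum f (smooth S \<times> smooth S)"
      by (rule euler_product_finite[OF sm one mult S(1), symmetric]) (use S(3) in auto)
    finally have P: "(\<Prod>p\<in>S. L p) = infsum f (smooth S \<times> smooth S)" .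
    have "F \<subseteq> smooth S \<times> smooth S"
    proof
      fix z assume z: "z \<in> F"
      obtain m n where mn: "z = (m, n)" by (cases z)
      have "prime_factors m \<subseteq> S" "prime_factors n \<subseteq> S" using z S(2) by (auto simp: S0_def mn)
      moreover have "m > 0" "n > 0" using z F(2) by (auto simp: mn)
      ultimately show "z \<in> smooth S \<times> smooth S" by (auto simp: mn smooth_def)
    qed
    moreover have "smooth S \<times> smooth S \<subseteq> {1..} \<times> {1..}" by (auto simp: smooth_def)
    ultimately have "norm (infsum f ({1..} \<times> {1..}) - infsum f (smooth S \<times> smooth S)) < e"
      using norm_infsum_diff_subset_le[OF sm] F(3) by (meson le_less_trans)
    thus "dist (\<Prod>p\<in>S. L p) (infsum f ({1..} \<times> {1..})) < e" unfolding P by (simp add: dist_norm norm_minus_commute)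
  qed
qed

section \<open>Vanishing parameters\<close>

lemma summable_on_Times_nonneg:
  fixes f :: "'a \<Rightarrow> real" and g :: "'b \<Rightarrow> real"
  assumes f: "f summable_on A" "\<And>x. x \<in> A \<Longrightarrow> f x \<ge> 0" and g: "g summable_on B" "\<And>y. y \<in> B \<Longrightarrow> g y \<ge> 0"
  shows "(\<lambda>(x, y). f x * g y) summable_on A \<times> B"
proof -
  have f': "(\<lambda>x. \<bar>f x\<bar>) summable_on A" using f by (subst summable_on_cong[of _ _ f]) auto
  have g': "(\<lambda>x. \<bar>g x\<bar>) summable_on B" using g by (subst summable_on_cong[of _ _ g]) auto
  have "(\<lambda>z. norm (case z of (x, y) \<Rightarrow> f x * g y)) summable_on A \<times> B"
    unfolding Infinite_Sum.abs_summable_on_Sigma_iff unfolding prod.case real_norm_def abs_mult infsum_cmult_right'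
    by (auto intro!: summable_on_cmult_right summable_on_cmult_left f' g' simp: abs_mult)
  thus ?thesis by (rule abs_summable_summable)
qed

lemma norm_local_fibre_le:
  assumes P: "norm P \<ge> 1"
  shows "norm (local_fibre P a k j m) \<le> (2 * real m + 3) * norm P ^ (k + m)"
proof -
  have P0: "P \<noteq> 0" using P by auto
  have count: "norm (\<Sum>i\<le>a. of_bool (Q i) :: complex) \<le> real m + 1" if "\<And>i. Q i \<Longrightarrow> i \<le> m" for Q
  proof -
    have "(\<Sum>i\<le>a. of_bool (Q i) :: complex) = of_nat (card {i \<in> {..a}. Q i})"
      by (simp add: of_bool_def sum.inter_filter[symmetric])
    hence "norm (\<Sum>i\<le>a. of_bool (Q i) :: complex) = real (card {i \<in> {..a}. Q i})" by (simp only: norm_of_nat)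
    also have "card {i \<in> {..a}. Q i} \<le> card {..m}" using that by (intro card_mono) auto
    finally show ?thesis by simp
  qed
  have 1: "norm (if 2 * k < m \<and> k \<le> a then P ^ (3 * k) else 0) \<le> norm P ^ (k + m)"
    using P by (auto simp: norm_power intro!: power_increasing)
  have 2: "norm (P ^ (k + m) * (\<Sum>i\<le>a. of_bool (m \<le> k + i \<and> 2 * i \<le> m \<and> k \<le> a + j + i \<and> m \<le> a + j + i)))
      \<le> norm P ^ (k + m) * (real m + 1)"
    unfolding norm_mult norm_power by (intro mult_left_mono count) auto
  have 3: "norm (P ^ (k + m) / P * (\<Sum>i\<le>a. of_bool (m \<le> k + i \<and> 2 * i + 2 \<le> m \<and> k \<le> a + j + i + 1 \<and> m \<le> a + j + i + 1)))
      \<le> norm P ^ (k + m) * (real m + 1)"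
    unfolding norm_mult norm_power norm_divide
    using P by (intro mult_mono count) (auto simp: divide_le_eq mult_le_cancel_left1)
  have "norm (local_fibre P a k j m) \<le> norm P ^ (k + m) + norm P ^ (k + m) * (real m + 1) + norm P ^ (k + m) * (real m + 1)"
    unfolding local_fibre_def by (intro norm_triangle_le_diff norm_triangle_le add_mono 1 2 3)
  thus ?thesis by (simp add: algebra_simps)
qed

lemma norm_local_ramanujan_le:
  assumes P: "norm P \<ge> 1"
  shows "norm (local_ramanujan P b j) \<le> 2 * norm P ^ j"
proof -
  have "norm (local_ramanujan P b j) \<le> norm P ^ j + norm P ^ j"
    unfolding local_ramanujan_def using P
    by (intro norm_triangle_le_diff add_mono) (auto simp: norm_power intro!: power_increasing)
  thus ?thesis by simp
qed

text \<open>
  A polynomial that dominates the normalised coefficients uniformly in \<open>n1\<close> and \<open>n2\<close>. It is four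
  times the coefficient of the second derivative of the geometric series.
\<close>

definition local_bound :: "nat \<Rightarrow> real" where
  "local_bound l = 4 * ((real l + 1) * (real l + 2))"

lemma norm_loose_sum_prime_powers_le:
  fixes p n1 n2 :: int assumes p: "prime p" and n: "n1 \<noteq> 0" "n2 \<noteq> 0"
  shows "norm (loose_sum n1 n2 (p ^ k) (p ^ l)) \<le> local_bound l * of_int p ^ (k + l)"
proof -
  define P where "P = (of_int p :: complex)"
  have p1: "p > 1" using p by (rule prime_gt_1_int)
  have nP: "norm P = of_int p" using p1 by (simp add: P_def)
  have P: "norm P \<ge> 1" using p1 by (simp add: nP)
  have "norm (loose_sum n1 n2 (p ^ k) (p ^ l)) \<le> (\<Sum>j\<le>l. 2 * (2 * real l + 3) * norm P ^ (k + l))"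
    unfolding loose_sum_prime_powers[OF p n] P_def[symmetric]
  proof (rule norm_sum[THEN order_trans], rule sum_mono)
    fix j assume "j \<in> {..l}"
    hence j: "j \<le> l" by simp
    have "norm (local_ramanujan P (multiplicity p n2) j * local_fibre P (multiplicity p n1) k j (l - j))
      \<le> (2 * norm P ^ j) * ((2 * real (l - j) + 3) * norm P ^ (k + (l - j)))"
      unfolding norm_mult by (intro mult_mono norm_local_ramanujan_le norm_local_fibre_le P) auto
    also have "\<dots> = 2 * (2 * real (l - j) + 3) * norm P ^ (j + (k + (l - j)))" by (simp add: power_add)
    also have "j + (k + (l - j)) = k + l" using j by simp
    also have "2 * (2 * real (l - j) + 3) * norm P ^ (k + l) \<le> 2 * (2 * real l + 3) * norm P ^ (k + l)"
      by (intro mult_right_mono) auto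
    finally show "norm (local_ramanujan P (multiplicity p n2) j * local_fibre P (multiplicity p n1) k j (l - j))
      \<le> 2 * (2 * real l + 3) * norm P ^ (k + l)" .
  qed
  also have "\<dots> = 2 * (real l + 1) * (2 * real l + 3) * of_int p ^ (k + l)" by (simp add: nP algebra_simps)
  also have "\<dots> \<le> local_bound l * of_int p ^ (k + l)"
    using p1 by (intro mult_right_mono) (auto simp: local_bound_def algebra_simps)
  finally show ?thesis .
qed

text \<open>
  For the exponential sums modulo \<open>p ^ k\<close>, the integer \<open>0\<close> is indistinguishable from \<open>p ^ N\<close> as soon
  as \<open>N \<ge> k\<close>.
\<close>

definition nonzero_approx :: "int \<Rightarrow> int \<Rightarrow> nat \<Rightarrow> int" where
  "nonzero_approx p n N = (if n = 0 then p ^ N else n)"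

lemma loose_sum_nonzero_approx:
  assumes "k \<le> N" "l \<le> N"
  shows "loose_sum (nonzero_approx p n1 N) (nonzero_approx p n2 N) (p ^ k) (p ^ l) = loose_sum n1 n2 (p ^ k) (p ^ l)"
proof -
  have c: "char_mod (p ^ e) (nonzero_approx p n N * v) = char_mod (p ^ e) (n * v)" if "e \<le> N" for e n v
  proof (rule char_mod_cong)
    have "p ^ e dvd nonzero_approx p n N - n" using that by (auto simp: nonzero_approx_def le_imp_power_dvd)
    thus "p ^ e dvd nonzero_approx p n N * v - n * v" by (simp add: left_diff_distrib[symmetric])
  qed
  show ?thesis unfolding loose_sum_def c[OF assms(1)] c[OF assms(2)] ..
qed

text \<open>
  The power \<open>z ^ (ord\<^sub>p n + 1)\<close>, with the convention that it vanishes for \<open>n = 0\<close>, as is appropriate for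
  \<open>norm z < 1\<close>.
\<close>

definition tail_power :: "int \<Rightarrow> int \<Rightarrow> complex \<Rightarrow> complex" where
  "tail_power p n z = (if n = 0 then 0 else z ^ Suc (multiplicity p n))"

lemma tail_power_nonzero_approx_tendsto:
  fixes p :: int assumes p: "prime p" and z: "norm z < 1"
  shows "(\<lambda>N. z ^ Suc (multiplicity p (nonzero_approx p n N))) \<longlonglongrightarrow> tail_power p n z"
proof (cases "n = 0")
  case True
  have p0: "p > 0" using p by (rule prime_gt_0_int)
  have m: "multiplicity p (p ^ N) = N" for N
    using p p0 not_prime_unit[of p] by (intro multiplicity_same_power) auto
  have "(\<lambda>N. z ^ N) \<longlonglongrightarrow> 0" using z by (rule LIMSEQ_power_zero)
  hence "(\<lambda>N. z ^ Suc N) \<longlonglongrightarrow> 0" by (rule LIMSEQ_Suc)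
  thus ?thesis using True by (simp add: nonzero_approx_def tail_power_def m)
qed (simp add: nonzero_approx_def tail_power_def)

lemma summable_local_bound:
  fixes y :: real assumes "0 \<le> y" "y < 1"
  shows "summable (\<lambda>l. local_bound l * y ^ l)"
proof -
  have "summable (\<lambda>n. diffs (diffs (\<lambda>_. 1)) n * y ^ n)"
    using assms by (intro termdiff_converges[of _ 1]) (auto intro: termdiff_converges[of _ 1] summable_geometric)
  hence "summable (\<lambda>n. 4 * (diffs (diffs (\<lambda>_. 1)) n * y ^ n))" by (rule summable_mult)
  thus ?thesis by (simp add: diffs_def local_bound_def algebra_simps)
qed

text \<open>
  The case of vanishing \<open>n1\<close> or \<open>n2\<close> is the limit \<open>N \<rightarrow> \<infinity>\<close> of the formula for \<open>p ^ N\<close>: each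
  coefficient is eventually constant, the coefficients are dominated uniformly, and the powers in
  the character tend to zero.
\<close>

theorem has_sum_loose_local_general:
  fixes p n1 n2 :: int and X Y :: complex
  assumes p: "prime p"
    and x: "norm (of_int p * X) < 1" and y: "norm (of_int p * Y) < 1"
  shows "((\<lambda>(k, l). loose_sum n1 n2 (p ^ k) (p ^ l) * X ^ k * Y ^ l) has_sum
     euler_factor (of_int p * X) (of_int p * Y) Y (tail_power p n1) (tail_power p n2)) UNIV"
proof -
  define x' y' where "x' = of_int p * X" and "y' = of_int p * Y"
  have xy: "norm x' < 1" "norm y' < 1" using x y by (simp_all add: x'_def y'_def)
  have p1: "p > 1" using p by (rule prime_gt_1_int)
  define f where "f = (\<lambda>N (k, l). loose_sum (nonzero_approx p n1 N) (nonzero_approx p n2 N) (p ^ k) (p ^ l) * X ^ k * Y ^ l)"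
  define g where "g = (\<lambda>(k, l). norm x' ^ k * (local_bound l * norm y' ^ l))"
  have ap: "nonzero_approx p n N \<noteq> 0" for n N using p1 by (simp add: nonzero_approx_def)
  have le: "norm (f N z) \<le> g z" for N z
  proof -
    obtain k l where z: "z = (k, l)" by (cases z)
    have "norm (f N z) \<le> (local_bound l * of_int p ^ (k + l)) * norm X ^ k * norm Y ^ l"
      unfolding f_def z prod.case norm_mult norm_power
      by (intro mult_right_mono norm_loose_sum_prime_powers_le p ap) auto
    also have "\<dots> = g z" using p1
      by (simp add: g_def z x'_def y'_def norm_mult power_mult_distrib power_add)
    finally show ?thesis .
  qed
  have g: "g summable_on UNIV"
  proof -
    have lb: "local_bound l * norm y' ^ l \<ge> 0" for l by (simp add: local_bound_def)
    have "(\<lambda>k. norm x' ^ k) summable_on UNIV"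
      using xy by (simp add: summable_on_UNIV_nonneg_real_iff summable_geometric)
    moreover have "(\<lambda>l. local_bound l * norm y' ^ l) summable_on UNIV"
      using summable_local_bound[of "norm y'"] xy lb by (simp add: summable_on_UNIV_nonneg_real_iff)
    ultimately have "g summable_on UNIV \<times> UNIV"
      unfolding g_def by (intro summable_on_Times_nonneg lb) auto
    thus ?thesis by simp
  qed
  have "((\<lambda>(k, l). loose_sum n1 n2 (p ^ k) (p ^ l) * X ^ k * Y ^ l) has_sum
     euler_factor x' y' Y (tail_power p n1) (tail_power p n2)) UNIV"
  proof (rule has_sum_dominated_eventually[where f = f, OF g le])
    fix z :: "nat \<times> nat"
    obtain k l where z: "z = (k, l)" by (cases z)
    have "eventually (\<lambda>N. N \<ge> max k l) sequentially" by (rule eventually_ge_at_top)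
    thus "eventually (\<lambda>N. f N z = (case z of (k, l) \<Rightarrow> loose_sum n1 n2 (p ^ k) (p ^ l) * X ^ k * Y ^ l)) sequentially"
      by eventually_elim (simp add: z f_def loose_sum_nonzero_approx)
  next
    have "infsum (f N) UNIV = euler_factor x' y' Y (\<lambda>z. z ^ Suc (multiplicity p (nonzero_approx p n1 N)))
        (\<lambda>z. z ^ Suc (multiplicity p (nonzero_approx p n2 N)))" for N
      unfolding f_def x'_def y'_def by (intro infsumI has_sum_loose_local p ap x y)
    moreover have "(\<lambda>N. euler_factor x' y' Y (\<lambda>z. z ^ Suc (multiplicity p (nonzero_approx p n1 N)))
        (\<lambda>z. z ^ Suc (multiplicity p (nonzero_approx p n2 N)))) \<longlonglongrightarrow> euler_factor x' y' Y (tail_power p n1) (tail_power p n2)"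
      unfolding euler_factor_def schur_factor_def weyl_denominator_def using not_one[OF xy]
      by (intro tendsto_intros tail_power_nonzero_approx_tendsto p xy small_products[OF xy]) auto
    ultimately show "(\<lambda>N. infsum (f N) UNIV) \<longlonglongrightarrow> euler_factor x' y' Y (tail_power p n1) (tail_power p n2)" by simp
  qed
  thus ?thesis by (simp add: x'_def y'_def)
qed

section \<open>The zeta function and divisor sums\<close>

lemma bij_betw_Suc_int: "bij_betw (\<lambda>n. int (Suc n)) UNIV {1..}"
  by (rule bij_betwI[where g = "\<lambda>v. nat v - 1"]) auto

lemma summable_int_powr:
  fixes \<sigma> :: real assumes "\<sigma> > 1"
  shows "(\<lambda>v::int. of_int v powr (- \<sigma>)) summable_on {1..}"
proof -
  have "summable (\<lambda>n. of_nat n powr (- \<sigma>) :: real)" using assms by (simp add: summable_real_powr_iff)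
  hence "summable (\<lambda>n. of_nat (Suc n) powr (- \<sigma>) :: real)" by (subst summable_Suc_iff)
  hence "(\<lambda>n. of_int (int (Suc n)) powr (- \<sigma>) :: real) summable_on UNIV"
    by (simp add: summable_on_UNIV_nonneg_real_iff)
  thus ?thesis using summable_on_reindex_bij_betw[OF bij_betw_Suc_int, of "\<lambda>v. of_int v powr (- \<sigma>) :: real"] by simp
qed

lemma norm_int_powr: "v > 0 \<Longrightarrow> norm (of_int v powr s :: complex) = of_int v powr Re s"
  by (subst norm_powr_real_powr) auto

lemma int_powr_mult: "v > 0 \<Longrightarrow> w > 0 \<Longrightarrow> (of_int (v * w) :: complex) powr s = of_int v powr s * of_int w powr s"
  by (simp add: powr_times_real)

lemma int_power_powr:
  assumes "p > 0" shows "(of_int (p ^ k) :: complex) powr s = (of_int p powr s) ^ k"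
proof (induction k)
  case (Suc k)
  thus ?case using int_powr_mult[of p "p ^ k" s] assms by simp
qed simp

lemma has_sum_riemann_zeta:
  assumes "Re s > 1"
  shows "((\<lambda>v::int. of_int v powr (- s)) has_sum riemann_zeta s) {1..}"
proof -
  have "(\<lambda>v::int. norm (of_int v powr (- s) :: complex)) summable_on {1..}"
    using summable_int_powr[OF assms] by (subst summable_on_cong[of _ _ "\<lambda>v. of_int v powr (- Re s)"]) (auto simp: norm_int_powr)
  hence sm: "(\<lambda>v::int. of_int v powr (- s) :: complex) summable_on {1..}" by (rule abs_summable_summable)
  define T where "T = infsum (\<lambda>v::int. of_int v powr (- s) :: complex) {1..}"
  have T: "((\<lambda>v::int. of_int v powr (- s)) has_sum T) {1..}" unfolding T_def using sm by simp
  have "((\<lambda>n. of_int (int (Suc n)) powr (- s)) has_sum T) UNIV"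
    using has_sum_reindex_bij_betw[OF bij_betw_Suc_int, of "\<lambda>v. of_int v powr (- s)" T] T by simp
  hence "(\<lambda>n. of_int (int (Suc n)) powr (- s)) sums T" by (rule has_sum_imp_sums)
  hence "(\<lambda>n. 1 / of_nat (Suc n) powr s) sums T" by (simp add: powr_minus_divide)
  hence "zeta_series s = T" unfolding zeta_series_def by (rule sums_unique[symmetric])
  thus ?thesis using T assms by (simp add: riemann_zeta_def)
qed

text \<open>
  The two-variable product applied to a function supported on pairs \<open>(v, 1)\<close>.
\<close>

lemma euler_product_one_variable:
  fixes f :: "int \<Rightarrow> complex"
  assumes sm: "(\<lambda>v. norm (f v)) summable_on {1..}" and one: "f 1 = 1"
    and mult: "\<And>v w. v > 0 \<Longrightarrow> w > 0 \<Longrightarrow> coprime v w \<Longrightarrow> f (v * w) = f v * f w"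
    and loc: "\<And>p. prime p \<Longrightarrow> ((\<lambda>k. f (p ^ k)) has_sum L p) UNIV"
  shows "((\<lambda>S. \<Prod>p\<in>S. L p) \<longlongrightarrow> infsum f {1..}) (finite_subsets_at_top {p. prime p})"
proof -
  define g where "g = (\<lambda>(v :: int, w :: int). if w = 1 then f v else 0)"
  have b: "bij_betw (\<lambda>v. (v, 1::int)) A (A \<times> {1})" for A :: "'a set" by (auto simp: bij_betw_def inj_on_def)
  have "((\<lambda>S. \<Prod>p\<in>S. L p) \<longlongrightarrow> infsum g ({1..} \<times> {1..})) (finite_subsets_at_top {p. prime p})"
  proof (rule euler_product_tendsto)
    have "(\<lambda>z. norm (g z)) summable_on {1..} \<times> {1}"
      using summable_on_reindex_bij_betw[OF b, of "\<lambda>z. norm (g z)" "{1..}"] sm by (simp add: g_def)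
    also have "?this \<longleftrightarrow> (\<lambda>z. norm (g z)) summable_on {1..} \<times> {1..}"
      by (rule summable_on_cong_neutral) (auto simp: g_def split: if_splits)
    finally show "(\<lambda>z. norm (g z)) summable_on {1..} \<times> {1..}" .
  next
    fix v w v' w' :: int assume *: "v > 0" "w > 0" "v' > 0" "w' > 0" "coprime (v * w) (v' * w')"
    hence "coprime v v'" by simp
    moreover have "w * w' = 1 \<longleftrightarrow> w = 1 \<and> w' = 1" using *(2,4) by (auto simp: zmult_eq_1_iff)
    ultimately show "g (v * v', w * w') = g (v, w) * g (v', w')" using * by (simp add: g_def mult)
  next
    fix p :: int assume p: "prime p"
    hence p1: "p > 1" by (rule prime_gt_1_int)
    have pb: "p ^ b = 1 \<longleftrightarrow> b = 0" for b
      using p1 by (metis one_less_power less_irrefl neq0_conv power_0)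
    have b': "bij_betw (\<lambda>k. (k, 0::nat)) (UNIV :: nat set) (UNIV \<times> {0})" by (auto simp: bij_betw_def inj_on_def)
    have "((\<lambda>(k, l). g (p ^ k, p ^ l)) has_sum L p) (UNIV \<times> {0})"
      using has_sum_reindex_bij_betw[OF b', of "\<lambda>(k, l). g (p ^ k, p ^ l)"] loc[OF p] by (simp add: g_def)
    also have "?this \<longleftrightarrow> ((\<lambda>(k, l). g (p ^ k, p ^ l)) has_sum L p) UNIV"
      using p1 by (intro has_sum_cong_neutral) (auto simp: g_def pb split: if_splits)
    finally show "((\<lambda>(k, l). g (p ^ k, p ^ l)) has_sum L p) UNIV" .
  qed (simp add: g_def one)
  also have "infsum g ({1..} \<times> {1..}) = infsum g ({1..} \<times> {1})"
    by (rule infsum_cong_neutral) (auto simp: g_def split: if_splits)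
  also have "\<dots> = infsum f {1..}"
    using infsum_reindex_bij_betw[OF b, of g "{1..}"] by (simp add: g_def)
  finally show ?thesis .
qed

lemma norm_prime_powr_less_1:
  fixes p :: int assumes "prime p" "Re s > 0"
  shows "norm (of_int p powr (- s) :: complex) < 1"
proof -
  have p: "p > 1" using assms by (simp add: prime_gt_1_int)
  have "(of_int p :: real) powr (- Re s) < 1" using p assms by (simp add: powr_less_one)
  thus ?thesis using p by (simp add: norm_int_powr)
qed

theorem riemann_zeta_euler_product:
  assumes s: "Re s > 1"
  shows "((\<lambda>S. \<Prod>p\<in>S. 1 / (1 - of_int p powr (- s))) \<longlongrightarrow> riemann_zeta s) (finite_subsets_at_top {p. prime p})"
proof -
  have "((\<lambda>S. \<Prod>p\<in>S. 1 / (1 - of_int p powr (- s))) \<longlongrightarrow> infsum (\<lambda>v::int. of_int v powr (- s)) {1..}) (finite_subsets_at_top {p. prime p})"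
  proof (rule euler_product_one_variable)
    show "(\<lambda>v::int. norm (of_int v powr (- s) :: complex)) summable_on {1..}"
      using summable_int_powr[OF s] by (subst summable_on_cong[of _ _ "\<lambda>v. of_int v powr (- Re s)"]) (auto simp: norm_int_powr)
  next
    fix p :: int assume p: "prime p"
    have "norm (of_int p powr (- s) :: complex) < 1" using p s by (intro norm_prime_powr_less_1) auto
    from has_sum_geometric_from[OF this, of 0]
    show "((\<lambda>k. of_int (p ^ k) powr (- s)) has_sum 1 / (1 - of_int p powr (- s))) UNIV"
      using p by (simp only: int_power_powr[OF prime_gt_0_int]) simp
  qed (simp_all only: int_powr_mult of_int_1 powr_one_eq_one)
  thus ?thesis using has_sum_riemann_zeta[OF s] by (simp add: infsumI)
qed

text \<open>
  Each Euler factor satisfies \<open>\<bar>1 / (1 - z)\<bar> \<ge> exp (- \<bar>z\<bar>)\<close>, so the partial products stay above a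
  positive constant.
\<close>

lemma riemann_zeta_nonzero:
  assumes s: "Re s > 1" shows "riemann_zeta s \<noteq> 0"
proof -
  define C where "C = infsum (\<lambda>v::int. of_int v powr (- Re s) :: real) {1..}"
  have sm: "(\<lambda>v::int. of_int v powr (- Re s) :: real) summable_on {1..}" by (rule summable_int_powr[OF s])
  have lb: "exp (- C) \<le> norm (\<Prod>p\<in>S. 1 / (1 - of_int p powr (- s)))" if S: "finite S" "S \<subseteq> {p. prime p}" for S
  proof -
    have pos: "p \<ge> 1" if "p \<in> S" for p using S that prime_gt_0_int[of p] by auto
    have "(\<Sum>p\<in>S. of_int p powr (- Re s)) \<le> C"
      unfolding C_def using S pos by (intro finite_sum_le_infsum sm) auto
    hence "exp (- C) \<le> exp (\<Sum>p\<in>S. - (of_int p powr (- Re s)))" by (simp add: sum_negf)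
    also have "\<dots> = (\<Prod>p\<in>S. exp (- (of_int p powr (- Re s))))" using S by (simp add: exp_sum)
    also have "\<dots> \<le> (\<Prod>p\<in>S. norm (1 / (1 - of_int p powr (- s) :: complex)))"
    proof (intro prod_mono conjI)
      fix p assume pS: "p \<in> S"
      define z where "z = (of_int p powr (- s) :: complex)"
      have nz: "norm z = of_int p powr (- Re s)" using pos[OF pS] by (simp add: z_def norm_int_powr)
      have "norm z < 1" unfolding z_def using pS S s by (intro norm_prime_powr_less_1) auto
      hence "z \<noteq> 1" by auto
      hence z0: "norm (1 - z) > 0" by simp
      have "norm (1 - z) \<le> 1 + norm z" by (metis norm_one norm_triangle_ineq4)
      also have "\<dots> \<le> exp (norm z)" by simp
      finally have "inverse (exp (norm z)) \<le> inverse (norm (1 - z))" using z0 by (intro le_imp_inverse_le)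
      thus "exp (- (of_int p powr (- Re s))) \<le> norm (1 / (1 - of_int p powr (- s) :: complex))"
        by (simp add: nz z_def[symmetric] exp_minus norm_divide inverse_eq_divide)
    qed auto
    also have "\<dots> = norm (\<Prod>p\<in>S. 1 / (1 - of_int p powr (- s) :: complex))" by (rule prod_norm)
    finally show ?thesis .
  qed
  have "exp (- C) \<le> norm (riemann_zeta s)"
  proof (rule tendsto_lowerbound[OF tendsto_norm[OF riemann_zeta_euler_product[OF s]]])
    show "eventually (\<lambda>S. exp (- C) \<le> norm (\<Prod>p\<in>S. 1 / (1 - of_int p powr (- s)))) (finite_subsets_at_top {p. prime p})"
      using lb by (auto intro!: eventually_finite_subsets_at_top_weakI)
  qed simp
  thus ?thesis by (metis exp_gt_zero norm_zero not_le)
qed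

text \<open>
  The divisor sum is the sum over all positive integers of a multiplicative function with finite
  support.
\<close>

theorem sigma1_euler_product:
  assumes n: "n \<noteq> 0" and \<nu>: "Re \<nu> < 0"
  shows "((\<lambda>S. \<Prod>p\<in>S. (1 - (of_int p powr \<nu>) ^ Suc (multiplicity p n)) / (1 - of_int p powr \<nu>)) \<longlongrightarrow> sigma1 \<nu> n)
     (finite_subsets_at_top {p. prime p})"
proof -
  define f where "f = (\<lambda>d::int. if d dvd n then of_int d powr \<nu> else (0::complex))"
  have fin: "finite {d. d > 0 \<and> d dvd n}"
    using divisors_int_finite[of "\<bar>n\<bar>"] n by simp
  have "((\<lambda>S. \<Prod>p\<in>S. (1 - (of_int p powr \<nu>) ^ Suc (multiplicity p n)) / (1 - of_int p powr \<nu>)) \<longlongrightarrow> infsum f {1..})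
     (finite_subsets_at_top {p. prime p})"
  proof (rule euler_product_one_variable)
    show "(\<lambda>v. norm (f v)) summable_on {1..}"
      by (rule finite_nonzero_values_imp_summable_on, rule finite_subset[OF _ fin]) (auto simp: f_def)
    show "f 1 = 1" by (simp add: f_def)
  next
    fix v w :: int assume vw: "v > 0" "w > 0" "coprime v w"
    have "v * w dvd n \<longleftrightarrow> v dvd n \<and> w dvd n"
      using vw(3) by (auto intro: divides_mult dest: dvd_mult_left dvd_mult_right)
    thus "f (v * w) = f v * f w" using int_powr_mult[OF vw(1,2), of \<nu>] by (simp add: f_def)
  next
    fix p :: int assume p: "prime p"
    have p0: "p > 0" using p by (rule prime_gt_0_int)
    have "norm (of_int p powr - (- \<nu>) :: complex) < 1" using p \<nu> by (intro norm_prime_powr_less_1) auto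
    hence ne: "of_int p powr \<nu> \<noteq> (1 :: complex)" by auto
    have f: "f (p ^ k) = (if k \<le> multiplicity p n then (of_int p powr \<nu>) ^ k else 0)" for k
      using int_power_powr[OF p0, of k \<nu>] prime_power_dvd_iff_le[OF p n, of k] by (simp add: f_def)
    have "((\<lambda>k. f (p ^ k)) has_sum (\<Sum>k\<le>multiplicity p n. (of_int p powr \<nu>) ^ k)) UNIV"
      by (rule has_sum_finite_neutralI[of "{..multiplicity p n}"]) (auto simp: f)
    thus "((\<lambda>k. f (p ^ k)) has_sum (1 - (of_int p powr \<nu>) ^ Suc (multiplicity p n)) / (1 - of_int p powr \<nu>)) UNIV"
      by (simp only: geometric_sum_atMost[OF ne])
  qed
  also have "infsum f {1..} = sigma1 \<nu> n"
  proof -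
    have "infsum f {1..} = infsum f {d. d > 0 \<and> d dvd n}"
      by (rule infsum_cong_neutral) (auto simp: f_def)
    also have "\<dots> = sigma1 \<nu> n" using fin by (auto simp: sigma1_def f_def intro!: sum.cong)
    finally show ?thesis .
  qed
  finally show ?thesis .
qed

section \<open>The symplectic Schur function\<close>

text \<open>
  Multiplication by \<open>x1 ^ k * x2 ^ l\<close> clears the negative powers; in the off-diagonal term it
  leaves the factor \<open>(x1 / x2) ^ (k - l)\<close>.
\<close>

lemma sp_det_normalised:
  assumes "x1 = y * x2" "x1 \<noteq> 0" "x2 \<noteq> 0" "l \<le> k"
  shows "x1 ^ k * x2 ^ l * sp_det k l (x1, x2)
    = (1 - (x1\<^sup>2) ^ k) * (1 - (x2\<^sup>2) ^ l) - y ^ (k - l) * (1 - (x2\<^sup>2) ^ k) * (1 - (x1\<^sup>2) ^ l)"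
proof -
  have e: "x ^ m * sp_entry m x = (x\<^sup>2) ^ m - 1" if "x \<noteq> 0" for m and x :: complex
    using that by (simp add: sp_entry_def right_diff_distrib power2_eq_square power_mult_distrib)
  have "x1 ^ k = x1 ^ l * (y ^ (k - l) * x2 ^ (k - l))"
    using assms(1,4) by (simp add: power_add[symmetric] flip: power_mult_distrib)
  moreover have "x2 ^ k = x2 ^ (k - l) * x2 ^ l" using assms(4) by (simp add: power_add[symmetric])
  ultimately have c: "x1 ^ k * x2 ^ l = y ^ (k - l) * (x1 ^ l * x2 ^ k)" by (simp add: mult_ac)
  have "x1 ^ k * x2 ^ l * sp_det k l (x1, x2)
     = (x1 ^ k * sp_entry k x1) * (x2 ^ l * sp_entry l x2)
       - y ^ (k - l) * (x2 ^ k * sp_entry k x2) * (x1 ^ l * sp_entry l x1)"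
    using c by (simp add: sp_det_def right_diff_distrib mult_ac)
  thus ?thesis unfolding e[OF assms(2)] e[OF assms(3)] by (simp add: algebra_simps)
qed

lemma schur_factor_numerator_0:
  "(1 - x * y\<^sup>2 * (x * y\<^sup>2)) * (1 - x) - y * (1 - x * x) * (1 - x * y\<^sup>2) = weyl_denominator x y"
  by (simp add: weyl_denominator_def power2_eq_square algebra_simps)

lemma complex_powr_of_nat_mult: "(z :: complex) \<noteq> 0 \<Longrightarrow> z powr (of_nat n * s) = (z powr s) ^ n"
  by (simp add: powr_def exp_of_nat_mult[symmetric] mult_ac)

text \<open>
  The square of \<open>p powr \<mu>2\<close> and the quotient of the two arguments of the Schur function are the
  simple roots \<open>x\<close> and \<open>y\<close>. As the Weyl denominator does not vanish, the Schur function is the quotient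
  of the two determinants.
\<close>

lemma sigma2_local_eq:
  fixes p :: int
  assumes p: "prime p" and x: "x = (of_int p powr \<mu>2)\<^sup>2" and y: "of_int p powr \<mu>1 = y * of_int p powr \<mu>2"
    and nz: "weyl_denominator x y \<noteq> 0"
  shows "sigma2_local \<mu>1 \<mu>2 p a b = schur_factor x y (\<lambda>z. z ^ Suc a) (\<lambda>z. z ^ Suc b)"
proof -
  define x1 x2 where "x1 = (of_int p powr \<mu>1 :: complex)" and "x2 = (of_int p powr \<mu>2 :: complex)"
  have p0: "(of_int p :: complex) \<noteq> 0" using prime_gt_0_int[OF p] by simp
  have nz1: "x1 \<noteq> 0" "x2 \<noteq> 0" using p0 by (simp_all add: x1_def x2_def)
  have 1: "x1 = y * x2" using y by (simp add: x1_def x2_def)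
  have 2: "x2\<^sup>2 = x" "x1\<^sup>2 = x * y\<^sup>2" using x 1 by (simp_all add: x2_def power_mult_distrib)
  have num: "x1 ^ (a + b + 2) * x2 ^ (a + 1) * sp_det (a + b + 2) (a + 1) (x1, x2)
      = (1 - (x * y\<^sup>2) ^ Suc a * (x * y\<^sup>2) ^ Suc b) * (1 - x ^ Suc a)
        - y ^ Suc b * (1 - x ^ Suc a * x ^ Suc b) * (1 - (x * y\<^sup>2) ^ Suc a)" for a b
    using sp_det_normalised[OF 1 nz1, of "a + 1" "a + b + 2"]
    unfolding 2 by (simp add: power_add[symmetric] mult_ac)
  have den: "x1 ^ 2 * x2 * sp_det 2 1 (x1, x2) = weyl_denominator x y"
    using num[of 0 0] by (simp only: add_0 power_one_right One_nat_def[symmetric] schur_factor_numerator_0)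
  hence sd: "sp_det 2 1 (x1, x2) \<noteq> 0" using nz by auto
  have "sigma2_local \<mu>1 \<mu>2 p a b = x1 ^ (a + b) * x2 ^ a * (sp_det (a + b + 2) (a + 1) (x1, x2) / sp_det 2 1 (x1, x2))"
    using sd p0 unfolding sigma2_local_def Sp_def x1_def[symmetric] x2_def[symmetric]
    by (simp add: powr_add complex_powr_of_nat_mult x1_def x2_def del: of_nat_add)
  also have "\<dots> = (x1 ^ (a + b + 2) * x2 ^ (a + 1) * sp_det (a + b + 2) (a + 1) (x1, x2)) / (x1 ^ 2 * x2 * sp_det 2 1 (x1, x2))"
    using nz1 sd by (simp add: power_add power2_eq_square)
  finally show ?thesis unfolding num den schur_factor_def .
qed

section \<open>The double Dirichlet series and its region of convergence\<close>

text \<open>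
  The series \<open>\<zeta>(s) \<zeta>(t) R\<close> is a sum over \<open>((d, c), (m, n))\<close>. Grouping the terms by
  \<open>(v, w) = (d m, c n)\<close> gives the sums without coprimality conditions as coefficients.
\<close>

lemma loose_series:
  assumes R: "(s, t) \<in> R_abs_conv n1 n2" and re: "Re s > 1" "Re t > 1"
  defines "f \<equiv> \<lambda>(v, w). loose_sum n1 n2 v w * of_int v powr (- s) * of_int w powr (- t)"
  shows "(\<lambda>z. norm (f z)) summable_on {1..} \<times> {1..}"
    and "infsum f ({1..} \<times> {1..}) = riemann_zeta s * riemann_zeta t * Rseries s t n1 n2"
proof -
  define Q where "Q = ({1..} \<times> {1..} :: (int \<times> int) set)"
  define h where "h = (\<lambda>(d :: int, c :: int). of_int d powr (- s) * of_int c powr (- t) :: complex)"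
  define r where "r = R_term s t n1 n2"
  define F where "F = (\<lambda>(x, y). h x * r y)"
  have smp: "(\<lambda>d::int. norm (of_int d powr (- \<nu>) :: complex)) summable_on {1..}" if "Re \<nu> > 1" for \<nu>
    using summable_int_powr[OF that] by (subst summable_on_cong[of _ _ "\<lambda>v. of_int v powr (- Re \<nu>)"]) (auto simp: norm_int_powr)
  have h: "(\<lambda>x. norm (h x)) summable_on Q"
  proof -
    have "(\<lambda>(d::int, c::int). norm (of_int d powr (- s) :: complex) * norm (of_int c powr (- t) :: complex)) summable_on Q"
      unfolding Q_def by (intro summable_on_Times_nonneg smp re) auto
    thus ?thesis by (simp add: h_def split_def norm_mult)
  qed
  have r: "(\<lambda>x. norm (r x)) summable_on Q" using R by (simp add: R_abs_conv_def r_def Q_def)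
  have F: "(\<lambda>z. norm (F z)) summable_on Q \<times> Q"
  proof -
    have "(\<lambda>(x, y). norm (h x) * norm (r y)) summable_on Q \<times> Q" by (intro summable_on_Times_nonneg h r) auto
    thus ?thesis by (simp add: F_def split_def norm_mult)
  qed
  have infF: "infsum F (Q \<times> Q) = riemann_zeta s * riemann_zeta t * Rseries s t n1 n2"
  proof -
    have "infsum F (Q \<times> Q) = infsum h Q * infsum r Q"
      unfolding F_def using abs_summable_summable[OF F] by (intro infsum_Times_product) (simp add: F_def)
    also have "infsum h Q = infsum (\<lambda>d::int. of_int d powr (- s)) {1..} * infsum (\<lambda>d::int. of_int d powr (- t)) {1..}"
      unfolding h_def Q_def using abs_summable_summable[OF h] by (intro infsum_Times_product) (simp add: h_def Q_def)
    finally show ?thesis using has_sum_riemann_zeta[OF re(1)] has_sum_riemann_zeta[OF re(2)]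
      by (simp add: infsumI Rseries_def r_def Q_def)
  qed
  define B where "B = (\<lambda>(v, w). {d :: int. d > 0 \<and> d dvd v} \<times> {c :: int. c > 0 \<and> c dvd w})"
  define g where "g = (\<lambda>((v, w), (d, c)). ((d, c), (v div d, w div c)) :: (int \<times> int) \<times> (int \<times> int))"
  have bij: "bij_betw g (Sigma Q B) (Q \<times> Q)"
  proof (rule bij_betwI[where g = "\<lambda>((d, c), (m, n)). ((d * m, c * n), (d, c))"])
    have pos: "v div d \<ge> 1" if "v \<ge> 1" "d > 0" "d dvd v" for v d :: int
    proof -
      from that(3) obtain k where k: "v = d * k" by (meson dvdE)
      hence "k > 0" using that by (simp add: int_one_le_iff_zero_less zero_less_mult_iff)
      thus ?thesis using that(2) by (simp add: k)
    qed
    show "g \<in> Sigma Q B \<rightarrow> Q \<times> Q" by (auto simp: g_def Q_def B_def intro: pos)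
    show "(\<lambda>((d, c), (m, n)). ((d * m, c * n), (d, c))) \<in> Q \<times> Q \<rightarrow> Sigma Q B"
      by (auto simp: Q_def B_def int_one_le_iff_zero_less)
    show "(\<lambda>((d, c), (m, n)). ((d * m, c * n), (d, c))) (g z) = z" if "z \<in> Sigma Q B" for z
      using that by (auto simp: g_def B_def)
    show "g ((\<lambda>((d, c), (m, n)). ((d * m, c * n), (d, c))) z) = z" if "z \<in> Q \<times> Q" for z
      using that by (auto simp: g_def Q_def)
  qed
  have Fg: "F (g ((v, w), (d, c))) = flag_sum n1 n2 (v div d) (w div c) * of_int v powr (- s) * of_int w powr (- t)"
    if "(v, w) \<in> Q" "(d, c) \<in> B (v, w)" for v w d c
  proof -
    from that(2) obtain m where m: "v = d * m" by (auto simp: B_def)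
    from that(2) obtain n where n: "w = c * n" by (auto simp: B_def)
    have pos: "d > 0" "c > 0" "m > 0" "n > 0" using that m n by (auto simp: B_def Q_def int_one_le_iff_zero_less zero_less_mult_iff)
    have "v div d = m" "w div c = n" using pos by (simp_all add: m n)
    thus ?thesis using int_powr_mult[OF pos(1,3), of "- s"] int_powr_mult[OF pos(2,4), of "- t"]
      by (simp add: F_def g_def h_def r_def R_term_eq m n)
  qed
  have finB: "finite (B z)" if "z \<in> Q" for z using that by (auto simp: B_def Q_def)
  have f: "f z = infsum (\<lambda>y. F (g (z, y))) (B z)" if z: "z \<in> Q" for z
  proof -
    obtain v w where vw: "z = (v, w)" by (cases z)
    have pos: "v > 0" "w > 0" using z by (auto simp: vw Q_def)
    have "infsum (\<lambda>y. F (g (z, y))) (B z) = (\<Sum>y\<in>B z. F (g (z, y)))" using finB[OF z] by simp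
    also have "\<dots> = (\<Sum>(d, c)\<in>B (v, w). flag_sum n1 n2 (v div d) (w div c) * of_int v powr (- s) * of_int w powr (- t))"
      unfolding vw by (intro sum.cong refl) (use z in \<open>auto simp: vw intro!: Fg\<close>)
    also have "\<dots> = f z" unfolding f_def vw prod.case loose_sum_eq_flag_sums[OF pos]
      by (simp add: sum_distrib_right B_def split_def)
    finally show ?thesis by simp
  qed
  have Fg_sum: "(\<lambda>z. norm (F (g z))) summable_on Sigma Q B"
    using summable_on_reindex_bij_betw[OF bij, of "\<lambda>z. norm (F z)"] F by simp
  have "(\<lambda>x. infsum (\<lambda>y. norm (F (g (x, y)))) (B x)) summable_on Q"
  proof -
    have "(\<lambda>x. norm (infsum (\<lambda>y. norm (F (g (x, y)))) (B x))) summable_on Q"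
      using Fg_sum unfolding Infinite_Sum.abs_summable_on_Sigma_iff by blast
    thus ?thesis by (rule abs_summable_summable)
  qed
  thus "(\<lambda>z. norm (f z)) summable_on {1..} \<times> {1..}"
    unfolding Q_def[symmetric]
  proof (rule summable_on_comparison_test)
    fix z assume z: "z \<in> Q"
    show "norm (f z) \<le> infsum (\<lambda>y. norm (F (g (z, y)))) (B z)"
      unfolding f[OF z] using finB[OF z] by (simp add: norm_sum)
  qed auto
  have "infsum f Q = infsum (\<lambda>z. infsum (\<lambda>y. F (g (z, y))) (B z)) Q" by (rule infsum_cong) (rule f)
  also have "\<dots> = infsum (\<lambda>z. F (g z)) (Sigma Q B)"
    using infsum_Sigma_banach[of "\<lambda>z. F (g z)" Q B] abs_summable_summable[OF Fg_sum] by simp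
  also have "\<dots> = infsum F (Q \<times> Q)" by (rule infsum_reindex_bij_betw[OF bij])
  finally show "infsum f ({1..} \<times> {1..}) = riemann_zeta s * riemann_zeta t * Rseries s t n1 n2"
    using infF by (simp add: Q_def)
qed

text \<open>
  If the sum over primes were finite, then the Euler product would bound \<open>\<zeta>(s)\<close> uniformly for real
  \<open>s > 1\<close>, hence also the partial sums of the harmonic series, by letting \<open>s\<close> tend to \<open>1\<close>.
\<close>

lemma not_summable_prime_reciprocals:
  "\<not> (\<lambda>p::int. 1 / real_of_int p) summable_on {p. prime p}"
proof
  assume sm: "(\<lambda>p::int. 1 / real_of_int p) summable_on {p. prime p}"
  define C where "C = infsum (\<lambda>p::int. 1 / real_of_int p) {p. prime p}"
  have bound: "norm (riemann_zeta (of_real s)) \<le> exp (2 * C)" if s: "s > 1" for s :: real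
  proof (rule tendsto_upperbound[OF tendsto_norm[OF riemann_zeta_euler_product]])
    show "Re (of_real s) > 1" using s by simp
    have "norm (\<Prod>p\<in>S. 1 / (1 - of_int p powr (- of_real s)) :: complex) \<le> exp (2 * C)"
      if S: "finite S" "S \<subseteq> {p. prime p}" for S
    proof -
      have "norm (\<Prod>p\<in>S. 1 / (1 - of_int p powr (- of_real s)) :: complex)
          = (\<Prod>p\<in>S. norm (1 / (1 - of_int p powr (- of_real s)) :: complex))" by (rule prod_norm[symmetric])
      also have "\<dots> \<le> (\<Prod>p\<in>S. exp (2 * (1 / real_of_int p)))"
      proof (intro prod_mono conjI)
        fix p assume "p \<in> S"
        hence p: "p \<ge> 2" using S prime_ge_2_int by blast
        define t where "t = real_of_int p powr (- s)"
        have "t \<le> real_of_int p powr (- 1)" unfolding t_def using p s by (intro powr_mono) auto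
        moreover have "real_of_int p powr (- 1) = 1 / real_of_int p" using p by (simp add: powr_minus_divide)
        moreover have "0 \<le> t" unfolding t_def by (rule powr_ge_zero)
        ultimately have t: "0 \<le> t" "t \<le> 1 / real_of_int p" by simp_all
        have "1 / real_of_int p \<le> 1 / 2" using p by simp
        hence t2: "t \<le> 1 / 2" using t(2) by linarith
        \<comment> \<open>The inequality \<open>1 / (1 - t) \<le> exp (2 t)\<close> for \<open>0 \<le> t \<le> 1 / 2\<close>.\<close>
        have "t * t \<le> 1 / 2 * t" using t(1) t2 by (intro mult_right_mono)
        hence "- 2 * t \<le> - t - 2 * t\<^sup>2" by (simp add: power2_eq_square)
        also have "\<dots> \<le> ln (1 - t)" using t(1) t2 by (rule ln_one_minus_pos_lower_bound)
        finally have "exp (- 2 * t) \<le> 1 - t" using t2 by (subst (asm) ln_ge_iff) auto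
        hence "inverse (1 - t) \<le> inverse (exp (- 2 * t))" by (intro le_imp_inverse_le) auto
        also have "\<dots> = exp (2 * t)" by (simp add: exp_minus)
        also have "\<dots> \<le> exp (2 * (1 / real_of_int p))" using t by simp
        finally have le: "inverse (1 - t) \<le> exp (2 * (1 / real_of_int p))" .
        have "(of_int p :: complex) powr (- of_real s) = of_real t"
          using p powr_of_real[of "real_of_int p" "- s"] by (simp add: t_def)
        hence "norm (1 / (1 - of_int p powr (- of_real s)) :: complex) = norm (of_real (1 / (1 - t)) :: complex)" by simp
        also have "\<dots> = inverse (1 - t)" using t2 by (simp only: norm_of_real) (simp add: inverse_eq_divide)
        finally show "norm (1 / (1 - of_int p powr (- of_real s)) :: complex) \<le> exp (2 * (1 / real_of_int p))" using le by simp
      qed auto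
      also have "\<dots> = exp (2 * (\<Sum>p\<in>S. 1 / real_of_int p))" using S by (simp add: exp_sum sum_distrib_left)
      also have "\<dots> \<le> exp (2 * C)"
      proof -
        have "(\<Sum>p\<in>S. 1 / real_of_int p) \<le> C" unfolding C_def
          by (rule finite_sum_le_infsum[OF sm S(1)]) (use S prime_gt_0_int in \<open>auto simp: less_imp_le\<close>)
        thus ?thesis by simp
      qed
      finally show ?thesis .
    qed
    thus "eventually (\<lambda>S. norm (\<Prod>p\<in>S. 1 / (1 - of_int p powr (- of_real s)) :: complex) \<le> exp (2 * C)) (finite_subsets_at_top {p. prime p})"
      by (auto intro!: eventually_finite_subsets_at_top_weakI)
  qed simp
  have partial: "(\<Sum>v\<in>{1..M::int}. real_of_int v powr (- s)) \<le> exp (2 * C)" if s: "s > 1" for s :: real and M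
  proof -
    have sms: "(\<lambda>v::int. real_of_int v powr (- s)) summable_on {1..}" by (rule summable_int_powr[OF s])
    have "((\<lambda>v::int. of_real (real_of_int v powr (- s))) has_sum (of_real (infsum (\<lambda>v::int. real_of_int v powr (- s)) {1..}) :: complex)) {1..}"
      using sms by (intro has_sum_of_real) simp
    moreover have "(of_real (real_of_int v powr (- s)) :: complex) = of_int v powr (- of_real s)" if "v \<in> {1..}" for v :: int
      using that powr_of_real[of "real_of_int v" "- s"] by simp
    ultimately have "((\<lambda>v::int. of_int v powr (- of_real s)) has_sum (of_real (infsum (\<lambda>v::int. real_of_int v powr (- s)) {1..}) :: complex)) {1..}"
      by (subst (asm) has_sum_cong) auto
    hence "riemann_zeta (of_real s) = of_real (infsum (\<lambda>v::int. real_of_int v powr (- s)) {1..})"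
      using has_sum_riemann_zeta[of "of_real s"] s has_sum_unique by fastforce
    hence "norm (riemann_zeta (of_real s)) = \<bar>infsum (\<lambda>v::int. real_of_int v powr (- s)) {1..}\<bar>" by simp
    moreover have "(\<Sum>v\<in>{1..M::int}. real_of_int v powr (- s)) \<le> infsum (\<lambda>v::int. real_of_int v powr (- s)) {1..}"
      by (rule finite_sum_le_infsum[OF sms]) auto
    ultimately show ?thesis using bound[OF s] by linarith
  qed
  have harm: "(\<Sum>v\<in>{1..M::int}. 1 / real_of_int v) \<le> exp (2 * C)" for M
  proof (rule tendsto_upperbound)
    have "((\<lambda>s. \<Sum>v\<in>{1..M::int}. real_of_int v powr (- s)) \<longlongrightarrow> (\<Sum>v\<in>{1..M::int}. real_of_int v powr (- 1))) (at_right 1)"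
      by (intro tendsto_intros) auto
    thus "((\<lambda>s. \<Sum>v\<in>{1..M::int}. real_of_int v powr (- s)) \<longlongrightarrow> (\<Sum>v\<in>{1..M::int}. 1 / real_of_int v)) (at_right 1)"
      by (simp add: powr_minus_divide)
    show "eventually (\<lambda>s. (\<Sum>v\<in>{1..M::int}. real_of_int v powr (- s)) \<le> exp (2 * C)) (at_right 1)"
      using partial by (auto simp: eventually_at_filter)
  qed simp
  have "summable (\<lambda>n. inverse (real (Suc n)))"
  proof (rule summableI_nonneg_bounded)
    fix N
    have "(\<Sum>n<N. inverse (real (Suc n))) = (\<Sum>v\<in>{1..int N}. 1 / real_of_int v)"
      by (rule sum.reindex_bij_witness[of _ "\<lambda>v. nat v - 1" "\<lambda>n. int (Suc n)"]) (auto simp: inverse_eq_divide)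
    thus "(\<Sum>n<N. inverse (real (Suc n))) \<le> exp (2 * C)" using harm by simp
  qed simp
  hence "summable (\<lambda>n. inverse (real n))" by (subst (asm) summable_Suc_iff)
  thus False using not_summable_harmonic[where 'a = real] by simp
qed

lemma exponent_gt_1_if_prime_powers_summable:
  fixes \<sigma> :: real and n :: int
  assumes sm: "(\<lambda>p::int. of_int p powr (- \<sigma>)) summable_on {p. prime p \<and> (n \<noteq> 0 \<longrightarrow> \<not> p dvd n)}"
  shows "\<sigma> > 1"
proof (rule ccontr)
  assume "\<not> \<sigma> > 1"
  define A where "A = {p :: int. prime p \<and> (n \<noteq> 0 \<longrightarrow> \<not> p dvd n)}"
  define D where "D = {p :: int. prime p \<and> n \<noteq> 0 \<and> p dvd n}"
  have "(\<lambda>p::int. 1 / real_of_int p) summable_on A"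
  proof (rule summable_on_comparison_test[OF sm[folded A_def]])
    fix p assume "p \<in> A"
    hence p: "p > 1" by (auto simp: A_def prime_gt_1_int)
    have "real_of_int p powr (- 1) \<le> of_int p powr (- \<sigma>)" using p \<open>\<not> \<sigma> > 1\<close> by (intro powr_mono) auto
    thus "1 / real_of_int p \<le> of_int p powr (- \<sigma>)" using p by (simp add: powr_minus_divide)
  qed (auto simp: A_def prime_ge_0_int)
  moreover have "finite D"
  proof (cases "n = 0")
    case False
    show ?thesis by (rule finite_subset[of _ "{d. d > 0 \<and> d dvd \<bar>n\<bar>}"]) (use False in \<open>auto simp: D_def prime_gt_0_int\<close>)
  qed (simp add: D_def)
  ultimately have "(\<lambda>p::int. 1 / real_of_int p) summable_on A \<union> D"
    by (intro summable_on_union) auto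
  also have "A \<union> D = {p. prime p}" by (auto simp: A_def D_def)
  finally show False using not_summable_prime_reciprocals by blast
qed

text \<open>
  The sums without coprimality conditions are immediate when one modulus is \<open>1\<close> and the other one
  is prime, and they exceed the sums with these conditions by the term \<open>1\<close> at \<open>(1, 1)\<close>.
\<close>

lemma flag_sum_prime:
  fixes p :: int assumes p: "prime p"
  shows "flag_sum n1 n2 p 1 = (if p dvd n1 then of_int p else 0) - 1"
    and "flag_sum n1 n2 1 p = (if p dvd n2 then of_int p else 0) - 1"
proof -
  have p0: "p > 0" using p by (rule prime_gt_0_int)
  have div1: "{d. d > 0 \<and> d dvd 1} = {1 :: int}" by auto
  have divp: "{d. d > 0 \<and> d dvd p} = {1, p}"
    using p p0 unfolding prime_int_iff by (auto dest: less_imp_le)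
  have p1: "p \<noteq> 1" using p by auto
  have res: "{0..<1} = {0 :: int}" by auto
  have one: "flag_sum n1 n2 1 1 = 1"
    using loose_sum_eq_flag_sums[of 1 1 n1 n2] loose_sum_eq[of 1 1 n1 n2] unfolding div1
    by (simp add: ramanujan_sum_def fibre_sum_def res)
  have "loose_sum n1 n2 p 1 = (if p dvd n1 then of_int p else 0)"
    using loose_sum_eq[OF p0, of 1 n1 n2] unfolding div1
    by (simp add: ramanujan_sum_def fibre_sum_def res)
  moreover have "loose_sum n1 n2 p 1 = flag_sum n1 n2 p 1 + 1"
    using loose_sum_eq_flag_sums[OF p0, of 1 n1 n2] p0 p1 unfolding div1 divp
    by (simp add: one sum.cartesian_product[symmetric])
  ultimately show "flag_sum n1 n2 p 1 = (if p dvd n1 then of_int p else 0) - 1"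
    by (simp add: eq_diff_eq)
  have "loose_sum n1 n2 1 p = ramanujan_sum p n2 + ramanujan_sum 1 n2"
    using loose_sum_eq[of 1 p n1 n2] p0 p1 unfolding divp by (simp add: fibre_sum_def res)
  also have "\<dots> = (if p dvd n2 then of_int p else 0)"
    using ramanujan_sum_prime_power[OF p, of 0 n2] ramanujan_sum_1 by simp
  finally have "loose_sum n1 n2 1 p = (if p dvd n2 then of_int p else 0)" .
  moreover have "loose_sum n1 n2 1 p = flag_sum n1 n2 1 p + 1"
    using loose_sum_eq_flag_sums[of 1 p n1 n2] p0 p1 unfolding div1 divp
    by (simp add: one sum.cartesian_product[symmetric])
  ultimately show "flag_sum n1 n2 1 p = (if p dvd n2 then of_int p else 0) - 1"
    by (simp add: eq_diff_eq)
qed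

text \<open>
  For \<open>n \<noteq> 0\<close> almost all terms have norm \<open>p powr (- Re \<nu>)\<close>, for \<open>n = 0\<close> the norm is
  \<open>(p - 1) p powr (- Re \<nu>)\<close>, so the bound follows from the divergence of the sum of the reciprocals of
  the primes.
\<close>

lemma Re_bound_if_prime_terms_summable:
  fixes n :: int
  assumes sm: "(\<lambda>p::int. norm (of_int p powr (- \<nu>) * ((if p dvd n then of_int p else 0) - 1) :: complex)) summable_on {p. prime p}"
  shows "Re \<nu> > (if n = 0 then 2 else 1)"
proof (cases "n = 0")
  case False
  have "(\<lambda>p::int. of_int p powr (- Re \<nu>) :: real) summable_on {p. prime p \<and> (n \<noteq> 0 \<longrightarrow> \<not> p dvd n)}"
  proof -
    have "(\<lambda>p::int. norm (of_int p powr (- \<nu>) * ((if p dvd n then of_int p else 0) - 1) :: complex)) summable_on {p. prime p \<and> (n \<noteq> 0 \<longrightarrow> \<not> p dvd n)}"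
      by (rule summable_on_subset_banach[OF sm]) auto
    thus ?thesis using False
      by (subst (asm) summable_on_cong[where g = "\<lambda>p. of_int p powr (- Re \<nu>)"]) (auto simp: norm_int_powr prime_gt_0_int norm_mult)
  qed
  from exponent_gt_1_if_prime_powers_summable[OF this] show ?thesis using False by simp
next
  case True
  have "(\<lambda>p::int. of_int p powr (- (Re \<nu> - 1)) :: real) summable_on {p. prime p \<and> (n \<noteq> 0 \<longrightarrow> \<not> p dvd n)}"
  proof (rule summable_on_comparison_test[OF summable_on_cmult_right[OF sm, of 2, THEN summable_on_subset_banach]])
    fix p :: int assume "p \<in> {p. prime p \<and> (n \<noteq> 0 \<longrightarrow> \<not> p dvd n)}"
    hence p: "p \<ge> 2" using prime_ge_2_int by auto
    have e: "(of_int p :: real) powr (- (Re \<nu> - 1)) = of_int p powr (- Re \<nu>) * of_int p"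
      using p by (simp add: powr_diff[symmetric] powr_mult_base mult.commute)
    have "norm (of_int p - 1 :: complex) = of_int p - 1"
    proof -
      have "(of_int p - 1 :: complex) = of_int (p - 1)" by simp
      thus ?thesis using p by (simp only: norm_of_int)
    qed
    hence "2 * norm (of_int p powr (- \<nu>) * ((if p dvd n then of_int p else 0) - 1) :: complex)
        = of_int p powr (- Re \<nu>) * (2 * (of_int p - 1))"
      using p True by (simp add: norm_mult norm_int_powr)
    also have "\<dots> \<ge> of_int p powr (- Re \<nu>) * of_int p" using p by (intro mult_left_mono) auto
    finally show "(of_int p :: real) powr (- (Re \<nu> - 1)) \<le> 2 * norm (of_int p powr (- \<nu>) * ((if p dvd n then of_int p else 0) - 1) :: complex)"
      unfolding e .
  qed (use True in auto)
  from exponent_gt_1_if_prime_powers_summable[OF this] show ?thesis using True by simp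
qed

text \<open>
  Absolute convergence is tested on the terms \<open>(p, 1)\<close> and \<open>(1, p)\<close>. The resulting bounds put
  every zeta value in the evaluation into the half plane of absolute convergence.
\<close>

lemma R_abs_conv_imp_Re:
  assumes R: "(s, t) \<in> R_abs_conv n1 n2"
  shows "Re s > (if n1 = 0 then 2 else 1)" "Re t > (if n2 = 0 then 2 else 1)"
proof -
  have sm: "(\<lambda>z. norm (R_term s t n1 n2 z)) summable_on {1..} \<times> {1..}"
    using R by (simp add: R_abs_conv_def)
  have b1: "bij_betw (\<lambda>p. (p, 1::int)) {p::int. prime p} ({p. prime p} \<times> {1})" by (auto simp: bij_betw_def inj_on_def)
  have "(\<lambda>z. norm (R_term s t n1 n2 z)) summable_on ({p. prime p} \<times> {1})"
    by (rule summable_on_subset_banach[OF sm]) (auto simp: prime_ge_1_int)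
  hence "(\<lambda>p::int. norm (R_term s t n1 n2 (p, 1))) summable_on {p. prime p}"
    using summable_on_reindex_bij_betw[OF b1, of "\<lambda>z. norm (R_term s t n1 n2 z)"] by simp
  hence "(\<lambda>p::int. norm (of_int p powr (- s) * ((if p dvd n1 then of_int p else 0) - 1) :: complex)) summable_on {p. prime p}"
    by (subst (asm) summable_on_cong) (auto simp: R_term_eq flag_sum_prime)
  thus "Re s > (if n1 = 0 then 2 else 1)" by (rule Re_bound_if_prime_terms_summable)
  have b2: "bij_betw (\<lambda>p. (1::int, p)) {p::int. prime p} ({1} \<times> {p. prime p})" by (auto simp: bij_betw_def inj_on_def)
  have "(\<lambda>z. norm (R_term s t n1 n2 z)) summable_on ({1} \<times> {p. prime p})"
    by (rule summable_on_subset_banach[OF sm]) (auto simp: prime_ge_1_int)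
  hence "(\<lambda>p::int. norm (R_term s t n1 n2 (1, p))) summable_on {p. prime p}"
    using summable_on_reindex_bij_betw[OF b2, of "\<lambda>z. norm (R_term s t n1 n2 z)"] by simp
  hence "(\<lambda>p::int. norm (of_int p powr (- t) * ((if p dvd n2 then of_int p else 0) - 1) :: complex)) summable_on {p. prime p}"
    by (subst (asm) summable_on_cong) (auto simp: R_term_eq flag_sum_prime)
  thus "Re t > (if n2 = 0 then 2 else 1)" by (rule Re_bound_if_prime_terms_summable)
qed

section \<open>Evaluation\<close>

lemma loose_series_euler_product:
  assumes R: "(s, t) \<in> R_abs_conv n1 n2"
  shows "((\<lambda>S. \<Prod>p\<in>S. euler_factor (of_int p powr (1 - s)) (of_int p powr (1 - t)) (of_int p powr (- t)) (tail_power p n1) (tail_power p n2))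
     \<longlongrightarrow> riemann_zeta s * riemann_zeta t * Rseries s t n1 n2) (finite_subsets_at_top {p. prime p})"
proof -
  have re: "Re s > 1" "Re t > 1" using R_abs_conv_imp_Re[OF R] by (auto split: if_splits)
  define f where "f = (\<lambda>(v, w). loose_sum n1 n2 v w * of_int v powr (- s) * of_int w powr (- t))"
  have sm: "(\<lambda>z. norm (f z)) summable_on {1..} \<times> {1..}"
    and val: "infsum f ({1..} \<times> {1..}) = riemann_zeta s * riemann_zeta t * Rseries s t n1 n2"
    unfolding f_def by (rule loose_series[OF R re])+
  show ?thesis unfolding val[symmetric]
  proof (rule euler_product_tendsto[OF sm])
    have "loose_index 1 1 = {(0, 0, 0, 0)}" by (auto simp: loose_index_def)
    thus "f (1, 1) = 1" by (simp add: f_def loose_sum_def)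
  next
    fix v w v' w' :: int assume *: "v > 0" "w > 0" "v' > 0" "w' > 0" "coprime (v * w) (v' * w')"
    show "f (v * v', w * w') = f (v, w) * f (v', w')"
      unfolding f_def prod.case loose_sum_mult[OF *] int_powr_mult[OF *(1,3)] int_powr_mult[OF *(2,4)]
      by (simp add: mult_ac)
  next
    fix p :: int assume p: "prime p"
    have p1: "p > 1" using p by (rule prime_gt_1_int)
    have pX: "of_int p * of_int p powr (- \<nu>) = (of_int p powr (1 - \<nu>) :: complex)" for \<nu>
      using p1 by (simp add: powr_diff powr_minus field_simps)
    have lt: "norm (of_int p powr (1 - \<nu>) :: complex) < 1" if "Re \<nu> > 1" for \<nu>
      using norm_prime_powr_less_1[OF p, of "\<nu> - 1"] that by simp
    have "((\<lambda>(k, l). loose_sum n1 n2 (p ^ k) (p ^ l) * (of_int p powr (- s)) ^ k * (of_int p powr (- t)) ^ l) has_sum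
       euler_factor (of_int p powr (1 - s)) (of_int p powr (1 - t)) (of_int p powr (- t)) (tail_power p n1) (tail_power p n2)) UNIV"
      using has_sum_loose_local_general[OF p, of "of_int p powr (- s)" "of_int p powr (- t)" n1 n2]
      unfolding pX using lt re by simp
    thus "((\<lambda>(k, l). f (p ^ k, p ^ l)) has_sum
       euler_factor (of_int p powr (1 - s)) (of_int p powr (1 - t)) (of_int p powr (- t)) (tail_power p n1) (tail_power p n2)) UNIV"
      using p1 by (simp add: f_def int_power_powr del: of_int_power)
  qed
qed

lemma inverse_zeta_euler_product:
  assumes s: "Re s > 1"
  shows "((\<lambda>S. \<Prod>p\<in>S. 1 - of_int p powr (- s)) \<longlongrightarrow> 1 / riemann_zeta s) (finite_subsets_at_top {p. prime p})"
  using tendsto_divide[OF tendsto_const riemann_zeta_euler_product[OF s] riemann_zeta_nonzero[OF s], of 1]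
  by (simp add: prod_dividef)

definition local_schur :: "complex \<Rightarrow> complex \<Rightarrow> int \<Rightarrow> int \<Rightarrow> int \<Rightarrow> complex" where
  "local_schur s t n m p =
     schur_factor (of_int p powr (1 - s)) (of_int p powr (1 - t)) (tail_power p n) (tail_power p m)"

lemma prime_powr_products:
  fixes p :: int assumes "p > 0"
  shows "(of_int p :: complex) powr (1 - s) * of_int p powr (1 - t) = of_int p powr (- (s + t - 2))"
    and "(of_int p :: complex) powr (1 - s) * (of_int p powr (1 - t))\<^sup>2 = of_int p powr (- (s + 2 * t - 3))"
    and "(of_int p :: complex) powr (1 - s) * of_int p powr (- t) = of_int p powr (- (s + t - 1))"
    and "(of_int p :: complex) powr (1 - s) * of_int p powr (1 - t) * of_int p powr (- t) = of_int p powr (- (s + 2 * t - 2))"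
  unfolding power2_eq_square using assms by (simp_all add: powr_add[symmetric] algebra_simps)

text \<open>
  Two of the four inverse zeta functions come from removing the coprimality conditions, the other
  two from the factors \<open>1 - x Y\<close> and \<open>1 - x y Y\<close> of the local generating functions.
\<close>

lemma Rseries_eq_limit:
  assumes R: "(s, t) \<in> R_abs_conv n m"
    and L: "((\<lambda>S. \<Prod>p\<in>S. local_schur s t n m p) \<longlongrightarrow> L) (finite_subsets_at_top {p. prime p})"
  shows "Rseries s t n m
     = L / (riemann_zeta s * riemann_zeta t * riemann_zeta (s + t - 1) * riemann_zeta (s + 2 * t - 2))"
proof -
  let ?F = "finite_subsets_at_top {p :: int. prime p}"
  define s3 s4 where "s3 = s + t - 1" and "s4 = s + 2 * t - 2"
  have re: "Re s > 1" "Re t > 1" using R_abs_conv_imp_Re[OF R] by (auto split: if_splits)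
  have re34: "Re s3 > 1" "Re s4 > 1" using re by (simp_all add: s3_def s4_def)
  have "((\<lambda>S. (\<Prod>p\<in>S. 1 - of_int p powr (- s3)) * (\<Prod>p\<in>S. 1 - of_int p powr (- s4)) * (\<Prod>p\<in>S. local_schur s t n m p))
      \<longlongrightarrow> 1 / riemann_zeta s3 * (1 / riemann_zeta s4) * L) ?F"
    by (intro tendsto_mult inverse_zeta_euler_product re34 L)
  moreover have "((\<lambda>S. (\<Prod>p\<in>S. 1 - of_int p powr (- s3)) * (\<Prod>p\<in>S. 1 - of_int p powr (- s4)) * (\<Prod>p\<in>S. local_schur s t n m p))
      \<longlongrightarrow> riemann_zeta s * riemann_zeta t * Rseries s t n m) ?F"
  proof (rule Lim_transform_eventually[OF loose_series_euler_product[OF R]], intro eventually_finite_subsets_at_top_weakI)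
    fix S assume S: "finite S" "S \<subseteq> {p :: int. prime p}"
    show "(\<Prod>p\<in>S. euler_factor (of_int p powr (1 - s)) (of_int p powr (1 - t)) (of_int p powr (- t)) (tail_power p n) (tail_power p m))
       = (\<Prod>p\<in>S. 1 - of_int p powr (- s3)) * (\<Prod>p\<in>S. 1 - of_int p powr (- s4)) * (\<Prod>p\<in>S. local_schur s t n m p)"
      unfolding prod.distrib[symmetric]
    proof (rule prod.cong[OF refl])
      fix p assume "p \<in> S"
      hence "p > 0" using S prime_gt_0_int by blast
      thus "euler_factor (of_int p powr (1 - s)) (of_int p powr (1 - t)) (of_int p powr (- t)) (tail_power p n) (tail_power p m)
         = (1 - of_int p powr (- s3)) * (1 - of_int p powr (- s4)) * local_schur s t n m p"
        unfolding euler_factor_def local_schur_def s3_def s4_def by (simp only: prime_powr_products(3,4))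
    qed
  qed
  ultimately have "riemann_zeta s * riemann_zeta t * Rseries s t n m = 1 / riemann_zeta s3 * (1 / riemann_zeta s4) * L"
    using tendsto_unique[OF finite_subsets_at_top_neq_bot] by blast
  thus ?thesis
    using riemann_zeta_nonzero[OF re(1)] riemann_zeta_nonzero[OF re(2)]
      riemann_zeta_nonzero[OF re34(1)] riemann_zeta_nonzero[OF re34(2)]
    unfolding s3_def[symmetric] s4_def[symmetric] by (simp add: field_simps)
qed

text \<open>
  At primes that do not divide \<open>n m\<close> the character is that of the trivial representation.
\<close>

lemma local_schur_product_nonzero:
  assumes re: "Re s > 1" "Re t > 1" and nm: "n \<noteq> 0" "m \<noteq> 0"
  shows "((\<lambda>S. \<Prod>p\<in>S. local_schur s t n m p) \<longlongrightarrow> sigma2 (3/2 - s/2 - t) (1/2 - s/2) n m)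
     (finite_subsets_at_top {p. prime p})"
proof -
  define P where "P = {p :: int. prime p \<and> p dvd n * m}"
  have fin: "finite P"
    by (rule finite_subset[of _ "{d. d > 0 \<and> d dvd \<bar>n * m\<bar>}"]) (use nm in \<open>auto simp: P_def prime_gt_0_int\<close>)
  have sub: "P \<subseteq> {p. prime p}" by (auto simp: P_def)
  have nz: "weyl_denominator (of_int p powr (1 - s)) (of_int p powr (1 - t)) \<noteq> 0" if p: "prime p" for p :: int
  proof -
    have "norm (of_int p powr (1 - s) :: complex) < 1" "norm (of_int p powr (1 - t) :: complex) < 1"
      using norm_prime_powr_less_1[OF p, of "s - 1"] norm_prime_powr_less_1[OF p, of "t - 1"] re by simp_all
    from not_one[OF this] show ?thesis by (simp add: weyl_denominator_def)
  qed
  have loc: "sigma2_local (3/2 - s/2 - t) (1/2 - s/2) p (multiplicity p n) (multiplicity p m) = local_schur s t n m p"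
    if p: "prime p" for p
  proof -
    have 1: "1/2 - s/2 + (1/2 - s/2) = 1 - s" "1 - t + (1/2 - s/2) = 3/2 - s/2 - t" by (simp_all add: field_simps)
    have 2: "of_int p powr (1 - s) = (of_int p powr (1/2 - s/2))\<^sup>2"
        "of_int p powr (3/2 - s/2 - t) = of_int p powr (1 - t) * of_int p powr (1/2 - s/2)"
      by (simp_all only: power2_eq_square powr_add[symmetric] 1)
    have "tail_power p n = (\<lambda>z. z ^ Suc (multiplicity p n))" "tail_power p m = (\<lambda>z. z ^ Suc (multiplicity p m))"
      using nm by (auto simp: tail_power_def fun_eq_iff)
    thus ?thesis unfolding local_schur_def by (simp only: sigma2_local_eq[OF p 2 nz[OF p]])
  qed
  show ?thesis
  proof (rule tendsto_eventually, unfold eventually_finite_subsets_at_top,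
      intro exI[of _ P] conjI fin sub allI impI, elim conjE)
    fix S assume S: "finite S" "P \<subseteq> S" "S \<subseteq> {p :: int. prime p}"
    have one: "local_schur s t n m p = 1" if "p \<in> S - P" for p
    proof -
      have p: "prime p" "\<not> p dvd n * m" using that S by (auto simp: P_def)
      hence "multiplicity p n = 0" "multiplicity p m = 0"
        by (auto intro!: not_dvd_imp_multiplicity_0)
      thus ?thesis using nz[OF p(1)] nm
        by (simp add: local_schur_def schur_factor_def tail_power_def schur_factor_numerator_0)
    qed
    have "(\<Prod>p\<in>S. local_schur s t n m p) = (\<Prod>p\<in>P. local_schur s t n m p)"
      by (rule prod.mono_neutral_right) (use S one in auto)
    also have "\<dots> = sigma2 (3/2 - s/2 - t) (1/2 - s/2) n m"
      unfolding sigma2_def P_def by (rule prod.cong) (auto simp: loc)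
    finally show "(\<Prod>p\<in>S. local_schur s t n m p) = sigma2 (3/2 - s/2 - t) (1/2 - s/2) n m" .
  qed
qed

lemma shifted_zeta_euler_product:
  assumes "Re s > 1" "\<And>p. prime p \<Longrightarrow> g p = of_int p powr (- s)"
  shows "((\<lambda>S. \<Prod>p\<in>S. 1 / (1 - g p)) \<longlongrightarrow> riemann_zeta s) (finite_subsets_at_top {p :: int. prime p})"
  by (rule Lim_transform_eventually[OF riemann_zeta_euler_product[OF assms(1)]])
    (auto intro!: eventually_finite_subsets_at_top_weakI prod.cong simp: assms(2) subset_eq)

text \<open>
  If \<open>n\<close> or \<open>m\<close> vanishes, then the numerator of the character factors into a part for each of the two
  simple roots, and the Weyl denominator supplies four zeta functions.
\<close>

lemma local_schur_product_vanishing: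
  assumes a: "((\<lambda>S. \<Prod>p\<in>S. a p / (1 - of_int p powr (1 - s))) \<longlongrightarrow> La) (finite_subsets_at_top {p. prime p})"
    and b: "((\<lambda>S. \<Prod>p\<in>S. b p / (1 - of_int p powr (1 - t))) \<longlongrightarrow> Lb) (finite_subsets_at_top {p. prime p})"
    and re: "Re (s + t - 2) > 1" "Re (s + 2 * t - 3) > 1"
    and eq: "\<And>p. prime p \<Longrightarrow> local_schur s t n m p
       = a p * b p / weyl_denominator (of_int p powr (1 - s)) (of_int p powr (1 - t))"
  shows "((\<lambda>S. \<Prod>p\<in>S. local_schur s t n m p) \<longlongrightarrow> La * Lb * riemann_zeta (s + t - 2) * riemann_zeta (s + 2 * t - 3))
     (finite_subsets_at_top {p. prime p})"
proof (rule Lim_transform_eventually)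
  show "((\<lambda>S. (\<Prod>p\<in>S. a p / (1 - of_int p powr (1 - s))) * (\<Prod>p\<in>S. b p / (1 - of_int p powr (1 - t)))
      * (\<Prod>p\<in>S. 1 / (1 - of_int p powr (1 - s) * of_int p powr (1 - t)))
      * (\<Prod>p\<in>S. 1 / (1 - of_int p powr (1 - s) * (of_int p powr (1 - t))\<^sup>2)))
     \<longlongrightarrow> La * Lb * riemann_zeta (s + t - 2) * riemann_zeta (s + 2 * t - 3)) (finite_subsets_at_top {p. prime p})"
    by (intro tendsto_mult a b shifted_zeta_euler_product re prime_powr_products prime_gt_0_int)
  show "eventually (\<lambda>S. (\<Prod>p\<in>S. a p / (1 - of_int p powr (1 - s))) * (\<Prod>p\<in>S. b p / (1 - of_int p powr (1 - t)))
      * (\<Prod>p\<in>S. 1 / (1 - of_int p powr (1 - s) * of_int p powr (1 - t)))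
      * (\<Prod>p\<in>S. 1 / (1 - of_int p powr (1 - s) * (of_int p powr (1 - t))\<^sup>2))
     = (\<Prod>p\<in>S. local_schur s t n m p)) (finite_subsets_at_top {p. prime p})"
    unfolding prod.distrib[symmetric]
    by (intro eventually_finite_subsets_at_top_weakI prod.cong refl)
      (auto simp: eq weyl_denominator_def subset_eq)
qed

theorem proposition5p2:
  fixes n\<^sub>1 n\<^sub>2 :: int and \<nu>\<^sub>1 \<nu>\<^sub>2 :: complex
  assumes "(\<nu>\<^sub>1, \<nu>\<^sub>2) \<in> R_abs_conv n\<^sub>1 n\<^sub>2"
  shows "(n\<^sub>1 \<noteq> 0 \<and> n\<^sub>2 \<noteq> 0 \<longrightarrow>
           Rseries \<nu>\<^sub>1 \<nu>\<^sub>2 n\<^sub>1 n\<^sub>2 =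
             sigma2 (3/2 - \<nu>\<^sub>1/2 - \<nu>\<^sub>2) (1/2 - \<nu>\<^sub>1/2) n\<^sub>1 n\<^sub>2
             / (riemann_zeta \<nu>\<^sub>1 * riemann_zeta \<nu>\<^sub>2
                * riemann_zeta (\<nu>\<^sub>1 + \<nu>\<^sub>2 - 1) * riemann_zeta (\<nu>\<^sub>1 + 2 * \<nu>\<^sub>2 - 2)))
       \<and> (n\<^sub>1 \<noteq> 0 \<and> n\<^sub>2 = 0 \<longrightarrow>
           Rseries \<nu>\<^sub>1 \<nu>\<^sub>2 n\<^sub>1 n\<^sub>2 =
             sigma1 (1 - \<nu>\<^sub>1) n\<^sub>1 / riemann_zeta \<nu>\<^sub>1
             * (riemann_zeta (\<nu>\<^sub>2 - 1) / riemann_zeta \<nu>\<^sub>2)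
             * (riemann_zeta (\<nu>\<^sub>1 + \<nu>\<^sub>2 - 2) / riemann_zeta (\<nu>\<^sub>1 + \<nu>\<^sub>2 - 1))
             * (riemann_zeta (\<nu>\<^sub>1 + 2 * \<nu>\<^sub>2 - 3) / riemann_zeta (\<nu>\<^sub>1 + 2 * \<nu>\<^sub>2 - 2)))
       \<and> (n\<^sub>1 = 0 \<and> n\<^sub>2 \<noteq> 0 \<longrightarrow>
           Rseries \<nu>\<^sub>1 \<nu>\<^sub>2 n\<^sub>1 n\<^sub>2 =
             sigma1 (1 - \<nu>\<^sub>2) n\<^sub>2 / riemann_zeta \<nu>\<^sub>2
             * (riemann_zeta (\<nu>\<^sub>1 - 1) / riemann_zeta \<nu>\<^sub>1)
             * (riemann_zeta (\<nu>\<^sub>1 + \<nu>\<^sub>2 - 2) / riemann_zeta (\<nu>\<^sub>1 + \<nu>\<^sub>2 - 1))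
             * (riemann_zeta (\<nu>\<^sub>1 + 2 * \<nu>\<^sub>2 - 3) / riemann_zeta (\<nu>\<^sub>1 + 2 * \<nu>\<^sub>2 - 2)))
       \<and> (n\<^sub>1 = 0 \<and> n\<^sub>2 = 0 \<longrightarrow>
           Rseries \<nu>\<^sub>1 \<nu>\<^sub>2 n\<^sub>1 n\<^sub>2 =
             (riemann_zeta (\<nu>\<^sub>1 - 1) / riemann_zeta \<nu>\<^sub>1)
             * (riemann_zeta (\<nu>\<^sub>2 - 1) / riemann_zeta \<nu>\<^sub>2)
             * (riemann_zeta (\<nu>\<^sub>1 + \<nu>\<^sub>2 - 2) / riemann_zeta (\<nu>\<^sub>1 + \<nu>\<^sub>2 - 1))
             * (riemann_zeta (\<nu>\<^sub>1 + 2 * \<nu>\<^sub>2 - 3) / riemann_zeta (\<nu>\<^sub>1 + 2 * \<nu>\<^sub>2 - 2)))"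
proof -
  note re = R_abs_conv_imp_Re[OF assms]
  note series = Rseries_eq_limit[OF assms]
  have re2: "Re (\<nu>\<^sub>1 + \<nu>\<^sub>2 - 2) > 1" "Re (\<nu>\<^sub>1 + 2 * \<nu>\<^sub>2 - 3) > 1" if "n\<^sub>1 = 0 \<or> n\<^sub>2 = 0"
    using re that by (auto split: if_splits)
  have zeta: "((\<lambda>S. \<Prod>p\<in>S. 1 / (1 - of_int p powr (1 - z))) \<longlongrightarrow> riemann_zeta (z - 1)) (finite_subsets_at_top {p :: int. prime p})"
    if "Re z > 2" for z using that by (intro shifted_zeta_euler_product) auto
  show ?thesis
  proof (intro conjI impI, goal_cases)
    case 1
    show ?case by (rule series) (use 1 re in \<open>auto intro!: local_schur_product_nonzero split: if_splits\<close>)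
  next
    case 2
    have "((\<lambda>S. \<Prod>p\<in>S. local_schur \<nu>\<^sub>1 \<nu>\<^sub>2 n\<^sub>1 n\<^sub>2 p) \<longlongrightarrow> sigma1 (1 - \<nu>\<^sub>1) n\<^sub>1 * riemann_zeta (\<nu>\<^sub>2 - 1)
        * riemann_zeta (\<nu>\<^sub>1 + \<nu>\<^sub>2 - 2) * riemann_zeta (\<nu>\<^sub>1 + 2 * \<nu>\<^sub>2 - 3)) (finite_subsets_at_top {p. prime p})"
      by (rule local_schur_product_vanishing[OF sigma1_euler_product zeta])
        (use 2 re re2 in \<open>auto simp: local_schur_def schur_factor_def tail_power_def\<close>)
    from series[OF this] show ?case by simp
  next
    case 3
    have "((\<lambda>S. \<Prod>p\<in>S. local_schur \<nu>\<^sub>1 \<nu>\<^sub>2 n\<^sub>1 n\<^sub>2 p) \<longlongrightarrow> riemann_zeta (\<nu>\<^sub>1 - 1) * sigma1 (1 - \<nu>\<^sub>2) n\<^sub>2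
        * riemann_zeta (\<nu>\<^sub>1 + \<nu>\<^sub>2 - 2) * riemann_zeta (\<nu>\<^sub>1 + 2 * \<nu>\<^sub>2 - 3)) (finite_subsets_at_top {p. prime p})"
      by (rule local_schur_product_vanishing[OF zeta sigma1_euler_product])
        (use 3 re re2 in \<open>auto simp: local_schur_def schur_factor_def tail_power_def\<close>)
    from series[OF this] show ?case by (simp add: mult_ac)
  next
    case 4
    have "((\<lambda>S. \<Prod>p\<in>S. local_schur \<nu>\<^sub>1 \<nu>\<^sub>2 n\<^sub>1 n\<^sub>2 p) \<longlongrightarrow> riemann_zeta (\<nu>\<^sub>1 - 1) * riemann_zeta (\<nu>\<^sub>2 - 1)
        * riemann_zeta (\<nu>\<^sub>1 + \<nu>\<^sub>2 - 2) * riemann_zeta (\<nu>\<^sub>1 + 2 * \<nu>\<^sub>2 - 3)) (finite_subsets_at_top {p. prime p})"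
      by (rule local_schur_product_vanishing[OF zeta zeta])
        (use 4 re re2 in \<open>auto simp: local_schur_def schur_factor_def tail_power_def\<close>)
    from series[OF this] show ?case by simp
  qed
qed

end
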